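(* Let $\sigma\in\{-1,1\}$. (i) Let $k=2$ and $s>3$. There is a real-valued $$u\in\bigcap_{\epsilon>0}C_t^0L_x^{k-\epsilon}([0,1]\times\mathbb T)\setminus\{0\}$$ such that $\mathbb P_{\neq0}(u^2)$ exists as an element of $C_t^0\dot H_x^{-s}([0,1]\times\mathbb T)$ in the sense of absolute summability, and such that $u$ is a weak singular solution of $$\partial_tu+\partial_{xxx}u+\sigma\partial_x(u^k)=0$$ with initial data $u_0=0$, and $u(0,x)=0$. (ii) Let $k\ge3$ be an integer and $s>3$. There is a real-valued $$u\in\bigcap_{\epsilon>0}C_t^0H_x^{\frac12-\frac1k-\epsilon}([0,1]\times\mathbb T)\setminus\{0\}$$ such that $\mathbb P_{\neq0}(u^k)$ exists as an element of $C_t^0\dot H_x^{-s}([0,1]\times\mathbb T)$ in the sense of absolute summability, and such that $u$ is a weak singular solution of $$\partial_tu+\partial_{xxx}u+\sigma\partial_x(u^k)=0$$ with initial data $u_0=0$, and $u(0,x)=0$.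
   Context: $\mathbb T=\mathbb R/\mathbb Z$ (identified with $[0,1]$). $C_t^0X_x([0,1]\times\mathbb T)$ is the space of continuous maps $[0,1]\to X(\mathbb T)$, with the supremum norm; in the intersection of the spaces $L^{k-\epsilon}$ only $\epsilon$ with $k-\epsilon\ge1$ matter. Fourier coefficients: $\hat f(t,\xi)=\langle f(t,\cdot),e^{-2\pi i\xi x}\rangle$, $\xi\in\mathbb Z$. For $s\in\mathbb R$, $\dot H^s(\mathbb T)$ has norm $(\sum_{\xi\ne0}|\xi|^{2s}|\hat f(\xi)|^2)^{1/2}$. The pairing $\langle\cdot,\cdot\rangle_{H^r,H^{-r}}$ is the usual duality extending $\int_{\mathbb T}fg\,dx$, and $\langle\cdot,\cdot\rangle_{\dot H^r,\dot H^{-r}}$ is the same with only nonzero frequencies contributing. Absolute summability. For $u_1,\dots,u_k\in C_t^0\mathcal D'_x([0,1]\times\mathbb T)$ and $s\in\mathbb R$, $\mathbb P_{\neq0}(u_1\cdots u_k)$ is said to be well defined (to exist) as an element of $C_t^0\dot H^s_x([0,1]\times\mathbb T)$ if $$\sum_{\xi_1+\dots+\xi_k\ne0}\|\hat u_1(t,\xi_1)\cdots\hat u_k(t,\xi_k)\|_{C_t^0}\,|\xi_1+\dots+\xi_k|^{s}<\infty$$ (sum over $(\xi_1,\dots,\xi_k)\in\mathbb Z^k$), and then $$\mathbb P_{\neq0}(u_1\cdots u_k):=\sum_{\xi_1+\dots+\xi_k\neq0}\hat u_1(t,\xi_1)\cdots\hat u_k(t,\xi_k)e^{2\pi i(\xi_1+\dots+\xi_k)x},$$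 an absolutely summable series in $C_t^0\dot H^s_x$. $\mathbb P_{\neq0}(u^k)$ is the case $u_1=\dots=u_k=u$. Weak singular solution. $u$ is a weak singular solution of $\partial_tu+\partial_{xxx}u+\sigma\partial_x(u^k)=0$ with initial data $u_0$ if $u\in C_t^0H^r_x([0,1]\times\mathbb T)$ for some $r\in\mathbb R$, there is $s'\in\mathbb R$ such that $\mathbb P_{\neq0}(u^k)$ is well defined as an element of $C_t^0\dot H^{s'}_x$ in the sense above, and $$\int_0^1\Big(\langle u,\partial_t\phi\rangle_{H^r,H^{-r}}+\langle u,\partial_{xxx}\phi\rangle_{\dot H^r,\dot H^{-r}}+\sigma\langle\mathbb P_{\neq0}(u^k),\partial_x\phi\rangle_{\dot H^{s'},\dot H^{-s'}}\Big)dt=-\langle u_0,\phi(0)\rangle_{H^r,H^{-r}}$$ for all smooth compactly supported $\phi\in C_c^\infty([0,1)\times\mathbb T)$. *)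

theory Defs
  imports "HOL-Analysis.Analysis"
begin

primrec C_n :: "nat \<Rightarrow> ('a::real_normed_vector \<Rightarrow> complex) \<Rightarrow> bool" where
  "C_n 0 f \<longleftrightarrow> continuous_on UNIV f"
| "C_n (Suc n) f \<longleftrightarrow>
     (\<forall>x. f differentiable (at x)) \<and> (\<forall>v. C_n n (\<lambda>x. frechet_derivative f (at x) v))"

definition smooth :: "('a::real_normed_vector \<Rightarrow> complex) \<Rightarrow> bool" where
  "smooth f \<longleftrightarrow> (\<forall>n. C_n n f)"

text \<open>Smooth functions on the torus are 1-periodic smooth functions on the line.\<close>

definition test_fun :: "(real \<Rightarrow> complex) set" where
  "test_fun = {\<phi>. smooth \<phi> \<and> (\<forall>x. \<phi> (x + 1) = \<phi> x)}"

text \<open>Smooth compactly supported functions on the product of \<open>[0,1)\<close> with the torus. Smoothness up to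
  the boundary \<open>t = 0\<close> means having a smooth extension to negative times; only the values
  at \<open>t \<ge> 0\<close> are ever used.\<close>

definition spacetime_test_fun :: "(real \<times> real \<Rightarrow> complex) set" where
  "spacetime_test_fun =
     {\<phi>. smooth \<phi> \<and> (\<forall>t x. \<phi> (t, x + 1) = \<phi> (t, x)) \<and> (\<exists>b<1. \<forall>t\<ge>b. \<forall>x. \<phi> (t, x) = 0)}"

definition D :: "(real \<Rightarrow> complex) \<Rightarrow> real \<Rightarrow> complex" where
  "D f = (\<lambda>x. vector_derivative f (at x))"

text \<open>Only the values of a functional on \<open>test_fun\<close> are meaningful.\<close>

type_synonym functional = "(real \<Rightarrow> complex) \<Rightarrow> complex"

definition distribution :: "functional \<Rightarrow> bool" where
  "distribution T \<longleftrightarrow>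
     (\<forall>\<phi>\<in>test_fun. \<forall>\<psi>\<in>test_fun. \<forall>a b. T (\<lambda>x. a * \<phi> x + b * \<psi> x) = a * T \<phi> + b * T \<psi>) \<and>
     (\<exists>N C. \<forall>\<phi>\<in>test_fun. norm (T \<phi>) \<le> C * (\<Sum>j\<le>N. SUP x\<in>{0..1}. norm ((D ^^ j) \<phi> x)))"

definition dist_of_fun :: "(real \<Rightarrow> complex) \<Rightarrow> functional" where
  "dist_of_fun f = (\<lambda>\<phi>. LINT x|lebesgue_on {0..1}. f x * \<phi> x)"

definition expi :: "int \<Rightarrow> real \<Rightarrow> complex" where
  "expi m x = exp (2 * of_real pi * \<i> * of_int m * of_real x)"

definition fourier :: "functional \<Rightarrow> int \<Rightarrow> complex" where
  "fourier T \<xi> = T (expi (- \<xi>))"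

text \<open>Continuity in time for the weak-* topology. On the compact interval \<open>[0,1]\<close> this agrees with
  continuity for the strong dual topology, the space of test functions being Montel.\<close>

definition Ct_distribution :: "(real \<Rightarrow> functional) \<Rightarrow> bool" where
  "Ct_distribution u \<longleftrightarrow>
     (\<forall>t\<in>{0..1}. distribution (u t)) \<and> (\<forall>\<phi>\<in>test_fun. continuous_on {0..1} (\<lambda>t. u t \<phi>))"

definition sobolev :: "real \<Rightarrow> functional set" where
  "sobolev s = {T. distribution T \<and>
     (\<lambda>\<xi>. (1 + (of_int \<xi>)\<^sup>2) powr s * (norm (fourier T \<xi>))\<^sup>2) summable_on UNIV}"

definition sobolev_norm :: "real \<Rightarrow> functional \<Rightarrow> real" where
  "sobolev_norm s T = sqrt (\<Sum>\<^sub>\<infinity>\<xi>. (1 + (of_int \<xi>)\<^sup>2) powr s * (norm (fourier T \<xi>))\<^sup>2)"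

definition Ct_sobolev :: "real \<Rightarrow> (real \<Rightarrow> functional) \<Rightarrow> bool" where
  "Ct_sobolev s u \<longleftrightarrow> (\<forall>t\<in>{0..1}. u t \<in> sobolev s) \<and>
     (\<forall>t0\<in>{0..1}. ((\<lambda>t. sobolev_norm s (\<lambda>\<phi>. u t \<phi> - u t0 \<phi>)) \<longlongrightarrow> 0) (at t0 within {0..1}))"

definition Lp :: "real \<Rightarrow> (real \<Rightarrow> real) set" where
  "Lp p = {f \<in> borel_measurable (lebesgue_on {0..1}).
     integrable (lebesgue_on {0..1}) (\<lambda>x. \<bar>f x\<bar> powr p)}"

definition Lp_norm :: "real \<Rightarrow> (real \<Rightarrow> real) \<Rightarrow> real" where
  "Lp_norm p f = (LINT x|lebesgue_on {0..1}. \<bar>f x\<bar> powr p) powr (1 / p)"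

definition Ct_Lp :: "real \<Rightarrow> (real \<Rightarrow> real \<Rightarrow> real) \<Rightarrow> bool" where
  "Ct_Lp p u \<longleftrightarrow> (\<forall>t\<in>{0..1}. u t \<in> Lp p) \<and>
     (\<forall>t0\<in>{0..1}. ((\<lambda>t. Lp_norm p (\<lambda>x. u t x - u t0 x)) \<longlongrightarrow> 0) (at t0 within {0..1}))"

definition dist_path :: "(real \<Rightarrow> real \<Rightarrow> real) \<Rightarrow> real \<Rightarrow> functional" where
  "dist_path u t = dist_of_fun (\<lambda>x. complex_of_real (u t x))"

text \<open>Equality to zero as an element of \<open>L\<^sup>1\<close> of the torus.\<close>

definition zero_ae :: "(real \<Rightarrow> real) \<Rightarrow> bool" where
  "zero_ae f \<longleftrightarrow> (AE x in lebesgue_on {0..1}. f x = 0)"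

definition nonzero_freqs :: "nat \<Rightarrow> (nat \<Rightarrow> int) set" where
  "nonzero_freqs k = {\<xi> \<in> {..<k} \<rightarrow>\<^sub>E UNIV. (\<Sum>i<k. \<xi> i) \<noteq> 0}"

text \<open>The factors \<open>u\<^sub>1, \<dots>, u\<^sub>k\<close> are indexed from 0. The supremum is that of a bounded function, because
  Fourier coefficients of elements of \<open>Ct_distribution\<close> are continuous in time.\<close>

definition product_exists :: "nat \<Rightarrow> (nat \<Rightarrow> real \<Rightarrow> functional) \<Rightarrow> real \<Rightarrow> bool" where
  "product_exists k u s \<longleftrightarrow> (\<forall>i<k. Ct_distribution (u i)) \<and>
     (\<lambda>\<xi>. (SUP t\<in>{0..1}. norm (\<Prod>i<k. fourier (u i t) (\<xi> i)))
            * \<bar>of_int (\<Sum>i<k. \<xi> i)\<bar> powr s) summable_on nonzero_freqs k"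

text \<open>The sum of the series of distributions; tested against a fixed test function, it converges
  absolutely whenever \<open>product_exists k u s\<close> holds for some \<open>s\<close>.\<close>

definition P_nonzero_product :: "nat \<Rightarrow> (nat \<Rightarrow> real \<Rightarrow> functional) \<Rightarrow> real \<Rightarrow> functional" where
  "P_nonzero_product k u t = (\<lambda>\<phi>. \<Sum>\<^sub>\<infinity>\<xi>\<in>nonzero_freqs k.
     (\<Prod>i<k. fourier (u i t) (\<xi> i)) * dist_of_fun (expi (\<Sum>i<k. \<xi> i)) \<phi>)"

text \<open>Against a smooth function, the bilinear duality of \<open>H\<^sup>r\<close> and \<open>H\<^sup>-\<^sup>r\<close> extending the integral of the
  product is the action of the distribution. In the homogeneous duality the zero frequency of the
  test function, its mean, is removed.\<close>

definition pairing :: "functional \<Rightarrow> (real \<Rightarrow> complex) \<Rightarrow> complex" where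
  "pairing T g = T g"

definition hom_pairing :: "functional \<Rightarrow> (real \<Rightarrow> complex) \<Rightarrow> complex" where
  "hom_pairing T g = T (\<lambda>x. g x - (LINT y|lebesgue_on {0..1}. g y))"

definition weak_singular_solution ::
    "real \<Rightarrow> nat \<Rightarrow> functional \<Rightarrow> (real \<Rightarrow> functional) \<Rightarrow> bool" where
  "weak_singular_solution \<sigma> k u0 u \<longleftrightarrow>
     (\<exists>r. u0 \<in> sobolev r \<and> Ct_sobolev r u) \<and>
     (\<exists>s'. product_exists k (\<lambda>_. u) s') \<and>
     (\<forall>\<phi>\<in>spacetime_test_fun.
        (LINT t|lebesgue_on {0..1}.
             pairing (u t) (\<lambda>x. vector_derivative (\<lambda>\<tau>. \<phi> (\<tau>, x)) (at t))
           + hom_pairing (u t) ((D ^^ 3) (\<lambda>x. \<phi> (t, x)))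
           + of_real \<sigma> * hom_pairing (P_nonzero_product k (\<lambda>_. u) t) (D (\<lambda>x. \<phi> (t, x))))
        = - pairing u0 (\<lambda>x. \<phi> (0, x)))"

end

theory Submission imports Defs
begin

text \<open>
  The solution is a sum of trigonometric polynomials with disjoint frequency supports. For a partial sum
  \<open>c\<close>, let the residual be the antiderivative in \<open>x\<close> of the error in the equation. A conjugate pair of
  modes \<open>\<plusminus>f\<close> of the residual is removed by adding a wave packet whose \<open>k\<close>-fold resonances (\<open>k - 1\<close> waves of
  one type and one of another) produce exactly the modes \<open>\<plusminus>f\<close>. The packet consists of about \<open>M\<close> waves of amplitude
  \<open>M\<^sup>1\<^sup>/\<^sup>k\<^sup>-\<^sup>1\<close> in steps of \<open>L\<close> with Fejer weights. Its other interactions have frequency zero, which is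
  discarded, or frequency at least \<open>L/2\<close>, or involve \<open>c\<close>. By Young's inequality the second kind is small for
  large \<open>L\<close> and the third for large \<open>M\<close>; the contribution of the linear part tends to zero since \<open>s \<ge> 3\<close>. The
  absolute sum defining the product grows by no more than the mass removed from the residual, so the sum of both stays
  bounded while every mode is visited infinitely often. For time profiles, the span of
  \<open>exp (- \<alpha> / t) / t\<^sup>m\<close> is closed under products and derivatives, vanishes at \<open>t = 0\<close>, and lets any profile be
  written as \<open>a\<^sup>k\<^sup>-\<^sup>1 b\<close> with \<open>a\<close> real, without extracting roots.
\<close>

subsection \<open>Time profiles\<close>

text \<open>All exponents come from one balance. A packet of about \<open>M\<close> waves of
  amplitude \<open>A\<close> has about M^(k-1) resonant tuples, so A^k M^(k-1) = 1 lets it remove a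
  residual mode of unit size for every \<open>M\<close>. Its squared H^r norm is then of order
  M^(2/k - 1 + 2r), which tends to zero exactly when r < 1/2 - 1/k; being a modulated Fejer kernel,
  it has L^q norm of order M^(1/k - 1/q), small for q < k. The l^1 norm A M = M^(1/k) of its
  coefficients diverges, so the estimates must measure one slot of each tuple in l^infinity. The
  obstacle is that absolute summability forbids cancellation inside the sum over tuples. Hence all
  resonant tuples hitting \<open>f\<close> carry the same time profile with nonnegative weights: the
  sum of their suprema equals the supremum of their sum, and mass is created only at the price of
  residual removed. The total weighted residual is only known to stay bounded; single modes tend to
  zero. The weak limit therefore uses the extra decay of test functions to discard high
  frequencies.\<close>

definition bump :: "real \<Rightarrow> nat \<Rightarrow> real \<Rightarrow> real" where
  "bump \<alpha> m t = (if t \<le> 0 then 0 else exp (- (\<alpha> / t)) / t ^ m)"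

inductive_set flat :: "(real \<Rightarrow> complex) set" where
  bump: "\<alpha> > 0 \<Longrightarrow> (\<lambda>t. z * of_real (bump \<alpha> m t)) \<in> flat"
| add: "f \<in> flat \<Longrightarrow> g \<in> flat \<Longrightarrow> (\<lambda>t. f t + g t) \<in> flat"

lemma bump_mult: "bump \<alpha> m t * bump \<beta> n t = bump (\<alpha> + \<beta>) (m + n) t"
  by (simp add: bump_def power_add exp_add[symmetric] add_divide_distrib)

lemma bump_power: "j > 0 \<Longrightarrow> bump \<alpha> 0 t ^ j = bump (of_nat j * \<alpha>) 0 t"
  by (auto simp: bump_def exp_of_nat_mult[symmetric] zero_power)

lemma flat_zero: "(\<lambda>t. 0) \<in> flat"
  using flat.bump[of 1 0 0] by simp

lemma flat_scale: "f \<in> flat \<Longrightarrow> (\<lambda>t. z * f t) \<in> flat"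
proof (induction rule: flat.induct)
  case (bump \<alpha> w m)
  then show ?case using flat.bump[of \<alpha> "z * w" m] by (simp add: mult.assoc)
next
  case (add f g)
  then show ?case using flat.add by (simp add: distrib_left)
qed

lemma flat_cnj: "f \<in> flat \<Longrightarrow> (\<lambda>t. cnj (f t)) \<in> flat"
proof (induction rule: flat.induct)
  case (bump \<alpha> w m)
  then show ?case using flat.bump[of \<alpha> "cnj w" m] by simp
next
  case (add f g)
  then show ?case using flat.add by simp
qed

lemma flat_mult:
  assumes "f \<in> flat" "g \<in> flat"
  shows "(\<lambda>t. f t * g t) \<in> flat"
  using assms(1)
proof (induction rule: flat.induct)
  case (bump \<alpha> w m)
  note b = this
  show ?case using assms(2)
  proof (induction rule: flat.induct)
    case (bump \<beta> z n)
    have "(\<lambda>t. w * of_real (bump \<alpha> m t) * (z * of_real (bump \<beta> n t)))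
        = (\<lambda>t. (w * z) * of_real (bump (\<alpha> + \<beta>) (m + n) t))"
      by (simp add: fun_eq_iff bump_mult[symmetric])
    then show ?case using flat.bump[of "\<alpha> + \<beta>" "w * z" "m + n"] b bump by simp
  next
    case (add f g)
    then show ?case using flat.add by (simp add: distrib_left)
  qed
next
  case (add f g)
  then show ?case using flat.add by (simp add: distrib_right)
qed

lemma flat_sum: "finite A \<Longrightarrow> (\<And>i. i \<in> A \<Longrightarrow> f i \<in> flat) \<Longrightarrow> (\<lambda>t. \<Sum>i\<in>A. f i t) \<in> flat"
  by (induction rule: finite_induct) (auto intro: flat_zero flat.add)

lemma flat_prod:
  "finite A \<Longrightarrow> A \<noteq> {} \<Longrightarrow> (\<And>i. i \<in> A \<Longrightarrow> f i \<in> flat) \<Longrightarrow> (\<lambda>t. \<Prod>i\<in>A. f i t) \<in> flat"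
  by (induction rule: finite_ne_induct) (auto intro: flat_mult)

text \<open>At time zero this gives the zero initial datum and removes a boundary term when the weak
  form is integrated by parts in time.\<close>

lemma flat_nonpos: "f \<in> flat \<Longrightarrow> t \<le> 0 \<Longrightarrow> f t = 0"
  by (induction rule: flat.induct) (auto simp: bump_def)

text \<open>With y = 1/t this is the decay of y^m exp(-\<alpha> y) at infinity.\<close>

lemma bump_tendsto_0:
  assumes "\<alpha> > 0"
  shows "(bump \<alpha> m \<longlongrightarrow> 0) (at_right 0)"
proof -
  have "((\<lambda>y::real. (1/\<alpha>^m) * ((\<alpha> * y) ^ m / exp (\<alpha> * y))) \<longlongrightarrow> (1/\<alpha>^m) * 0) at_top"
    by (intro tendsto_intros filterlim_compose[OF tendsto_power_div_exp_0]
          filterlim_tendsto_pos_mult_at_top[OF tendsto_const assms filterlim_ident])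
  then have "((\<lambda>y::real. y ^ m / exp (\<alpha> * y)) \<longlongrightarrow> 0) at_top"
    using assms by (simp add: power_mult_distrib)
  from filterlim_compose[OF this filterlim_inverse_at_top_right]
  have "((\<lambda>t. inverse t ^ m / exp (\<alpha> * inverse t)) \<longlongrightarrow> 0) (at_right 0)" .
  moreover have "eventually (\<lambda>t. inverse t ^ m / exp (\<alpha> * inverse t) = bump \<alpha> m t) (at_right 0)"
    by (auto simp: eventually_at_filter bump_def exp_minus field_simps power_inverse)
  ultimately show ?thesis by (rule Lim_transform_eventually)
qed

lemma bump_deriv:
  assumes "\<alpha> > 0"
  shows "(bump \<alpha> m has_real_derivative \<alpha> * bump \<alpha> (m + 2) t - of_nat m * bump \<alpha> (m + 1) t) (at t)"
proof (cases t "0::real" rule: linorder_cases)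
  case less
  have "((\<lambda>_. 0) has_real_derivative 0) (at t)" by simp
  then have "(bump \<alpha> m has_real_derivative 0) (at t)"
    by (rule has_field_derivative_transform_within_open[where S = "{..<0}"]) (use less in \<open>auto simp: bump_def\<close>)
  then show ?thesis using less by (simp add: bump_def)
next
  case greater
  have "((\<lambda>t. exp (- (\<alpha> / t)) / t ^ m) has_real_derivative
      \<alpha> * bump \<alpha> (m + 2) t - of_nat m * bump \<alpha> (m + 1) t) (at t)"
    using greater
    by (cases m, auto intro!: derivative_eq_intros simp: bump_def field_simps power2_eq_square)
      (metis One_nat_def mult.commute neq0_conv power_minus_mult)
  then show ?thesis
    by (rule has_field_derivative_transform_within_open[where S = "{0<..}"]) (use greater in \<open>auto simp: bump_def\<close>)
next
  case equal
  \<comment> \<open>To the right of zero the difference quotient at zero is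
    \<open>bump \<alpha> (Suc m)\<close>, which tends to zero.\<close>
  have "((\<lambda>y. (bump \<alpha> m y - bump \<alpha> m 0) / (y - 0)) \<longlongrightarrow> 0) (at_right 0)"
    by (rule Lim_transform_eventually[OF bump_tendsto_0[OF assms, of "Suc m"]])
       (auto simp: eventually_at_filter bump_def)
  moreover have "((\<lambda>y. (bump \<alpha> m y - bump \<alpha> m 0) / (y - 0)) \<longlongrightarrow> 0) (at_left 0)"
    by (rule Lim_transform_eventually[OF tendsto_const]) (auto simp: eventually_at_filter bump_def)
  ultimately have "((\<lambda>y. (bump \<alpha> m y - bump \<alpha> m 0) / (y - 0)) \<longlongrightarrow> 0) (at 0)"
    by (simp add: filterlim_split_at)
  then show ?thesis using equal by (simp add: has_field_derivative_iff bump_def)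
qed

lemma flat_has_derivative:
  "f \<in> flat \<Longrightarrow> \<exists>g\<in>flat. \<forall>t. (f has_vector_derivative g t) (at t)"
proof (induction rule: flat.induct)
  case (bump \<alpha> z m)
  let ?g = "\<lambda>t. (z * of_real \<alpha>) * of_real (bump \<alpha> (m + 2) t)
      + (- z * of_nat m) * of_real (bump \<alpha> (m + 1) t)"
  have "?g \<in> flat" using bump by (intro flat.intros)
  moreover have "((\<lambda>t. z * of_real (bump \<alpha> m t)) has_vector_derivative ?g t) (at t)" for t
  proof -
    have "((\<lambda>t. z * of_real (bump \<alpha> m t)) has_vector_derivative
        z * of_real (\<alpha> * bump \<alpha> (m + 2) t - of_nat m * bump \<alpha> (m + 1) t)) (at t)"
      by (intro has_vector_derivative_mult_right has_vector_derivative_of_real bump_deriv bump)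
    then show ?thesis by (simp add: algebra_simps)
  qed
  ultimately show ?case by (intro bexI[of _ ?g] allI)
next
  case (add f g)
  then obtain f' g' where "f' \<in> flat" "\<forall>t. (f has_vector_derivative f' t) (at t)"
    "g' \<in> flat" "\<forall>t. (g has_vector_derivative g' t) (at t)" by blast
  then show ?case
    by (intro bexI[of _ "\<lambda>t. f' t + g' t"]) (auto intro: has_vector_derivative_add flat.add)
qed

lemma flat_deriv: "f \<in> flat \<Longrightarrow> (\<lambda>t. vector_derivative f (at t)) \<in> flat"
proof -
  assume "f \<in> flat"
  then obtain g where g: "g \<in> flat" "\<forall>t. (f has_vector_derivative g t) (at t)"
    using flat_has_derivative by blast
  then have "(\<lambda>t. vector_derivative f (at t)) = g" by (auto intro!: ext vector_derivative_at)
  then show ?thesis using g by simp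
qed

lemma flat_has_vector_derivative:
  "f \<in> flat \<Longrightarrow> (f has_vector_derivative vector_derivative f (at t)) (at t)"
  using flat_has_derivative vector_derivative_works differentiableI_vector by blast

lemma flat_continuous: "f \<in> flat \<Longrightarrow> continuous_on S f"
  using flat_has_vector_derivative
  by (meson continuous_at_imp_continuous_on has_vector_derivative_continuous)

text \<open>Splitting the rate as \<epsilon> plus \<alpha> - \<epsilon> factors a single generator.
  The claim is made for all small \<epsilon> at once so that both summands of a sum can be divided
  by the same factor; the existence of one \<epsilon> would not survive the induction.\<close>

lemma flat_factor:
  "f \<in> flat \<Longrightarrow> \<exists>\<delta>>0. \<forall>\<epsilon>. 0 < \<epsilon> \<and> \<epsilon> < \<delta> \<longrightarrow> (\<exists>g\<in>flat. \<forall>t. f t = of_real (bump \<epsilon> 0 t) * g t)"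
proof (induction rule: flat.induct)
  case (bump \<alpha> z m)
  have "\<exists>g\<in>flat. \<forall>t. z * of_real (bump \<alpha> m t) = of_real (bump \<epsilon> 0 t) * g t"
    if "0 < \<epsilon>" "\<epsilon> < \<alpha>" for \<epsilon>
  proof (intro bexI[of _ "\<lambda>t. z * of_real (bump (\<alpha> - \<epsilon>) m t)"] allI)
    fix t
    have "bump \<alpha> m t = bump \<epsilon> 0 t * bump (\<alpha> - \<epsilon>) m t" by (simp add: bump_mult)
    then show "z * of_real (bump \<alpha> m t)
        = of_real (bump \<epsilon> 0 t) * (z * of_real (bump (\<alpha> - \<epsilon>) m t))" by simp
  qed (use that in \<open>auto intro: flat.bump\<close>)
  then show ?case using bump by blast
next
  case (add f g)
  from add.IH obtain d1 d2 where d: "d1 > 0" "d2 > 0"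
    "\<forall>\<epsilon>. 0 < \<epsilon> \<and> \<epsilon> < d1 \<longrightarrow> (\<exists>h\<in>flat. \<forall>t. f t = of_real (bump \<epsilon> 0 t) * h t)"
    "\<forall>\<epsilon>. 0 < \<epsilon> \<and> \<epsilon> < d2 \<longrightarrow> (\<exists>h\<in>flat. \<forall>t. g t = of_real (bump \<epsilon> 0 t) * h t)"
    by (elim exE conjE)
  show ?case
  proof (intro exI[of _ "min d1 d2"] conjI allI impI)
    fix \<epsilon> assume e: "0 < \<epsilon> \<and> \<epsilon> < min d1 d2"
    obtain h1 where "h1 \<in> flat" "\<forall>t. f t = of_real (bump \<epsilon> 0 t) * h1 t"
      using d(3)[rule_format, of \<epsilon>] e by auto
    moreover obtain h2 where "h2 \<in> flat" "\<forall>t. g t = of_real (bump \<epsilon> 0 t) * h2 t"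
      using d(4)[rule_format, of \<epsilon>] e by auto
    ultimately show "\<exists>h\<in>flat. \<forall>t. f t + g t = of_real (bump \<epsilon> 0 t) * h t"
      by (intro bexI[of _ "\<lambda>t. h1 t + h2 t"]) (auto simp: distrib_left intro: flat.add)
  qed (use d in auto)
qed

text \<open>The j-th root of a generator of rate j \<epsilon> with exponent 0 is the generator of
  rate \<epsilon>. It is real, so that the two wave types of offset 0, which must be conjugate to
  each other, can share the profile \<open>a\<close>.\<close>

lemma flat_factor_power:
  assumes "f \<in> flat" "j > 0"
  obtains a g where "a \<in> flat" "g \<in> flat" "\<And>t. cnj (a t) = a t" "\<And>t. f t = a t ^ j * g t"
proof -
  obtain \<delta> where d: "\<delta> > 0"
    "\<And>\<epsilon>. 0 < \<epsilon> \<Longrightarrow> \<epsilon> < \<delta> \<Longrightarrow> \<exists>g\<in>flat. \<forall>t. f t = of_real (bump \<epsilon> 0 t) * g t"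
    using flat_factor[OF assms(1)] by blast
  define \<epsilon> where "\<epsilon> = \<delta> / (2 * of_nat j)"
  have e: "0 < \<epsilon>" "of_nat j * \<epsilon> < \<delta>" using d(1) assms(2) by (auto simp: \<epsilon>_def)
  obtain g where g: "g \<in> flat" "\<forall>t. f t = of_real (bump (of_nat j * \<epsilon>) 0 t) * g t"
    using d(2)[of "of_nat j * \<epsilon>"] e assms(2) by auto
  have "(\<lambda>t. of_real (bump \<epsilon> 0 t)) \<in> flat" using flat.bump[of \<epsilon> 1 0] e by simp
  then show ?thesis
    using g(1) by (rule that) (use g(2) assms(2) in \<open>auto simp flip: bump_power\<close>)
qed

subsection \<open>Supremum over the time interval\<close>

text \<open>A real supremum is meaningful only for bounded families. Continuity on the compact
  interval supplies boundedness, hence the continuity hypotheses wherever values are bounded by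
  \<open>supn\<close>.\<close>

definition supn :: "(real \<Rightarrow> complex) \<Rightarrow> real" where
  "supn h = (SUP t\<in>{0..1}. norm (h t))"

lemma supn_ge:
  assumes "continuous_on {0..1} h" "t \<in> {0..1}"
  shows "norm (h t) \<le> supn h"
  unfolding supn_def
proof (rule cSUP_upper[OF assms(2)])
  have "compact ((\<lambda>t. norm (h t)) ` {0..1})"
    by (intro compact_continuous_image continuous_intros assms) auto
  then show "bdd_above ((\<lambda>t. norm (h t)) ` {0..1})" by (simp add: bounded_imp_bdd_above compact_imp_bounded)
qed

lemma supn_le: "(\<And>t. t \<in> {0..1} \<Longrightarrow> norm (h t) \<le> B) \<Longrightarrow> supn h \<le> B"
  unfolding supn_def by (rule cSUP_least) auto

lemma supn_nonneg: "continuous_on {0..1} h \<Longrightarrow> 0 \<le> supn h"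
  using order_trans[OF norm_ge_zero supn_ge[of h 0]] by simp

lemma supn_zero [simp]: "supn (\<lambda>t. 0) = 0"
  by (simp add: supn_def)

lemma supn_add:
  assumes "continuous_on {0..1} f" "continuous_on {0..1} g"
  shows "supn (\<lambda>t. f t + g t) \<le> supn f + supn g"
  by (rule supn_le) (use supn_ge[OF assms(1)] supn_ge[OF assms(2)] norm_triangle_mono in blast)

lemma supn_sum:
  assumes "finite A" "\<And>i. i \<in> A \<Longrightarrow> continuous_on {0..1} (f i)"
  shows "supn (\<lambda>t. \<Sum>i\<in>A. f i t) \<le> (\<Sum>i\<in>A. supn (f i))"
  by (rule supn_le) (auto intro!: order_trans[OF norm_sum] sum_mono supn_ge assms)

lemma supn_prod:
  assumes "\<And>i. i \<in> A \<Longrightarrow> continuous_on {0..1} (f i)"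
  shows "supn (\<lambda>t. \<Prod>i\<in>A. f i t) \<le> (\<Prod>i\<in>A. supn (f i))"
  by (rule supn_le) (auto simp: prod_norm[symmetric] intro!: prod_mono supn_ge assms)

lemma supn_cmult: "supn (\<lambda>t. z * h t) = norm z * supn h" if "continuous_on {0..1} h"
proof (cases "z = 0")
  case False
  have 1: "supn (\<lambda>t. z * h t) \<le> norm z * supn h"
    by (rule supn_le) (auto simp: norm_mult intro!: mult_left_mono supn_ge that)
  have "supn h \<le> supn (\<lambda>t. z * h t) / norm z"
  proof (rule supn_le)
    fix t :: real assume "t \<in> {0..1}"
    then have "norm (z * h t) \<le> supn (\<lambda>t. z * h t)"
      by (intro supn_ge continuous_intros that)
    then show "norm (h t) \<le> supn (\<lambda>t. z * h t) / norm z"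
      using False by (simp add: norm_mult field_simps)
  qed
  then show ?thesis using 1 False by (simp add: field_simps)
qed (simp add: supn_def)

lemma supn_cnj: "supn (\<lambda>t. cnj (h t)) = supn h"
  by (simp add: supn_def)

subsection \<open>Sums over tuples\<close>

lemma sum_PiE_split:
  fixes F :: "('i \<Rightarrow> 'a) \<Rightarrow> 'b::comm_monoid_add"
  assumes "i \<in> I"
  shows "(\<Sum>\<xi>\<in>PiE I S. F \<xi>) = (\<Sum>\<eta>\<in>PiE (I - {i}) S. \<Sum>y\<in>S i. F (\<eta>(i := y)))"
proof -
  have eq: "PiE I S = (\<lambda>(y, \<eta>). \<eta>(i := y)) ` (S i \<times> PiE (I - {i}) S)"
    using PiE_insert_eq[of i "I - {i}" S] assms by (simp add: insert_absorb)
  have inj: "inj_on (\<lambda>(y, \<eta>). \<eta>(i := y)) (S i \<times> PiE (I - {i}) S)"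
    using inj_combinator[of i "I - {i}" S] by simp
  have "(\<Sum>\<xi>\<in>PiE I S. F \<xi>) = (\<Sum>(y, \<eta>)\<in>S i \<times> PiE (I - {i}) S. F (\<eta>(i := y)))"
    unfolding eq by (subst sum.reindex[OF inj]) (simp add: case_prod_unfold)
  also have "\<dots> = (\<Sum>y\<in>S i. \<Sum>\<eta>\<in>PiE (I - {i}) S. F (\<eta>(i := y)))"
    by (rule sum.cartesian_product[symmetric])
  also have "\<dots> = (\<Sum>\<eta>\<in>PiE (I - {i}) S. \<Sum>y\<in>S i. F (\<eta>(i := y)))"
    by (rule sum.swap)
  finally show ?thesis .
qed

text \<open>Young's inequality for multiple convolutions. With all coordinates but \<open>i\<close>
  fixed, the sum over the remaining one is at most \<open>K\<close> times the sum of a translate of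
  \<open>h\<close>, hence at most K H; what is left factors into l^1 norms. Slot \<open>i\<close> is
  thus measured in l^infinity and every other slot in l^1.\<close>

lemma young_tuples:
  fixes m :: "int \<Rightarrow> real" and h :: "int \<Rightarrow> real"
  assumes "finite I" "i \<in> I" and fin: "\<And>j. j \<in> I \<Longrightarrow> finite (S j)"
    and m: "\<And>y. 0 \<le> m y" and K: "\<And>y. y \<in> S i \<Longrightarrow> m y \<le> K"
    and h: "\<And>y. 0 \<le> h y" and H: "\<And>F. finite F \<Longrightarrow> sum h F \<le> H"
    and W: "\<And>j. j \<in> I - {i} \<Longrightarrow> sum m (S j) \<le> W j" and "K \<ge> 0"
  shows "(\<Sum>\<xi>\<in>PiE I S. (\<Prod>j\<in>I. m (\<xi> j)) * h (\<Sum>j\<in>I. \<xi> j)) \<le> K * H * (\<Prod>j\<in>I - {i}. W j)"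
proof -
  have H0: "H \<ge> 0" using H[of "{}"] by simp
  have inner: "(\<Sum>y\<in>S i. (\<Prod>j\<in>I. m ((\<eta>(i := y)) j)) * h (\<Sum>j\<in>I. (\<eta>(i := y)) j))
      \<le> (\<Prod>j\<in>I - {i}. m (\<eta> j)) * (K * H)" for \<eta>
  proof -
    have p: "(\<Prod>j\<in>I. m ((\<eta>(i := y)) j)) = m y * (\<Prod>j\<in>I - {i}. m (\<eta> j))" for y
      by (subst prod.remove[OF assms(1,2)]) simp
    have s: "(\<Sum>j\<in>I. (\<eta>(i := y)) j) = y + (\<Sum>j\<in>I - {i}. \<eta> j)" for y
      by (subst sum.remove[OF assms(1,2)]) simp
    let ?c = "\<Sum>j\<in>I - {i}. \<eta> j"
    have "(\<Sum>y\<in>S i. m y * h (y + ?c)) \<le> (\<Sum>y\<in>S i. K * h (y + ?c))"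
      by (intro sum_mono mult_right_mono K h)
    also have "\<dots> = K * sum h ((\<lambda>y. y + ?c) ` S i)"
      by (subst sum.reindex) (auto simp: sum_distrib_left)
    also have "\<dots> \<le> K * H" using fin assms by (intro mult_left_mono H) auto
    finally have "(\<Prod>j\<in>I - {i}. m (\<eta> j)) * (\<Sum>y\<in>S i. m y * h (y + ?c)) \<le> (\<Prod>j\<in>I - {i}. m (\<eta> j)) * (K * H)"
      by (intro mult_left_mono prod_nonneg m) auto
    then show ?thesis unfolding p s by (simp add: sum_distrib_left mult_ac)
  qed
  have "(\<Sum>\<xi>\<in>PiE I S. (\<Prod>j\<in>I. m (\<xi> j)) * h (\<Sum>j\<in>I. \<xi> j))
      \<le> (\<Sum>\<eta>\<in>PiE (I - {i}) S. (\<Prod>j\<in>I - {i}. m (\<eta> j)) * (K * H))"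
    unfolding sum_PiE_split[OF assms(2)] by (intro sum_mono inner)
  also have "\<dots> = (\<Prod>j\<in>I - {i}. sum m (S j)) * (K * H)"
    unfolding sum_distrib_right[symmetric]
    by (subst prod_sum_PiE) (use assms fin in auto)
  also have "\<dots> \<le> (\<Prod>j\<in>I - {i}. W j) * (K * H)"
    using assms H0 by (intro mult_right_mono prod_mono) (auto intro!: sum_nonneg)
  finally show ?thesis by (simp add: mult_ac)
qed

lemma sum_powr_int_bound:
  fixes s :: real
  assumes "s > 1"
  obtains H where "H \<ge> 0" "\<And>F::int set. finite F \<Longrightarrow> (\<Sum>g\<in>F. if g = 0 then 0 else \<bar>of_int g\<bar> powr (-s)) \<le> H"
proof -
  have summ: "summable (\<lambda>n. of_nat n powr (-s))"
    using assms by (simp add: summable_real_powr_iff)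
  let ?Z = "\<Sum>n. real n powr (-s)"
  have half: "(\<Sum>g\<in>F. if g = 0 then 0 else \<bar>of_int g\<bar> powr (-s)) \<le> ?Z"
    if "finite F" "inj_on (\<lambda>g. nat \<bar>g\<bar>) F" for F :: "int set"
  proof -
    have "(\<Sum>g\<in>F. if g = 0 then 0 else \<bar>real_of_int g\<bar> powr (-s)) \<le> (\<Sum>g\<in>F. real (nat \<bar>g\<bar>) powr (-s))"
      by (intro sum_mono) auto
    also have "\<dots> = (\<Sum>n\<in>(\<lambda>g. nat \<bar>g\<bar>) ` F. real n powr (-s))"
      by (subst sum.reindex[OF that(2)]) simp
    also have "\<dots> \<le> ?Z" using that by (intro sum_le_suminf summ) auto
    finally show ?thesis .
  qed
  have Z0: "?Z \<ge> 0" by (intro suminf_nonneg summ) auto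
  show ?thesis
  proof (rule that[of "?Z + ?Z"])
    fix F :: "int set" assume F: "finite F"
    have "F = (F \<inter> {0..}) \<union> (F \<inter> {..<0})" by auto
    then have "(\<Sum>g\<in>F. if g = 0 then 0 else \<bar>real_of_int g\<bar> powr (-s))
      = (\<Sum>g\<in>F \<inter> {0..}. if g = 0 then 0 else \<bar>real_of_int g\<bar> powr (-s))
      + (\<Sum>g\<in>F \<inter> {..<0}. if g = 0 then 0 else \<bar>real_of_int g\<bar> powr (-s))"
      using F by (subst sum.union_disjoint[symmetric]) auto
    also have "\<dots> \<le> ?Z + ?Z"
      using F by (intro add_mono half) (auto simp: inj_on_def)
    finally show "(\<Sum>g\<in>F. if g = 0 then 0 else \<bar>real_of_int g\<bar> powr (-s)) \<le> ?Z + ?Z" .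
  qed (use Z0 in auto)
qed

subsection \<open>Trigonometric polynomials and their residuals\<close>

definition supp :: "(int \<Rightarrow> real \<Rightarrow> complex) \<Rightarrow> int set" where
  "supp c = {\<xi>. \<exists>t. c \<xi> t \<noteq> 0}"

text \<open>The symmetry under negation makes the function real. The mean must vanish because the
  residual does not see frequency 0, whereas the time derivative in the weak form does.\<close>

definition tpoly :: "(int \<Rightarrow> real \<Rightarrow> complex) \<Rightarrow> bool" where
  "tpoly c \<longleftrightarrow> finite (supp c) \<and> 0 \<notin> supp c \<and> (\<forall>\<xi>. c \<xi> \<in> flat) \<and> (\<forall>\<xi> t. c (-\<xi>) t = cnj (c \<xi> t))"

definition conv :: "nat \<Rightarrow> (int \<Rightarrow> real \<Rightarrow> complex) \<Rightarrow> int \<Rightarrow> real \<Rightarrow> complex" where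
  "conv k c g t = (\<Sum>\<xi>\<in>{\<xi>\<in>{..<k} \<rightarrow>\<^sub>E supp c. (\<Sum>i<k. \<xi> i) = g}. \<Prod>i<k. c (\<xi> i) t)"

text \<open>The part of the absolute series in \<open>product_exists\<close> that a trigonometric
  polynomial contributes. A bound that is uniform along the cascade yields absolute summability for
  the limit.\<close>

definition mass :: "nat \<Rightarrow> real \<Rightarrow> (int \<Rightarrow> real \<Rightarrow> complex) \<Rightarrow> real" where
  "mass k s c = (\<Sum>\<xi>\<in>{\<xi>\<in>{..<k} \<rightarrow>\<^sub>E supp c. (\<Sum>i<k. \<xi> i) \<noteq> 0}.
     supn (\<lambda>t. \<Prod>i<k. c (\<xi> i) t) * \<bar>of_int (\<Sum>i<k. \<xi> i)\<bar> powr (-s))"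

text \<open>One antiderivative in x is taken and the factor \<open>\<sigma>\<close> is moved over
  from the nonlinearity, so that \<open>conv\<close> enters \<open>resid\<close> with coefficient 1
  and a packet can cancel the residual for either sign.\<close>

definition airy :: "real \<Rightarrow> (int \<Rightarrow> real \<Rightarrow> complex) \<Rightarrow> int \<Rightarrow> real \<Rightarrow> complex" where
  "airy \<sigma> c \<xi> t = of_real \<sigma> * (vector_derivative (c \<xi>) (at t) + (2 * of_real pi * \<i> * of_int \<xi>) ^ 3 * c \<xi> t)
     / (2 * of_real pi * \<i> * of_int \<xi>)"

text \<open>When \<open>\<sigma>\<^sup>2 = 1\<close>, multiplying by \<open>2 \<pi> \<i> \<xi> \<sigma>\<close> gives the \<open>\<xi>\<close>-th Fourier coefficient of
  \<open>\<partial>\<^sub>t u + \<partial>\<^sub>x\<^sub>x\<^sub>x u + \<sigma> \<partial>\<^sub>x (u\<^sup>k)\<close>; at \<open>\<xi> = 0\<close> the value is irrelevant.\<close>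

definition resid :: "real \<Rightarrow> nat \<Rightarrow> (int \<Rightarrow> real \<Rightarrow> complex) \<Rightarrow> int \<Rightarrow> real \<Rightarrow> complex" where
  "resid \<sigma> k c \<xi> t = airy \<sigma> c \<xi> t + conv k c \<xi> t"

lemma tpolyD:
  assumes "tpoly c"
  shows "finite (supp c)" "0 \<notin> supp c" "c \<xi> \<in> flat" "c (-\<xi>) t = cnj (c \<xi> t)"
  using assms by (auto simp: tpoly_def)

lemma not_supp: "\<xi> \<notin> supp c \<Longrightarrow> c \<xi> t = 0"
  by (auto simp: supp_def)

lemma finite_tuples: "finite X \<Longrightarrow> finite ({..<k::nat} \<rightarrow>\<^sub>E (X::int set))"
  by (intro finite_PiE) auto

text \<open>This lets sums belonging to different polynomials be compared over one common index set:
  an added tuple has an entry outside the support, so its product vanishes identically in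
  time.\<close>

lemma sum_tuples_superset:
  fixes c :: "int \<Rightarrow> real \<Rightarrow> complex" and k :: nat
  assumes "finite X" "supp c \<subseteq> X" and h: "\<And>\<xi>. (\<forall>t. (\<Prod>i<k. c (\<xi> i) t) = 0) \<Longrightarrow> h \<xi> = (0::'b::comm_monoid_add)"
  shows "(\<Sum>\<xi>\<in>{\<xi>\<in>{..<k} \<rightarrow>\<^sub>E supp c. Q \<xi>}. h \<xi>) = (\<Sum>\<xi>\<in>{\<xi>\<in>{..<k} \<rightarrow>\<^sub>E X. Q \<xi>}. h \<xi>)"
proof (rule sum.mono_neutral_left)
  show "finite {\<xi>\<in>{..<k} \<rightarrow>\<^sub>E X. Q \<xi>}" using finite_tuples[OF assms(1), of k] by simp
  show "{\<xi>\<in>{..<k} \<rightarrow>\<^sub>E supp c. Q \<xi>} \<subseteq> {\<xi>\<in>{..<k} \<rightarrow>\<^sub>E X. Q \<xi>}"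
    using PiE_mono[of "{..<k}" "\<lambda>_. supp c" "\<lambda>_. X"] assms(2) by auto
  show "\<forall>\<xi>\<in>{\<xi>\<in>{..<k} \<rightarrow>\<^sub>E X. Q \<xi>} - {\<xi>\<in>{..<k} \<rightarrow>\<^sub>E supp c. Q \<xi>}. h \<xi> = 0"
  proof
    fix \<xi> assume "\<xi> \<in> {\<xi>\<in>{..<k} \<rightarrow>\<^sub>E X. Q \<xi>} - {\<xi>\<in>{..<k} \<rightarrow>\<^sub>E supp c. Q \<xi>}"
    then obtain i where "i < k" "\<xi> i \<notin> supp c" by (auto simp: PiE_iff)
    then show "h \<xi> = 0" by (intro h allI prod_zero) (auto intro: not_supp)
  qed
qed

lemma conv_superset:
  assumes "finite X" "supp c \<subseteq> X"
  shows "conv k c g t = (\<Sum>\<xi>\<in>{\<xi>\<in>{..<k} \<rightarrow>\<^sub>E X. (\<Sum>i<k. \<xi> i) = g}. \<Prod>i<k. c (\<xi> i) t)"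
  unfolding conv_def by (rule sum_tuples_superset[OF assms]) auto

lemma mass_superset:
  assumes "finite X" "supp c \<subseteq> X"
  shows "mass k s c = (\<Sum>\<xi>\<in>{\<xi>\<in>{..<k} \<rightarrow>\<^sub>E X. (\<Sum>i<k. \<xi> i) \<noteq> 0}.
     supn (\<lambda>t. \<Prod>i<k. c (\<xi> i) t) * \<bar>of_int (\<Sum>i<k. \<xi> i)\<bar> powr (-s))"
  unfolding mass_def by (rule sum_tuples_superset[OF assms]) (simp only: supn_zero mult_zero_left)

lemma tuple_continuous:
  "tpoly c \<Longrightarrow> continuous_on S (\<lambda>t. \<Prod>i<k. c (\<xi> i) t)"
  by (intro continuous_on_prod flat_continuous tpolyD)

lemma conv_flat: "tpoly c \<Longrightarrow> k > 0 \<Longrightarrow> conv k c g \<in> flat"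
  unfolding conv_def[abs_def]
  by (intro flat_sum flat_prod tpolyD) (auto intro!: finite_tuples tpolyD)

lemma airy_flat: "tpoly c \<Longrightarrow> airy \<sigma> c g \<in> flat"
proof -
  assume c: "tpoly c"
  let ?w = "2 * of_real pi * \<i> * of_int g"
  have "(\<lambda>t. (of_real \<sigma> / ?w) * (vector_derivative (c g) (at t) + ?w ^ 3 * c g t)) \<in> flat"
    by (intro flat_scale flat.add flat_deriv tpolyD[OF c])
  then show ?thesis by (simp add: airy_def[abs_def])
qed

lemma resid_flat: "tpoly c \<Longrightarrow> k > 0 \<Longrightarrow> resid \<sigma> k c g \<in> flat"
  unfolding resid_def[abs_def] by (intro flat.add conv_flat airy_flat)

lemma conv_uminus:
  assumes "tpoly c"
  shows "conv k c (- g) t = cnj (conv k c g t)"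
proof -
  have sup: "- \<xi> \<in> supp c \<longleftrightarrow> \<xi> \<in> supp c" for \<xi>
    using tpolyD(4)[OF assms] by (auto simp: supp_def)
  have "conv k c (- g) t
     = (\<Sum>\<xi>\<in>{\<xi>\<in>{..<k} \<rightarrow>\<^sub>E supp c. (\<Sum>i<k. \<xi> i) = g}. \<Prod>i<k. c (- \<xi> i) t)"
    unfolding conv_def
  \<comment> \<open>Negating all entries exchanges the fibres over \<open>g\<close> and
    \<open>- g\<close>; the restricted lambda keeps the tuples extensional.\<close>
  proof (rule sum.reindex_bij_witness[of _ "\<lambda>\<xi>. \<lambda>i\<in>{..<k}. - \<xi> i" "\<lambda>\<xi>. \<lambda>i\<in>{..<k}. - \<xi> i"])
  qed (auto simp: sup PiE_iff extensional_def restrict_def sum_negf fun_eq_iff)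
  then show ?thesis by (simp add: conv_def tpolyD(4)[OF assms])
qed

lemma vector_derivative_cnj:
  "(f has_vector_derivative f') (at t) \<Longrightarrow> ((\<lambda>t. cnj (f t)) has_vector_derivative cnj f') (at t)"
  by (rule bounded_linear.has_vector_derivative[OF bounded_linear_cnj])

lemma resid_uminus:
  assumes "tpoly c"
  shows "resid \<sigma> k c (- g) t = cnj (resid \<sigma> k c g t)"
proof -
  have "(c (-g)) = (\<lambda>t. cnj (c g t))" using tpolyD(4)[OF assms] by auto
  then have "vector_derivative (c (-g)) (at t) = cnj (vector_derivative (c g) (at t))"
    using vector_derivative_cnj[OF flat_has_vector_derivative[OF tpolyD(3)[OF assms]]]
    by (simp add: vector_derivative_at)
  then show ?thesis
    by (simp add: resid_def airy_def conv_uminus[OF assms] tpolyD(4)[OF assms])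
qed

section \<open>Adding a polynomial with disjoint frequency support\<close>

lemma sum_fibres_le:
  fixes h :: "'a \<Rightarrow> real"
  assumes "finite A" "finite F" "\<And>a. a \<in> A \<Longrightarrow> 0 \<le> h a" "\<And>a. a \<in> A \<Longrightarrow> p a \<in> F \<Longrightarrow> Q a"
  shows "(\<Sum>\<xi>\<in>F. \<Sum>a\<in>{a\<in>A. p a = \<xi>}. h a) \<le> (\<Sum>a\<in>{a\<in>A. Q a}. h a)"
proof -
  have "(\<Sum>\<xi>\<in>F. \<Sum>a\<in>{a\<in>A. p a = \<xi>}. h a) = sum h (\<Union>\<xi>\<in>F. {a\<in>A. p a = \<xi>})"
    by (rule sum.UNION_disjoint[symmetric]) (use assms in auto)
  also have "\<dots> \<le> (\<Sum>a\<in>{a\<in>A. Q a}. h a)"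
    by (rule sum_mono2) (use assms in auto)
  finally show ?thesis .
qed

lemma sum_fibres_pm:
  fixes h :: "'a \<Rightarrow> real" and p :: "'a \<Rightarrow> int"
  assumes "finite A" "f > 0"
  shows "(\<Sum>a\<in>{a\<in>A. p a \<noteq> 0}. h a) = (\<Sum>a\<in>{a\<in>A. p a \<noteq> 0 \<and> \<bar>p a\<bar> \<noteq> f}. h a)
    + (\<Sum>a\<in>{a\<in>A. p a = f}. h a) + (\<Sum>a\<in>{a\<in>A. p a = -f}. h a)"
proof -
  let ?A = "{a\<in>A. p a \<noteq> 0 \<and> \<bar>p a\<bar> \<noteq> f}" and ?B = "{a\<in>A. p a = f}" and ?C = "{a\<in>A. p a = -f}"
  have 0: "{a\<in>A. p a \<noteq> 0} = (?A \<union> ?B) \<union> ?C"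
    using assms(2) by auto
  have 1: "sum h ((?A \<union> ?B) \<union> ?C) = sum h (?A \<union> ?B) + sum h ?C"
    by (rule sum.union_disjoint) (use assms in auto)
  have 2: "sum h (?A \<union> ?B) = sum h ?A + sum h ?B"
    by (rule sum.union_disjoint) (use assms in auto)
  show ?thesis unfolding 0 1 2 ..
qed

definition mixed :: "nat \<Rightarrow> int set \<Rightarrow> int set \<Rightarrow> (nat \<Rightarrow> int) set" where
  "mixed k X V = {\<xi>\<in>{..<k} \<rightarrow>\<^sub>E (X \<union> V). (\<exists>i<k. \<xi> i \<in> X) \<and> (\<exists>i<k. \<xi> i \<in> V)}"

lemma sum_tuples_union:
  fixes h :: "(nat \<Rightarrow> int) \<Rightarrow> 'b::comm_monoid_add"
  assumes "finite X" "finite V" "X \<inter> V = {}" "k > 0"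
  shows "(\<Sum>\<xi>\<in>{\<xi>\<in>{..<k} \<rightarrow>\<^sub>E (X \<union> V). Q \<xi>}. h \<xi>)
    = (\<Sum>\<xi>\<in>{\<xi>\<in>{..<k} \<rightarrow>\<^sub>E X. Q \<xi>}. h \<xi>) + (\<Sum>\<xi>\<in>{\<xi>\<in>mixed k X V. Q \<xi>}. h \<xi>)
      + (\<Sum>\<xi>\<in>{\<xi>\<in>{..<k} \<rightarrow>\<^sub>E V. Q \<xi>}. h \<xi>)"
proof -
  have fin: "finite ({..<k} \<rightarrow>\<^sub>E (X \<union> V))" using finite_tuples assms by blast
  have sub: "{..<k} \<rightarrow>\<^sub>E X \<subseteq> {..<k} \<rightarrow>\<^sub>E (X \<union> V)" "{..<k} \<rightarrow>\<^sub>E V \<subseteq> {..<k} \<rightarrow>\<^sub>E (X \<union> V)"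
    by (intro PiE_mono; auto)+
  have eq: "{\<xi>\<in>{..<k} \<rightarrow>\<^sub>E (X \<union> V). Q \<xi>} = ({\<xi>\<in>{..<k} \<rightarrow>\<^sub>E X. Q \<xi>} \<union> {\<xi>\<in>mixed k X V. Q \<xi>}) \<union> {\<xi>\<in>{..<k} \<rightarrow>\<^sub>E V. Q \<xi>}"
  proof (intro set_eqI iffI)
    fix \<xi> assume "\<xi> \<in> {\<xi>\<in>{..<k} \<rightarrow>\<^sub>E (X \<union> V). Q \<xi>}"
    then show "\<xi> \<in> ({\<xi>\<in>{..<k} \<rightarrow>\<^sub>E X. Q \<xi>} \<union> {\<xi>\<in>mixed k X V. Q \<xi>}) \<union> {\<xi>\<in>{..<k} \<rightarrow>\<^sub>E V. Q \<xi>}"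
      by (auto simp: mixed_def PiE_iff)
  qed (use sub in \<open>auto simp: mixed_def\<close>)
  have z: "\<xi> 0 \<in> X" if "\<xi> \<in> {..<k} \<rightarrow>\<^sub>E X" for \<xi> :: "nat \<Rightarrow> int" and X using that assms(4) by auto
  show ?thesis unfolding eq
    apply (subst sum.union_disjoint)
    subgoal using finite_subset[OF sub(1) fin] by (auto simp: mixed_def fin)
    subgoal using finite_subset[OF sub(2) fin] by auto
    subgoal using assms(3) z by (auto simp: mixed_def PiE_iff)
    apply (subst sum.union_disjoint)
    subgoal using finite_subset[OF sub(1) fin] by auto
    subgoal by (auto simp: mixed_def fin)
    subgoal using assms(3) by (auto simp: mixed_def PiE_iff)
    apply (rule refl)
    done
qed

text \<open>Disjoint supports turn each product of coefficients of c + v into one of coefficients of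
  \<open>c\<close> or of \<open>v\<close>. Tuples over \<open>X\<close> reproduce the old sums, and
  mixed tuples are bounded by \<open>d1\<close>. Among the tuples over \<open>V\<close>, those with
  sum \<plusminus>f cancel the residual of \<open>c\<close> and cost no more mass than its size,
  those with sum 0 never count, and the rest is bounded by \<open>d2\<close>. The function
  \<open>m\<close> is a common majorant of both coefficient families.\<close>

lemma perturb:
  fixes c v :: "int \<Rightarrow> real \<Rightarrow> complex" and f :: int
  defines "c' \<equiv> \<lambda>\<xi> t. c \<xi> t + v \<xi> t"
  assumes c: "tpoly c" and v: "tpoly v" and X: "X = supp c" and V: "supp v \<subseteq> V" "finite V"
    and dis: "X \<inter> V = {}" and k: "k > 0"
    and m: "\<And>\<xi>. \<xi> \<in> X \<Longrightarrow> supn (c \<xi>) \<le> m \<xi>" "\<And>\<xi>. \<xi> \<in> V \<Longrightarrow> supn (v \<xi>) \<le> m \<xi>"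
    and mix: "(\<Sum>\<xi>\<in>{\<xi>\<in>mixed k X V. (\<Sum>i<k. \<xi> i) \<noteq> 0}. (\<Prod>i<k. m (\<xi> i)) * \<bar>of_int (\<Sum>i<k. \<xi> i)\<bar> powr (-s)) \<le> d1"
    and pure: "(\<Sum>\<xi>\<in>{\<xi>\<in>{..<k} \<rightarrow>\<^sub>E V. (\<Sum>i<k. \<xi> i) \<noteq> 0 \<and> \<bar>\<Sum>i<k. \<xi> i\<bar> \<noteq> f}.
        (\<Prod>i<k. m (\<xi> i)) * \<bar>of_int (\<Sum>i<k. \<xi> i)\<bar> powr (-s)) \<le> d2"
    and f: "f > 0"
    and kill: "\<And>g t. \<bar>g\<bar> = f \<Longrightarrow> conv k v g t = - resid \<sigma> k c g t"
    and killmass: "\<And>g. \<bar>g\<bar> = f \<Longrightarrow> (\<Sum>\<xi>\<in>{\<xi>\<in>{..<k} \<rightarrow>\<^sub>E V. (\<Sum>i<k. \<xi> i) = g}. supn (\<lambda>t. \<Prod>i<k. v (\<xi> i) t)) \<le> supn (resid \<sigma> k c g)"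
    and lin: "\<And>F. finite F \<Longrightarrow> 0 \<notin> F \<Longrightarrow> (\<Sum>\<xi>\<in>F. supn (airy \<sigma> v \<xi>) * \<bar>of_int \<xi>\<bar> powr (-s)) \<le> d3"
  shows "tpoly c'"
    and "mass k s c' \<le> mass k s c + (supn (resid \<sigma> k c f) + supn (resid \<sigma> k c (-f))) * of_int f powr (-s) + d1 + d2"
    and "\<And>F. finite F \<Longrightarrow> 0 \<notin> F \<Longrightarrow>
      (\<Sum>\<xi>\<in>F. supn (\<lambda>t. resid \<sigma> k c' \<xi> t - (if \<bar>\<xi>\<bar> = f then 0 else resid \<sigma> k c \<xi> t)) * \<bar>of_int \<xi>\<bar> powr (-s)) \<le> d1 + d2 + d3"
proof -
  have finX: "finite X" using c X by (simp add: tpolyD)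
  have sc': "supp c' \<subseteq> X \<union> V" using V X by (auto simp: supp_def c'_def) fastforce
  have v0: "v \<xi> t = 0" if "\<xi> \<in> X" for \<xi> t using that dis V(1) by (auto intro: not_supp)
  have c0: "c \<xi> t = 0" if "\<xi> \<in> V" for \<xi> t using that dis X by (auto intro: not_supp)
  have V0: "0 \<notin> supp v" using v by (simp add: tpolyD)
  show c': "tpoly c'"
    unfolding tpoly_def
  proof (intro conjI allI)
    show "finite (supp c')" using finite_subset[OF sc'] finX V by blast
    show "0 \<notin> supp c'" using tpolyD(2)[OF c] tpolyD(2)[OF v] by (auto simp: supp_def c'_def)
    show "c' \<xi> \<in> flat" for \<xi> unfolding c'_def by (intro flat.add tpolyD c v)
    show "c' (- \<xi>) t = cnj (c' \<xi> t)" for \<xi> t by (simp add: c'_def tpolyD(4) c v)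
  qed
  have fin: "finite (X \<union> V)" using finX V by blast
  have prodX: "(\<Prod>i<k. c' (\<xi> i) t) = (\<Prod>i<k. c (\<xi> i) t)" if "\<xi> \<in> {..<k} \<rightarrow>\<^sub>E X" for \<xi> t
    using that by (intro prod.cong) (auto simp: c'_def v0 PiE_iff)
  have prodV: "(\<Prod>i<k. c' (\<xi> i) t) = (\<Prod>i<k. v (\<xi> i) t)" if "\<xi> \<in> {..<k} \<rightarrow>\<^sub>E V" for \<xi> t
    using that by (intro prod.cong) (auto simp: c'_def c0 PiE_iff)
  have cont: "continuous_on {0..1} (c' \<xi>)" for \<xi> by (intro flat_continuous tpolyD c')
  have m': "supn (c' \<xi>) \<le> m \<xi>" if "\<xi> \<in> X \<union> V" for \<xi>
    using that m[of \<xi>] by (auto simp: c'_def v0 c0)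
  have prodm: "supn (\<lambda>t. \<Prod>i<k. c' (\<xi> i) t) \<le> (\<Prod>i<k. m (\<xi> i))" if "\<xi> \<in> {..<k} \<rightarrow>\<^sub>E (X \<union> V)" for \<xi>
  proof -
    have "supn (\<lambda>t. \<Prod>i<k. c' (\<xi> i) t) \<le> (\<Prod>i<k. supn (c' (\<xi> i)))" by (intro supn_prod cont)
    also have "\<dots> \<le> (\<Prod>i<k. m (\<xi> i))"
      using that by (intro prod_mono conjI supn_nonneg cont m') (auto simp: PiE_iff)
    finally show ?thesis .
  qed
  have m0: "0 \<le> m \<xi>" if "\<xi> \<in> X \<union> V" for \<xi> using order_trans[OF supn_nonneg[OF cont] m'] that .
  have pm0: "0 \<le> (\<Prod>i<k. m (\<xi> i))" if "\<xi> \<in> {..<k} \<rightarrow>\<^sub>E (X \<union> V)" for \<xi>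
    using that by (intro prod_nonneg m0) (auto simp: PiE_iff)
  have mixsub: "mixed k X V \<subseteq> {..<k} \<rightarrow>\<^sub>E (X \<union> V)" by (auto simp: mixed_def)
  have Vsub: "{..<k} \<rightarrow>\<^sub>E V \<subseteq> {..<k} \<rightarrow>\<^sub>E (X \<union> V)" by (intro PiE_mono) auto
  note finT = finite_tuples[OF fin, of k]
  note finM = finite_subset[OF mixsub finT] and finV = finite_subset[OF Vsub finT]
  let ?S = "\<lambda>\<xi>. \<Sum>i<k. \<xi> i"
  let ?w = "\<lambda>g::int. \<bar>real_of_int g\<bar> powr (-s)"
  have convc': "conv k c' g t = conv k c g t + (\<Sum>\<xi>\<in>{\<xi>\<in>mixed k X V. ?S \<xi> = g}. \<Prod>i<k. c' (\<xi> i) t) + conv k v g t" for g t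
    unfolding conv_superset[OF fin sc'] conv_superset[OF V(2,1)] sum_tuples_union[OF finX V(2) dis k]
    unfolding conv_def X[symmetric]
    by (intro arg_cong2[where f = "(+)"] sum.cong refl) (auto simp: prodX prodV)
  have massc': "mass k s c' = mass k s c
      + (\<Sum>\<xi>\<in>{\<xi>\<in>mixed k X V. ?S \<xi> \<noteq> 0}. supn (\<lambda>t. \<Prod>i<k. c' (\<xi> i) t) * ?w (?S \<xi>))
      + (\<Sum>\<xi>\<in>{\<xi>\<in>{..<k} \<rightarrow>\<^sub>E V. ?S \<xi> \<noteq> 0}. supn (\<lambda>t. \<Prod>i<k. v (\<xi> i) t) * ?w (?S \<xi>))"
    unfolding mass_superset[OF fin sc'] sum_tuples_union[OF finX V(2) dis k]
    unfolding mass_def X[symmetric]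
    by (intro arg_cong2[where f = "(+)"] sum.cong refl) (auto simp: prodX prodV)
  have b1: "(\<Sum>\<xi>\<in>{\<xi>\<in>mixed k X V. ?S \<xi> \<noteq> 0}. supn (\<lambda>t. \<Prod>i<k. c' (\<xi> i) t) * ?w (?S \<xi>)) \<le> d1"
    using mixsub by (intro order_trans[OF sum_mono mix] mult_right_mono prodm) auto
  have b2: "(\<Sum>\<xi>\<in>{\<xi>\<in>{..<k} \<rightarrow>\<^sub>E V. ?S \<xi> \<noteq> 0}. supn (\<lambda>t. \<Prod>i<k. v (\<xi> i) t) * ?w (?S \<xi>))
     = (\<Sum>\<xi>\<in>{\<xi>\<in>{..<k} \<rightarrow>\<^sub>E V. ?S \<xi> \<noteq> 0 \<and> \<bar>?S \<xi>\<bar> \<noteq> f}. supn (\<lambda>t. \<Prod>i<k. v (\<xi> i) t) * ?w (?S \<xi>))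
      + (\<Sum>\<xi>\<in>{\<xi>\<in>{..<k} \<rightarrow>\<^sub>E V. ?S \<xi> = f}. supn (\<lambda>t. \<Prod>i<k. v (\<xi> i) t)) * ?w f
      + (\<Sum>\<xi>\<in>{\<xi>\<in>{..<k} \<rightarrow>\<^sub>E V. ?S \<xi> = -f}. supn (\<lambda>t. \<Prod>i<k. v (\<xi> i) t)) * ?w (-f)"
    unfolding sum_distrib_right
    by (rule trans[OF sum_fibres_pm[OF finV f, of _ ?S]])
      (intro arg_cong2[where f = "(+)"] sum.cong refl; simp)
  have b3: "(\<Sum>\<xi>\<in>{\<xi>\<in>{..<k} \<rightarrow>\<^sub>E V. ?S \<xi> \<noteq> 0 \<and> \<bar>?S \<xi>\<bar> \<noteq> f}. supn (\<lambda>t. \<Prod>i<k. v (\<xi> i) t) * ?w (?S \<xi>)) \<le> d2"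
    using Vsub by (intro order_trans[OF sum_mono pure] mult_right_mono)
      (auto simp flip: prodV intro!: prodm)
  have b4: "(\<Sum>\<xi>\<in>{\<xi>\<in>{..<k} \<rightarrow>\<^sub>E V. ?S \<xi> = g}. supn (\<lambda>t. \<Prod>i<k. v (\<xi> i) t)) * ?w g \<le> supn (resid \<sigma> k c g) * ?w g"
    if "\<bar>g\<bar> = f" for g by (intro mult_right_mono killmass that) auto
  show "mass k s c' \<le> mass k s c + (supn (resid \<sigma> k c f) + supn (resid \<sigma> k c (-f))) * of_int f powr (-s) + d1 + d2"
  proof -
    have w: "?w f = of_int f powr (-s)" "?w (-f) = of_int f powr (-s)" using f by auto
    have "\<bar>f\<bar> = f" "\<bar>-f\<bar> = f" using f by auto
    from b4[OF this(1)] b4[OF this(2)] show ?thesis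
      using massc' b1 b2 b3 unfolding w distrib_right by linarith
  qed
  fix F :: "int set" assume F: "finite F" "0 \<notin> F"
  have airy': "airy \<sigma> c' \<xi> t = airy \<sigma> c \<xi> t + airy \<sigma> v \<xi> t" for \<xi> t
  proof -
    have "vector_derivative (c' \<xi>) (at t) = vector_derivative (c \<xi>) (at t) + vector_derivative (v \<xi>) (at t)"
      unfolding c'_def
      by (intro vector_derivative_at has_vector_derivative_add flat_has_vector_derivative tpolyD c v)
    then show ?thesis by (simp add: airy_def c'_def add_divide_distrib algebra_simps)
  qed
  \<comment> \<open>The weight depends on the sum of a tuple only, so it can be carried into the
    fibre sums. Added over \<open>F\<close>, these are disjoint pieces of the sums in
    \<open>mix\<close> and \<open>pure\<close>.\<close>
  have main: "supn (\<lambda>t. resid \<sigma> k c' \<xi> t - (if \<bar>\<xi>\<bar> = f then 0 else resid \<sigma> k c \<xi> t)) * ?w \<xi>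
     \<le> supn (airy \<sigma> v \<xi>) * ?w \<xi> + (\<Sum>\<eta>\<in>{\<eta>\<in>mixed k X V. ?S \<eta> = \<xi>}. (\<Prod>i<k. m (\<eta> i)) * ?w (?S \<eta>))
       + (\<Sum>\<eta>\<in>{\<eta>\<in>{\<eta>\<in>{..<k} \<rightarrow>\<^sub>E V. \<bar>?S \<eta>\<bar> \<noteq> f}. ?S \<eta> = \<xi>}. (\<Prod>i<k. m (\<eta> i)) * ?w (?S \<eta>))" for \<xi>
  proof -
    let ?M = "\<lambda>t. \<Sum>\<eta>\<in>{\<eta>\<in>mixed k X V. ?S \<eta> = \<xi>}. \<Prod>i<k. c' (\<eta> i) t"
    let ?P = "\<lambda>t. \<Sum>\<eta>\<in>{\<eta>\<in>{\<eta>\<in>{..<k} \<rightarrow>\<^sub>E V. \<bar>?S \<eta>\<bar> \<noteq> f}. ?S \<eta> = \<xi>}. \<Prod>i<k. c' (\<eta> i) t"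
    have P: "?P t = (if \<bar>\<xi>\<bar> = f then 0 else conv k v \<xi> t)" for t
    proof (cases "\<bar>\<xi>\<bar> = f")
      case True
      then have "{\<eta>\<in>{\<eta>\<in>{..<k} \<rightarrow>\<^sub>E V. \<bar>?S \<eta>\<bar> \<noteq> f}. ?S \<eta> = \<xi>} = {}" by auto
      then show ?thesis using True by (simp only: sum.empty if_True simp_thms)
    next
      case False
      then have "{\<eta>\<in>{\<eta>\<in>{..<k} \<rightarrow>\<^sub>E V. \<bar>?S \<eta>\<bar> \<noteq> f}. ?S \<eta> = \<xi>} = {\<eta>\<in>{..<k} \<rightarrow>\<^sub>E V. ?S \<eta> = \<xi>}" by auto
      then show ?thesis using False by (simp add: conv_superset[OF V(2,1)] prodV)
    qed
    \<comment> \<open>At the modes \<plusminus>f the pure part is used up against the old residual;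
      only the linear part of \<open>v\<close> and the mixed tuples remain there.\<close>
    have eq: "resid \<sigma> k c' \<xi> t - (if \<bar>\<xi>\<bar> = f then 0 else resid \<sigma> k c \<xi> t)
        = (airy \<sigma> v \<xi> t + ?M t) + ?P t" for t
      unfolding P using kill[of \<xi> t] by (auto simp: resid_def airy' convc')
    have contM: "continuous_on {0..1} ?M" "continuous_on {0..1} ?P" "continuous_on {0..1} (airy \<sigma> v \<xi>)"
      by (intro continuous_on_sum tuple_continuous c' flat_continuous airy_flat v)+
    have "supn (\<lambda>t. resid \<sigma> k c' \<xi> t - (if \<bar>\<xi>\<bar> = f then 0 else resid \<sigma> k c \<xi> t))
        \<le> (supn (airy \<sigma> v \<xi>) + supn ?M) + supn ?P"
      unfolding eq by (rule order_trans[OF supn_add add_mono[OF supn_add order_refl]])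
        (intro continuous_on_add contM)+
    also have "\<dots> \<le> (supn (airy \<sigma> v \<xi>) + (\<Sum>\<eta>\<in>{\<eta>\<in>mixed k X V. ?S \<eta> = \<xi>}. (\<Prod>i<k. m (\<eta> i))))
        + (\<Sum>\<eta>\<in>{\<eta>\<in>{\<eta>\<in>{..<k} \<rightarrow>\<^sub>E V. \<bar>?S \<eta>\<bar> \<noteq> f}. ?S \<eta> = \<xi>}. (\<Prod>i<k. m (\<eta> i)))"
      using mixsub Vsub finM finV
      by (intro add_mono order_refl; intro order_trans[OF supn_sum sum_mono] tuple_continuous c' prodm) auto
    finally have "supn (\<lambda>t. resid \<sigma> k c' \<xi> t - (if \<bar>\<xi>\<bar> = f then 0 else resid \<sigma> k c \<xi> t)) * ?w \<xi> \<le> \<dots> * ?w \<xi>"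
      by (rule mult_right_mono) auto
    also have "\<dots> = supn (airy \<sigma> v \<xi>) * ?w \<xi> + (\<Sum>\<eta>\<in>{\<eta>\<in>mixed k X V. ?S \<eta> = \<xi>}. (\<Prod>i<k. m (\<eta> i)) * ?w (?S \<eta>))
       + (\<Sum>\<eta>\<in>{\<eta>\<in>{\<eta>\<in>{..<k} \<rightarrow>\<^sub>E V. \<bar>?S \<eta>\<bar> \<noteq> f}. ?S \<eta> = \<xi>}. (\<Prod>i<k. m (\<eta> i)) * ?w (?S \<eta>))"
      unfolding distrib_right sum_distrib_right by (intro arg_cong2[where f = "(+)"] sum.cong refl) auto
    finally show ?thesis .
  qed
  have "(\<Sum>\<xi>\<in>F. supn (\<lambda>t. resid \<sigma> k c' \<xi> t - (if \<bar>\<xi>\<bar> = f then 0 else resid \<sigma> k c \<xi> t)) * ?w \<xi>)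
     \<le> (\<Sum>\<xi>\<in>F. supn (airy \<sigma> v \<xi>) * ?w \<xi>) + (\<Sum>\<xi>\<in>F. \<Sum>\<eta>\<in>{\<eta>\<in>mixed k X V. ?S \<eta> = \<xi>}. (\<Prod>i<k. m (\<eta> i)) * ?w (?S \<eta>))
       + (\<Sum>\<xi>\<in>F. \<Sum>\<eta>\<in>{\<eta>\<in>{\<eta>\<in>{..<k} \<rightarrow>\<^sub>E V. \<bar>?S \<eta>\<bar> \<noteq> f}. ?S \<eta> = \<xi>}. (\<Prod>i<k. m (\<eta> i)) * ?w (?S \<eta>))"
    unfolding sum.distrib[symmetric] by (intro sum_mono main)
  also have "(\<Sum>\<xi>\<in>F. \<Sum>\<eta>\<in>{\<eta>\<in>mixed k X V. ?S \<eta> = \<xi>}. (\<Prod>i<k. m (\<eta> i)) * ?w (?S \<eta>)) \<le> d1"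
    by (rule order_trans[OF sum_fibres_le[where Q = "\<lambda>\<eta>. ?S \<eta> \<noteq> 0"] mix])
      (use finM F mixsub pm0 in auto)
  also have "(\<Sum>\<xi>\<in>F. \<Sum>\<eta>\<in>{\<eta>\<in>{\<eta>\<in>{..<k} \<rightarrow>\<^sub>E V. \<bar>?S \<eta>\<bar> \<noteq> f}. ?S \<eta> = \<xi>}. (\<Prod>i<k. m (\<eta> i)) * ?w (?S \<eta>))
      \<le> (\<Sum>\<eta>\<in>{\<eta>\<in>{\<eta>\<in>{..<k} \<rightarrow>\<^sub>E V. \<bar>?S \<eta>\<bar> \<noteq> f}. ?S \<eta> \<noteq> 0}. (\<Prod>i<k. m (\<eta> i)) * ?w (?S \<eta>))"
    by (rule sum_fibres_le) (use finV F Vsub pm0 in auto)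
  also have "{\<eta>\<in>{\<eta>\<in>{..<k} \<rightarrow>\<^sub>E V. \<bar>?S \<eta>\<bar> \<noteq> f}. ?S \<eta> \<noteq> 0} = {\<xi>\<in>{..<k} \<rightarrow>\<^sub>E V. ?S \<xi> \<noteq> 0 \<and> \<bar>?S \<xi>\<bar> \<noteq> f}" by auto
  also have "(\<Sum>\<xi>\<in>F. supn (airy \<sigma> v \<xi>) * ?w \<xi>) \<le> d3" by (intro lin F)
  also note pure
  finally show "(\<Sum>\<xi>\<in>F. supn (\<lambda>t. resid \<sigma> k c' \<xi> t - (if \<bar>\<xi>\<bar> = f then 0 else resid \<sigma> k c \<xi> t)) * ?w \<xi>) \<le> d1 + d2 + d3"
    by simp
qed

subsection \<open>Resonant building blocks\<close>

text \<open>Pairs of a carrier and an offset. One pair (1 - k, 1) and k - 1 copies of (1, 0) add up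
  to (0, 1): the carriers cancel and one unit of offset survives. The other two pairs are the
  negatives that a real function requires.\<close>

definition wave_types :: "nat \<Rightarrow> (int \<times> int) set" where
  "wave_types k = {(1, 0), (-1, 0), (1 - int k, 1), (int k - 1, -1)}"

definition amp :: "(real \<Rightarrow> complex) \<Rightarrow> (real \<Rightarrow> complex) \<Rightarrow> int \<times> int \<Rightarrow> real \<Rightarrow> complex" where
  "amp a b \<tau> t = (if snd \<tau> = 0 then a t else if snd \<tau> = 1 then b t else cnj (b t))"

text \<open>Every type satisfies n + (k - 1) e <= 1 - |e|. When the carriers cancel, summation gives
  (k - 1) E <= k - sum |e| for the total offset E. As E is a positive integer and at most sum |e|,
  both must equal 1: one wave has offset 1 and all others have offset 0.\<close>

lemma resonant_types:
  fixes n e :: "nat \<Rightarrow> int"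
  assumes k: "k \<ge> 2" and ty: "\<And>i. i < k \<Longrightarrow> (n i, e i) \<in> wave_types k"
    and n: "(\<Sum>i<k. n i) = 0" and e: "(\<Sum>i<k. e i) > 0"
  shows "(\<Sum>i<k. e i) = 1" and "(\<Prod>i<k. amp a b (n i, e i) t) = a t ^ (k - 1) * b t"
proof -
  let ?E = "\<Sum>i<k. e i"
  have each: "n i + (int k - 1) * e i \<le> 1 - \<bar>e i\<bar>" if "i < k" for i
    using ty[OF that] by (auto simp: wave_types_def)
  have "(\<Sum>i<k. n i + (int k - 1) * e i) \<le> (\<Sum>i<k. 1 - \<bar>e i\<bar>)"
    by (intro sum_mono each) auto
  then have le: "(int k - 1) * ?E \<le> int k - (\<Sum>i<k. \<bar>e i\<bar>)"
    using n by (simp add: sum.distrib sum_distrib_left sum_subtractf)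
  have ge: "?E \<le> (\<Sum>i<k. \<bar>e i\<bar>)" by (intro sum_mono) auto
  have "(int k - 1) * ?E \<le> (int k - 1) * 1" using le ge e by simp
  then have "?E \<le> 1" using k by (subst (asm) mult_le_cancel_left_pos) auto
  then show E1: "?E = 1" using e by simp
  with le ge have abs1: "(\<Sum>i<k. \<bar>e i\<bar>) = 1" by simp
  have "\<exists>i<k. e i \<noteq> 0"
  proof (rule ccontr)
    assume "\<not> (\<exists>i<k. e i \<noteq> 0)"
    then have "?E = 0" by (intro sum.neutral) auto
    with E1 show False by simp
  qed
  then obtain i0 where i0: "i0 < k" "e i0 \<noteq> 0" by blast
  have "\<bar>e i0\<bar> + (\<Sum>i\<in>{..<k} - {i0}. \<bar>e i\<bar>) = 1"
    using abs1 i0 by (subst (asm) sum.remove[of _ i0]) auto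
  then have "(\<Sum>i\<in>{..<k} - {i0}. \<bar>e i\<bar>) = 0"
    using i0 sum_nonneg[of "{..<k} - {i0}" "\<lambda>i. \<bar>e i\<bar>"] by linarith
  then have others: "e i = 0" if "i < k" "i \<noteq> i0" for i
    using that by (subst (asm) sum_nonneg_eq_0_iff) auto
  have "e i0 + (\<Sum>i\<in>{..<k} - {i0}. e i) = 1" using E1 i0 by (subst (asm) sum.remove[of _ i0]) auto
  moreover have "(\<Sum>i\<in>{..<k} - {i0}. e i) = 0" using others by (intro sum.neutral) auto
  ultimately have "e i0 = 1" by simp
  have "(\<Prod>i<k. amp a b (n i, e i) t) = amp a b (n i0, e i0) t * (\<Prod>i\<in>{..<k} - {i0}. amp a b (n i, e i) t)"
    using i0 by (intro prod.remove) auto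
  also have "(\<Prod>i\<in>{..<k} - {i0}. amp a b (n i, e i) t) = (\<Prod>i\<in>{..<k} - {i0}. a t)"
    using others by (intro prod.cong) (auto simp: amp_def)
  also have "\<dots> = a t ^ (k - 1)" using i0 by simp
  finally show "(\<Prod>i<k. amp a b (n i, e i) t) = a t ^ (k - 1) * b t"
    using \<open>e i0 = 1\<close> by (simp add: amp_def)
qed

text \<open>A wave of type \<open>(n, e)\<close> has frequency near \<open>n k M L\<close>, offset by \<open>e f\<close>. In a sum of \<open>k\<close> frequencies,
  \<open>L > 2 k f\<close> separates the offsets from the multiples of \<open>L\<close>, and the factor \<open>k M\<close> separates the carriers \<open>n\<close>
  from the positions \<open>j\<close>. The sum \<open>rho\<close> normalises the resonant interaction.\<close>

locale block =
  fixes k M :: nat and f L :: int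
  assumes k: "k \<ge> 2" and M: "M \<ge> 1" and f: "f > 0" and L: "L \<ge> 2 * int k * f"
begin

definition enc :: "(int \<times> int) \<times> int \<Rightarrow> int" where
  "enc p = L * (int k * int M * fst (fst p) + snd p) + snd (fst p) * f"

definition idx :: "((int \<times> int) \<times> int) set" where
  "idx = wave_types k \<times> {- int M<..<int M}"

definition freqs :: "int set" where
  "freqs = enc ` idx"

definition dec :: "int \<Rightarrow> (int \<times> int) \<times> int" where
  "dec = inv_into idx enc"

definition wt :: "int \<Rightarrow> real" where
  "wt j = (real M - \<bar>of_int j\<bar>) / real M"

definition blk :: "real \<Rightarrow> (real \<Rightarrow> complex) \<Rightarrow> (real \<Rightarrow> complex) \<Rightarrow> int \<Rightarrow> real \<Rightarrow> complex" where
  "blk A a b \<xi> t = (if \<xi> \<in> freqs then of_real (A * wt (snd (dec \<xi>))) * amp a b (fst (dec \<xi>)) t else 0)"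

definition rho :: "real \<Rightarrow> real" where
  "rho A = (\<Sum>\<xi>\<in>{\<xi>\<in>{..<k} \<rightarrow>\<^sub>E freqs. (\<Sum>i<k. \<xi> i) = f}. \<Prod>i<k. A * wt (snd (dec (\<xi> i))))"

lemma L_pos: "L > 0"
proof -
  have "2 * int k * f > 0" using k f by simp
  then show ?thesis using L by linarith
qed

lemma L_ge: "L \<ge> 4 * f"
proof -
  have "4 * f \<le> 2 * int k * f" using k f by (intro mult_right_mono) auto
  then show ?thesis using L by linarith
qed

lemma typesD:
  assumes "p \<in> idx"
  shows "\<bar>fst (fst p)\<bar> \<ge> 1" "\<bar>fst (fst p)\<bar> \<le> int k - 1" "\<bar>snd (fst p)\<bar> \<le> 1" "\<bar>snd p\<bar> \<le> int M - 1"
  using assms k by (auto simp: idx_def wave_types_def)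

text \<open>Since L >= 4 f, a change of offset by at most 2 cannot make up for a change by one step
  \<open>L\<close>.\<close>

lemma enc_ne: "L * q + f * d = L * q' + f * d' \<Longrightarrow> \<bar>d - d'\<bar> \<le> 2 \<Longrightarrow> d = d' \<and> q = q'" for q q' d d' :: int
proof -
  assume h: "L * q + f * d = L * q' + f * d'" and d: "\<bar>d - d'\<bar> \<le> 2"
  have eq: "L * (q - q') = f * (d' - d)" using h by (simp add: algebra_simps)
  have "q = q'"
  proof (rule ccontr)
    assume "q \<noteq> q'"
    then have "L * 1 \<le> L * \<bar>q - q'\<bar>" using L_pos by (intro mult_left_mono) auto
    also have "\<dots> = f * \<bar>d' - d\<bar>"
      using arg_cong[OF eq, of abs] L_pos f by (simp add: abs_mult)
    also have "\<dots> \<le> f * 2" using d f by (intro mult_left_mono) auto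
    finally show False using L_ge f by linarith
  qed
  then show ?thesis using eq f by auto
qed

text \<open>Once the offset is separated, carriers are spaced by k M >= 2 M while two positions
  differ by at most 2 M - 2.\<close>

lemma inj_enc: "inj_on enc idx"
proof (rule inj_onI)
  fix p p' assume p: "p \<in> idx" and p': "p' \<in> idx" and "enc p = enc p'"
  then have eq: "L * (int k * int M * fst (fst p) + snd p) + f * snd (fst p)
      = L * (int k * int M * fst (fst p') + snd p') + f * snd (fst p')"
    by (simp add: enc_def mult.commute)
  have "\<bar>snd (fst p) - snd (fst p')\<bar> \<le> 2" using typesD(3)[OF p] typesD(3)[OF p'] by linarith
  from enc_ne[OF eq this] have e: "snd (fst p) = snd (fst p')"
    and q: "int k * int M * fst (fst p) + snd p = int k * int M * fst (fst p') + snd p'" by auto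
  have eq2: "int k * int M * (fst (fst p) - fst (fst p')) = snd p' - snd p"
    using q by (simp add: algebra_simps)
  have n: "fst (fst p) = fst (fst p')"
  proof (rule ccontr)
    assume "fst (fst p) \<noteq> fst (fst p')"
    then have "int k * int M * 1 \<le> int k * int M * \<bar>fst (fst p) - fst (fst p')\<bar>"
      by (intro mult_left_mono) auto
    also have "\<dots> = \<bar>snd p' - snd p\<bar>" unfolding eq2[symmetric] by (simp add: abs_mult)
    also have "\<dots> \<le> 2 * int M - 2" using typesD(4)[OF p] typesD(4)[OF p'] by linarith
    finally have "int k * int M \<le> 2 * int M - 2" by simp
    moreover have "2 * int M \<le> int k * int M" using k by (intro mult_right_mono) auto
    ultimately show False by simp
  qed
  show "p = p'" using e n eq2 by (auto simp: prod_eq_iff)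
qed

lemma dec: "\<xi> \<in> freqs \<Longrightarrow> dec \<xi> \<in> idx" "\<xi> \<in> freqs \<Longrightarrow> enc (dec \<xi>) = \<xi>"
  by (auto simp: freqs_def dec_def inv_into_into f_inv_into_f)

lemma dec_enc: "p \<in> idx \<Longrightarrow> dec (enc p) = p"
  using inj_enc by (simp add: dec_def)

lemma idx_minus: "p \<in> idx \<Longrightarrow> - p \<in> idx"
  by (auto simp: idx_def wave_types_def)

lemma enc_minus: "enc (- p) = - enc p"
  by (simp add: enc_def algebra_simps)

lemma freqs_minus: "\<xi> \<in> freqs \<Longrightarrow> - \<xi> \<in> freqs"
  using idx_minus by (auto simp: freqs_def simp flip: enc_minus)

lemma dec_minus: "\<xi> \<in> freqs \<Longrightarrow> dec (- \<xi>) = - dec \<xi>"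
  by (metis dec dec_enc enc_minus idx_minus)

lemma finite_idx: "finite idx"
  by (simp add: idx_def wave_types_def)

lemma finite_freqs: "finite freqs"
  by (simp add: freqs_def finite_idx)

lemma card_freqs: "card freqs \<le> 8 * M"
proof -
  have "card freqs \<le> card idx" by (simp add: freqs_def card_image_le finite_idx)
  also have "\<dots> = card (wave_types k) * (2 * M - 1)"
  proof -
    have "nat (2 * int M - 1) = 2 * M - 1" using M by linarith
    then show ?thesis by (simp add: idx_def card_cartesian_product)
  qed
  also have "\<dots> \<le> 4 * (2 * M)"
    by (intro mult_mono) (auto simp: wave_types_def card_insert_if)
  finally show ?thesis by simp
qed

text \<open>The bracket in \<open>enc\<close> has absolute value between M + 1 and k^2 M - 1. The
  spare unit, worth \<open>L\<close>, absorbs the offset.\<close>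

lemma freqs_bounds:
  assumes "\<xi> \<in> freqs"
  shows "\<bar>\<xi>\<bar> \<ge> L * int M" "\<bar>\<xi>\<bar> \<le> L * (int k ^ 2 * int M)"
proof -
  obtain p where p: "p \<in> idx" and \<xi>: "\<xi> = enc p" using assms by (auto simp: freqs_def)
  let ?n = "fst (fst p)" and ?e = "snd (fst p)" and ?j = "snd p"
  note b = typesD[OF p]
  have e: "\<bar>?e * f\<bar> \<le> f" using b(3) f mult_right_mono[of "\<bar>?e\<bar>" 1 f] by (simp add: abs_mult)
  have eq: "\<bar>L * (int k * int M * ?n + ?j)\<bar> = L * \<bar>int k * int M * ?n + ?j\<bar>"
    using L_pos by (simp add: abs_mult)
  have kM: "\<bar>int k * int M * ?n\<bar> = int k * int M * \<bar>?n\<bar>" by (simp add: abs_mult)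
  have "int k * int M * 1 \<le> int k * int M * \<bar>?n\<bar>" using b by (intro mult_left_mono) auto
  moreover have "2 * int M \<le> int k * int M" using k by (intro mult_right_mono) auto
  ultimately have "\<bar>int k * int M * ?n + ?j\<bar> \<ge> int M + 1" using b(4) kM by linarith
  then have "L * (int M + 1) \<le> L * \<bar>int k * int M * ?n + ?j\<bar>" using L_pos by (intro mult_left_mono) auto
  then show "\<bar>\<xi>\<bar> \<ge> L * int M" using e eq L_ge f unfolding \<xi> enc_def by (simp add: distrib_left)
  have "int k * int M * \<bar>?n\<bar> \<le> int k * int M * (int k - 1)" using b by (intro mult_left_mono) auto
  moreover have "int M \<le> int k * int M" using k mult_right_mono[of 1 "int k" "int M"] by simp
  ultimately have "\<bar>int k * int M * ?n + ?j\<bar> \<le> int k ^ 2 * int M - 1" using b(4) kM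
    by (simp add: power2_eq_square algebra_simps)
  then have "L * \<bar>int k * int M * ?n + ?j\<bar> \<le> L * (int k ^ 2 * int M - 1)" using L_pos by (intro mult_left_mono) auto
  then show "\<bar>\<xi>\<bar> \<le> L * (int k ^ 2 * int M)" using e eq L_ge f unfolding \<xi> enc_def by (simp add: right_diff_distrib)
qed

lemma tuple_sum:
  assumes "\<xi> \<in> {..<k} \<rightarrow>\<^sub>E freqs"
  obtains n e j where "\<And>i. i < k \<Longrightarrow> dec (\<xi> i) = ((n i, e i), j i)" "\<And>i. i < k \<Longrightarrow> (n i, e i) \<in> wave_types k"
    "(\<Sum>i<k. \<xi> i) = L * (int k * int M * (\<Sum>i<k. n i) + (\<Sum>i<k. j i)) + f * (\<Sum>i<k. e i)"
    "\<bar>\<Sum>i<k. e i\<bar> \<le> int k" "\<bar>\<Sum>i<k. j i\<bar> < int k * int M"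
proof -
  let ?n = "\<lambda>i. fst (fst (dec (\<xi> i)))" and ?e = "\<lambda>i. snd (fst (dec (\<xi> i)))" and ?j = "\<lambda>i. snd (dec (\<xi> i))"
  have F: "\<xi> i \<in> freqs" if "i < k" for i using assms that by auto
  note D = typesD[OF dec(1)[OF F]]
  have 1: "(\<Sum>i<k. \<xi> i) = (\<Sum>i<k. enc (dec (\<xi> i)))" using dec(2)[OF F] by simp
  have 2: "(?n i, ?e i) \<in> wave_types k" if "i < k" for i
    using dec(1)[OF F[OF that]] by (auto simp: idx_def)
  have 3: "\<bar>\<Sum>i<k. ?e i\<bar> \<le> int k"
  proof -
    have "\<bar>\<Sum>i<k. ?e i\<bar> \<le> (\<Sum>i<k. \<bar>?e i\<bar>)" by (rule sum_abs)
    also have "\<dots> \<le> (\<Sum>i<k. 1)" by (intro sum_mono) (use D(3) in auto)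
    finally show ?thesis by simp
  qed
  have "\<bar>\<Sum>i<k. ?j i\<bar> \<le> (\<Sum>i<k. \<bar>?j i\<bar>)" by (rule sum_abs)
  also have "\<dots> \<le> (\<Sum>i<k. int M - 1)" by (intro sum_mono) (use D(4) in auto)
  also have "\<dots> < int k * int M" using k by (simp add: algebra_simps)
  finally have 4: "\<bar>\<Sum>i<k. ?j i\<bar> < int k * int M" .
  show ?thesis
    by (rule that[of ?n ?e ?j])
      (use 1 2 3 4 in \<open>auto simp: enc_def sum.distrib sum_distrib_left mult.commute prod_eq_iff distrib_left mult.left_commute\<close>)
qed

text \<open>Write the sum as L q + f E. If q is nonzero, then |f E| <= k f <= L/2 leaves at least
  L/2. If q = 0, the positions are too small to balance a nonzero carrier total, so the carriers
  cancel and \<open>resonant_types\<close> applies: directly for E > 0, and to the negated tuple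
  with \<open>b\<close> conjugated for E < 0.\<close>

lemma resonance:
  assumes "\<xi> \<in> {..<k} \<rightarrow>\<^sub>E freqs" "(\<Sum>i<k. \<xi> i) \<noteq> 0"
  shows "2 * \<bar>\<Sum>i<k. \<xi> i\<bar> \<ge> L
    \<or> (\<Sum>i<k. \<xi> i) = f \<and> (\<forall>a b t. (\<Prod>i<k. amp a b (fst (dec (\<xi> i))) t) = a t ^ (k - 1) * b t)
    \<or> (\<Sum>i<k. \<xi> i) = -f \<and> (\<forall>a b t. (\<Prod>i<k. amp a b (fst (dec (\<xi> i))) t) = a t ^ (k - 1) * cnj (b t))"
proof -
  obtain n e j where d: "\<And>i. i < k \<Longrightarrow> dec (\<xi> i) = ((n i, e i), j i)" "\<And>i. i < k \<Longrightarrow> (n i, e i) \<in> wave_types k"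
    and S: "(\<Sum>i<k. \<xi> i) = L * (int k * int M * (\<Sum>i<k. n i) + (\<Sum>i<k. j i)) + f * (\<Sum>i<k. e i)"
    and E: "\<bar>\<Sum>i<k. e i\<bar> \<le> int k" and J: "\<bar>\<Sum>i<k. j i\<bar> < int k * int M"
    using tuple_sum[OF assms(1)] by blast
  define q where "q = int k * int M * (\<Sum>i<k. n i) + (\<Sum>i<k. j i)"
  note S = S[folded q_def]
  have pr: "(\<Prod>i<k. amp a b (fst (dec (\<xi> i))) t) = (\<Prod>i<k. amp a b (n i, e i) t)" for a b t
    using d(1) by (intro prod.cong) auto
  show ?thesis
  proof (cases "q = 0")
    case False
    then have 1: "L * 1 \<le> L * \<bar>q\<bar>" using L_pos by (intro mult_left_mono) auto
    have 2: "\<bar>f * (\<Sum>i<k. e i)\<bar> \<le> f * int k" using E f by (simp add: abs_mult)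
    have 3: "\<bar>L * q\<bar> = L * \<bar>q\<bar>" using L_pos by (simp add: abs_mult)
    have 4: "2 * (f * int k) \<le> L" using L by (simp add: mult_ac)
    have 5: "\<bar>L * q\<bar> - \<bar>f * (\<Sum>i<k. e i)\<bar> \<le> \<bar>L * q + f * (\<Sum>i<k. e i)\<bar>"
      using abs_triangle_ineq2[of "L * q" "- (f * (\<Sum>i<k. e i))"] by simp
    have "L \<le> 2 * X" if "L * 1 \<le> Q" "Y \<le> F" "Z = Q" "2 * F \<le> L" "Z - Y \<le> X" for X Y Z F Q :: int
      using that by linarith
    from this[OF 1 2 3 4 5] have "2 * \<bar>\<Sum>i<k. \<xi> i\<bar> \<ge> L" unfolding S .
    then show ?thesis by blast
  next
    case True
    have n0: "(\<Sum>i<k. n i) = 0"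
    proof (rule ccontr)
      assume "(\<Sum>i<k. n i) \<noteq> 0"
      then have "int k * int M * 1 \<le> int k * int M * \<bar>\<Sum>i<k. n i\<bar>" by (intro mult_left_mono) auto
      also have "\<dots> = \<bar>int k * int M * (\<Sum>i<k. n i)\<bar>" by (simp add: abs_mult)
      also have "\<dots> = \<bar>\<Sum>i<k. j i\<bar>" using True unfolding q_def by linarith
      finally show False using J by simp
    qed
    have S': "(\<Sum>i<k. \<xi> i) = f * (\<Sum>i<k. e i)" using S True by simp
    then have "(\<Sum>i<k. e i) \<noteq> 0" using assms(2) by auto
    then consider "(\<Sum>i<k. e i) > 0" | "(\<Sum>i<k. e i) < 0" by linarith
    then show ?thesis
    proof cases
      case 1
      from resonant_types[OF k d(2) n0 1] show ?thesis using S' pr by auto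
    next
      case 2
      have ty: "(- n i, - e i) \<in> wave_types k" if "i < k" for i
        using d(2)[OF that] by (auto simp: wave_types_def)
      have amp: "amp a b (n i, e i) t = amp a (\<lambda>t. cnj (b t)) (- n i, - e i) t" if "i < k" for a b t i
        using d(2)[OF that] by (auto simp: wave_types_def amp_def)
      have "(\<Sum>i<k. - n i) = 0" "(\<Sum>i<k. - e i) > 0" using n0 2 by (auto simp: sum_negf)
      note r = resonant_types[of k "\<lambda>i. - n i" "\<lambda>i. - e i", OF k ty this]
      have "(\<Sum>i<k. \<xi> i) = -f" using r(1) S' by (simp add: sum_negf)
      moreover have "(\<Prod>i<k. amp a b (fst (dec (\<xi> i))) t) = a t ^ (k - 1) * cnj (b t)" for a b t
        using r(2)[of a "\<lambda>t. cnj (b t)" t] by (simp add: pr amp)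
      ultimately show ?thesis by blast
    qed
  qed
qed

lemma wt_bounds: "\<bar>j\<bar> < int M \<Longrightarrow> 0 \<le> wt j \<and> wt j \<le> 1"
  using M by (auto simp: wt_def field_simps)

lemma wt_dec: "\<xi> \<in> freqs \<Longrightarrow> 0 \<le> wt (snd (dec \<xi>)) \<and> wt (snd (dec \<xi>)) \<le> 1"
  using typesD(4)[OF dec(1)] by (intro wt_bounds) auto

lemma f_lt_L: "2 * f < L"
  using L_ge f by linarith

lemma blk_prod:
  assumes "\<xi> \<in> {..<k} \<rightarrow>\<^sub>E freqs"
  shows "(\<Prod>i<k. blk A a b (\<xi> i) t)
    = of_real (\<Prod>i<k. A * wt (snd (dec (\<xi> i)))) * (\<Prod>i<k. amp a b (fst (dec (\<xi> i))) t)"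
proof -
  have "(\<Prod>i<k. blk A a b (\<xi> i) t) = (\<Prod>i<k. of_real (A * wt (snd (dec (\<xi> i)))) * amp a b (fst (dec (\<xi> i))) t)"
    using assms by (intro prod.cong) (auto simp: blk_def PiE_iff)
  then show ?thesis by (simp add: prod.distrib)
qed

text \<open>All tuples with sum \<open>f\<close> share one time profile, with nonnegative weights
  when A >= 0. This is what makes the sum of their suprema as small as the supremum of their
  sum.\<close>

lemma blk_prod_f:
  assumes "\<xi> \<in> {..<k} \<rightarrow>\<^sub>E freqs" "(\<Sum>i<k. \<xi> i) = f"
  shows "(\<Prod>i<k. blk A a b (\<xi> i) t) = of_real (\<Prod>i<k. A * wt (snd (dec (\<xi> i)))) * (a t ^ (k - 1) * b t)"
proof -
  have "(\<Prod>i<k. amp a b (fst (dec (\<xi> i))) t) = a t ^ (k - 1) * b t"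
    using resonance[OF assms(1)] assms(2) f f_lt_L by auto
  then show ?thesis using blk_prod[OF assms(1)] by simp
qed

lemma supp_blk: "supp (blk A a b) \<subseteq> freqs"
  by (auto simp: supp_def blk_def split: if_splits)

lemma conv_blk: "conv k (blk A a b) f t = of_real (rho A) * (a t ^ (k - 1) * b t)"
  unfolding conv_superset[OF finite_freqs supp_blk] rho_def of_real_sum sum_distrib_right
  by (intro sum.cong refl) (simp only: mem_Collect_eq blk_prod_f)

text \<open>Only tuples with the wave of offset 1 in the last slot are counted: the first k - 1
  positions range freely over [-m, m] and the last is minus their sum. Since 2 k m <= M, all
  positions are at most M/2 in modulus, so every weight is at least 1/2.\<close>

lemma rho_ge:
  assumes A: "A \<ge> 0" and m: "2 * k * m \<le> M"
  shows "rho A \<ge> (2 * real m + 1) ^ (k - 1) * (A / 2) ^ k"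
proof -
  let ?P = "{..<k - 1} \<rightarrow>\<^sub>E {- int m..int m}"
  define T where "T = (\<lambda>\<eta>. \<lambda>i\<in>{..<k}. if i < k - 1 then enc ((1, 0), \<eta> i) else enc ((1 - int k, 1), - (\<Sum>i<k - 1. \<eta> i)))"
  define w where "w = (\<lambda>\<xi>. \<Prod>i<k. A * wt (snd (dec (\<xi> i))))"
  have mM: "2 * int k * int m \<le> int M" using m by (metis int_ops(7) of_nat_le_iff of_nat_numeral)
  have mk: "int m \<le> int k * int m" using k mult_right_mono[of 1 "int k" "int m"] by simp
  have k1: "int (k - 1) = int k - 1" using k by simp
  have i1: "((1, 0), \<eta> i) \<in> idx" "2 * \<bar>\<eta> i\<bar> \<le> int M" if "\<eta> \<in> ?P" "i < k - 1" for \<eta> i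
  proof -
    have "\<bar>\<eta> i\<bar> \<le> int m" using that by (auto simp: PiE_iff abs_le_iff) (metis minus_le_iff lessThan_iff)
    then show "2 * \<bar>\<eta> i\<bar> \<le> int M" using mM mk by linarith
    then show "((1, 0), \<eta> i) \<in> idx" using M by (auto simp: idx_def wave_types_def)
  qed
  have i2: "((1 - int k, 1), - (\<Sum>i<k - 1. \<eta> i)) \<in> idx" "2 * \<bar>\<Sum>i<k - 1. \<eta> i\<bar> \<le> int M" if "\<eta> \<in> ?P" for \<eta>
  proof -
    have "\<bar>\<Sum>i<k - 1. \<eta> i\<bar> \<le> (\<Sum>i<k - 1. \<bar>\<eta> i\<bar>)" by (rule sum_abs)
    also have "\<dots> \<le> (\<Sum>i<k - 1. int m)"
      using that by (intro sum_mono) (auto simp: PiE_iff abs_le_iff, metis minus_le_iff lessThan_iff)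
    also have "\<dots> = (int k - 1) * int m" using k1 by simp
    finally show "2 * \<bar>\<Sum>i<k - 1. \<eta> i\<bar> \<le> int M" using mM by (simp add: algebra_simps)
    then show "((1 - int k, 1), - (\<Sum>i<k - 1. \<eta> i)) \<in> idx" using M by (auto simp: idx_def wave_types_def)
  qed
  have Tin: "T \<eta> \<in> {..<k} \<rightarrow>\<^sub>E freqs" if "\<eta> \<in> ?P" for \<eta>
    using i1[OF that] i2[OF that] by (auto simp: T_def freqs_def)
  have decT: "dec (T \<eta> i) = (if i < k - 1 then ((1, 0), \<eta> i) else ((1 - int k, 1), - (\<Sum>i<k - 1. \<eta> i)))"
    if "\<eta> \<in> ?P" "i < k" for \<eta> i
    using i1[OF that(1)] i2[OF that(1)] that(2) by (auto simp: T_def dec_enc)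
  have half: "A / 2 \<le> A * wt (snd (dec (T \<eta> i)))" if "\<eta> \<in> ?P" "i < k" for \<eta> i
  proof -
    have "2 * \<bar>snd (dec (T \<eta> i))\<bar> \<le> int M" using i1[OF that(1)] i2[OF that(1)] decT[OF that] by auto
    then have "1 / 2 \<le> wt (snd (dec (T \<eta> i)))" using M by (auto simp: wt_def field_simps)
    then have "A * (1 / 2) \<le> A * wt (snd (dec (T \<eta> i)))" using A by (intro mult_left_mono)
    then show ?thesis by simp
  qed
  have Tsum: "(\<Sum>i<k. T \<eta> i) = f" for \<eta>
  proof -
    have "k = Suc (k - 1)" using k by simp
    then have "(\<Sum>i<k. T \<eta> i) = (\<Sum>i<k - 1. T \<eta> i) + T \<eta> (k - 1)" by (metis sum.lessThan_Suc)
    also have "(\<Sum>i<k - 1. T \<eta> i) = (\<Sum>i<k - 1. enc ((1, 0), \<eta> i))"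
      by (intro sum.cong) (auto simp: T_def)
    also have "T \<eta> (k - 1) = enc ((1 - int k, 1), - (\<Sum>i<k - 1. \<eta> i))"
      using k by (simp add: T_def)
    also have "(\<Sum>i<k - 1. enc ((1, 0), \<eta> i)) + enc ((1 - int k, 1), - (\<Sum>i<k - 1. \<eta> i)) = f"
      using k1 by (simp add: enc_def sum.distrib distrib_left algebra_simps flip: sum_distrib_left)
    finally show ?thesis .
  qed
  have inj: "inj_on T ?P"
  proof (rule inj_onI)
    fix \<eta> \<eta>' assume h: "\<eta> \<in> ?P" "\<eta>' \<in> ?P" "T \<eta> = T \<eta>'"
    have "\<eta> i = \<eta>' i" if "i < k - 1" for i
      using decT[OF h(1), of i] decT[OF h(2), of i] h(3) that by simp
    then show "\<eta> = \<eta>'" using h(1,2) by (intro PiE_ext) auto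
  qed
  have "(2 * real m + 1) ^ (k - 1) * (A / 2) ^ k = (\<Sum>\<eta>\<in>?P. (A / 2) ^ k)"
    by (simp add: card_PiE add.commute)
  also have "\<dots> \<le> (\<Sum>\<eta>\<in>?P. w (T \<eta>))"
  proof (intro sum_mono)
    fix \<eta> assume "\<eta> \<in> ?P"
    then have "(\<Prod>i<k. A / 2) \<le> w (T \<eta>)"
      unfolding w_def using A by (intro prod_mono conjI half) auto
    then show "(A / 2) ^ k \<le> w (T \<eta>)" by simp
  qed
  also have "\<dots> = sum w (T ` ?P)" using sum.reindex[OF inj, of w] by (simp only: o_def)
  also have "\<dots> \<le> (\<Sum>\<xi>\<in>{\<xi>\<in>{..<k} \<rightarrow>\<^sub>E freqs. (\<Sum>i<k. \<xi> i) = f}. w \<xi>)"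
  proof (rule sum_mono2)
    show "finite {\<xi>\<in>{..<k} \<rightarrow>\<^sub>E freqs. (\<Sum>i<k. \<xi> i) = f}"
      using finite_tuples[OF finite_freqs, of k] by simp
    show "T ` ?P \<subseteq> {\<xi>\<in>{..<k} \<rightarrow>\<^sub>E freqs. (\<Sum>i<k. \<xi> i) = f}" using Tin Tsum by blast
    show "0 \<le> w \<xi>" if "\<xi> \<in> {\<xi>\<in>{..<k} \<rightarrow>\<^sub>E freqs. (\<Sum>i<k. \<xi> i) = f} - T ` ?P" for \<xi>
      unfolding w_def using that A wt_dec by (intro prod_nonneg ballI mult_nonneg_nonneg) (auto simp: PiE_iff)
  qed
  finally show ?thesis by (simp add: rho_def w_def)
qed

text \<open>Negating a frequency negates its type and position. The amplitude is then conjugated,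
  for offset 0 because \<open>a\<close> is real and for offsets \<plusminus>1 by the choice in
  \<open>amp\<close>.\<close>

lemma blk_tpoly:
  assumes "a \<in> flat" "b \<in> flat" and a: "\<And>t. cnj (a t) = a t"
  shows "tpoly (blk A a b)"
  unfolding tpoly_def
proof (intro conjI allI)
  show "finite (supp (blk A a b))" using finite_subset[OF supp_blk finite_freqs] .
  show "0 \<notin> supp (blk A a b)"
  proof
    assume "0 \<in> supp (blk A a b)"
    then have "L * int M \<le> 0" using freqs_bounds(1)[of 0] supp_blk by auto
    then show False using L_pos M by (simp add: mult_le_0_iff)
  qed
  have "amp a b \<tau> \<in> flat" for \<tau>
    using assms flat_cnj[OF assms(2)] by (cases "snd \<tau> = 0"; cases "snd \<tau> = 1") (simp_all add: amp_def[abs_def])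
  then show "blk A a b \<xi> \<in> flat" for \<xi>
    using flat_zero by (cases "\<xi> \<in> freqs") (simp_all add: blk_def[abs_def] flat_scale)
  show "blk A a b (- \<xi>) t = cnj (blk A a b \<xi> t)" for \<xi> t
  proof (cases "\<xi> \<in> freqs")
    case True
    have ty: "fst (dec \<xi>) \<in> wave_types k" using dec(1)[OF True] by (auto simp: idx_def)
    have "amp a b (- fst (dec \<xi>)) t = cnj (amp a b (fst (dec \<xi>)) t)"
      using ty a by (auto simp: wave_types_def amp_def)
    then show ?thesis using True freqs_minus[OF True] by (simp add: blk_def dec_minus wt_def)
  next
    case False
    then have "- \<xi> \<notin> freqs" using freqs_minus[of "- \<xi>"] by auto
    then show ?thesis using False by (simp add: blk_def)
  qed
qed

lemma blk_bound:
  assumes "norm (a t) \<le> C" "norm (b t) \<le> C" "A \<ge> 0"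
  shows "norm (blk A a b \<xi> t) \<le> A * C"
proof (cases "\<xi> \<in> freqs")
  case True
  have "norm (amp a b (fst (dec \<xi>)) t) \<le> C" using assms by (simp add: amp_def)
  moreover have "\<bar>wt (snd (dec \<xi>))\<bar> \<le> 1" using wt_dec[OF True] by auto
  ultimately have "\<bar>A * wt (snd (dec \<xi>))\<bar> * norm (amp a b (fst (dec \<xi>)) t) \<le> (A * 1) * C"
    using assms by (intro mult_mono) (auto simp: abs_mult intro: mult_left_le)
  then show ?thesis using True by (simp add: blk_def norm_mult abs_mult)
next
  case False
  have "0 \<le> C" using assms norm_ge_zero order_trans by blast
  then show ?thesis using False assms by (simp add: blk_def)
qed

end

subsection \<open>Exponentials and the Fejer kernel\<close>

lemma expi_add: "expi (m + n) x = expi m x * expi n x"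
  by (simp add: expi_def algebra_simps exp_add[symmetric])

lemma expi_0 [simp]: "expi 0 x = 1"
  by (simp add: expi_def)

lemma norm_expi [simp]: "norm (expi m x) = 1"
  by (simp add: expi_def norm_exp_eq_Re)

lemma cnj_expi: "cnj (expi m x) = expi (- m) x"
  by (simp add: expi_def exp_cnj)

lemma expi_periodic: "expi m (x + 1) = expi m x"
proof -
  have "exp (2 * of_real pi * \<i> * of_int m) = (1::complex)"
    using exp_integer_2pi[of "of_int m"] by (simp add: mult_ac)
  then show ?thesis by (simp add: expi_def distrib_left exp_add)
qed

lemma expi_vector_derivative:
  "(expi m has_vector_derivative (2 * of_real pi * \<i> * of_int m) * expi m x) (at x within S)"
proof -
  have "((\<lambda>z. exp (2 * of_real pi * \<i> * of_int m * z)) has_field_derivative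
      (2 * of_real pi * \<i> * of_int m) * exp (2 * of_real pi * \<i> * of_int m * of_real x)) (at (of_real x))"
    by (auto intro!: derivative_eq_intros)
  then show ?thesis unfolding expi_def[abs_def]
    by (rule has_vector_derivative_real_field[THEN has_vector_derivative_at_within])
qed

lemma continuous_on_expi [continuous_intros]: "continuous_on S g \<Longrightarrow> continuous_on S (\<lambda>x. expi m (g x))"
  unfolding expi_def by (intro continuous_intros)

lemma LINT_eq_integral:
  fixes f :: "real \<Rightarrow> 'a::euclidean_space"
  assumes "continuous_on {0..1} f"
  shows "integrable (lebesgue_on {0..1}) f" "(LINT x|lebesgue_on {0..1}. f x) = integral {0..1} f"
proof -
  show "integrable (lebesgue_on {0..1}) f" by (rule continuous_imp_integrable_real[OF assms])
  then show "(LINT x|lebesgue_on {0..1}. f x) = integral {0..1} f"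
    by (rule lebesgue_integral_eq_integral) auto
qed

lemma LINT_expi: "(LINT x|lebesgue_on {0..1}. expi m x) = (if m = 0 then 1 else 0)"
proof (cases "m = 0")
  case True
  then show ?thesis by (simp add: measure_restrict_space)
next
  case False
  let ?w = "2 * of_real pi * \<i> * of_int m :: complex"
  have w: "?w \<noteq> 0" using False by simp
  have "((\<lambda>x. expi m x / ?w) has_vector_derivative expi m x) (at x within {0..1})" for x
    using has_vector_derivative_divide[OF expi_vector_derivative[of m x "{0..1}"], of ?w] w by simp
  then have "(expi m has_integral (expi m 1 / ?w - expi m 0 / ?w)) {0..1}"
    by (intro fundamental_theorem_of_calculus) auto
  moreover have "expi m 1 = expi m 0" using expi_periodic[of m 0] by simp
  ultimately have "integral {0..1} (expi m) = 0" by (simp add: integral_unique)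
  then show ?thesis using False LINT_eq_integral(2)[of "expi m"]
    by (simp add: continuous_on_expi continuous_on_id)
qed

text \<open>Passing from \<open>M\<close> to M + 1 raises every weight with |j| <= M by one (the
  weight at |j| = M was 0), so the left side grows by the Dirichlet sum. The right side grows by the
  cross terms with the new summand e(M) and by its squared modulus, which is 1.\<close>

lemma fejer_square:
  fixes e :: "int \<Rightarrow> complex"
  assumes add: "\<And>i j. e (i + j) = e i * e j" and one: "e 0 = 1" and neg: "\<And>i. e (- i) = cnj (e i)"
  shows "(\<Sum>j\<in>{- int M<..<int M}. of_int (int M - \<bar>j\<bar>) * e j) = (\<Sum>p<M. e (int p)) * cnj (\<Sum>p<M. e (int p))"
proof (induction M)
  case 0
  then show ?case by simp
next
  case (Suc M)
  let ?S = "\<Sum>p<M. e (int p)"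
  have I: "{- int (Suc M)<..<int (Suc M)} = {- int M..int M}" by auto
  have "(\<Sum>j\<in>{- int M..int M}. of_int (int (Suc M) - \<bar>j\<bar>) * e j)
      = (\<Sum>j\<in>{- int M..int M}. of_int (int M - \<bar>j\<bar>) * e j) + (\<Sum>j\<in>{- int M..int M}. e j)"
    by (simp add: sum.distrib[symmetric] algebra_simps)
  also have "(\<Sum>j\<in>{- int M..int M}. of_int (int M - \<bar>j\<bar>) * e j) = (\<Sum>j\<in>{- int M<..<int M}. of_int (int M - \<bar>j\<bar>) * e j)"
    by (rule sum.mono_neutral_right) (auto simp: abs_if)
  also have "\<dots> = ?S * cnj ?S" by (rule Suc.IH)
  also have "(\<Sum>j\<in>{- int M..int M}. e j) = e (int M) * cnj ?S + cnj (e (int M)) * ?S + 1"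
  proof -
    have "{- int M..int M} = ({0<..int M} \<union> {- int M..<0}) \<union> {0}" by auto
    moreover have "sum e ({0<..int M} \<union> {- int M..<0}) = sum e {0<..int M} + sum e {- int M..<0}"
      by (rule sum.union_disjoint) auto
    ultimately have "(\<Sum>j\<in>{- int M..int M}. e j) = ((\<Sum>j\<in>{0<..int M}. e j) + (\<Sum>j\<in>{- int M..<0}. e j)) + e 0"
      by simp
    also have "(\<Sum>j\<in>{0<..int M}. e j) = (\<Sum>p<M. e (int M - int p))"
      by (rule sum.reindex_bij_witness[of _ "\<lambda>p. int M - int p" "\<lambda>j. nat (int M - j)"]) auto
    also have "\<dots> = e (int M) * cnj ?S"
      using add[of "int M" "- int _"] by (simp add: sum_distrib_left neg)
    also have "(\<Sum>j\<in>{- int M..<0}. e j) = (\<Sum>p<M. e (- int M + int p))"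
      by (rule sum.reindex_bij_witness[of _ "\<lambda>p. - int M + int p" "\<lambda>j. nat (int M + j)"]) auto
    also have "\<dots> = cnj (e (int M)) * ?S"
      by (simp only: add neg sum_distrib_left)
    finally show ?thesis by (simp add: one)
  qed
  finally have "(\<Sum>j\<in>{- int (Suc M)<..<int (Suc M)}. of_int (int (Suc M) - \<bar>j\<bar>) * e j)
     = ?S * cnj ?S + (e (int M) * cnj ?S + cnj (e (int M)) * ?S + 1)" unfolding I .
  moreover have "e (int M) * cnj (e (int M)) = 1"
    using add[of "int M" "- int M"] by (simp add: neg one)
  ultimately show ?case by (simp add: algebra_simps)
qed

subsection \<open>Values of trigonometric polynomials\<close>

text \<open>For coefficients with the symmetry in \<open>tpoly\<close> the sum is already real by
  \<open>of_real_val\<close>; \<open>Re\<close> only adjusts the type.\<close>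

definition val :: "(int \<Rightarrow> real \<Rightarrow> complex) \<Rightarrow> real \<Rightarrow> real \<Rightarrow> real" where
  "val c t x = Re (\<Sum>\<xi>\<in>supp c. c \<xi> t * expi \<xi> x)"

lemma of_real_val:
  assumes c: "tpoly c" and "finite X" "supp c \<subseteq> X"
  shows "complex_of_real (val c t x) = (\<Sum>\<xi>\<in>X. c \<xi> t * expi \<xi> x)"
proof -
  have sup: "- \<xi> \<in> supp c \<longleftrightarrow> \<xi> \<in> supp c" for \<xi>
    using tpolyD(4)[OF c] by (auto simp: supp_def)
  have "cnj (\<Sum>\<xi>\<in>supp c. c \<xi> t * expi \<xi> x) = (\<Sum>\<xi>\<in>supp c. c (- \<xi>) t * expi (- \<xi>) x)"
    by (simp add: cnj_expi tpolyD(4)[OF c])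
  also have "\<dots> = (\<Sum>\<xi>\<in>supp c. c \<xi> t * expi \<xi> x)"
    by (rule sum.reindex_bij_witness[of _ uminus uminus]) (auto simp: sup)
  finally have "(\<Sum>\<xi>\<in>supp c. c \<xi> t * expi \<xi> x) \<in> \<real>" by (simp add: Reals_cnj_iff)
  then have "complex_of_real (val c t x) = (\<Sum>\<xi>\<in>supp c. c \<xi> t * expi \<xi> x)"
    by (simp only: val_def of_real_Re)
  also have "\<dots> = (\<Sum>\<xi>\<in>X. c \<xi> t * expi \<xi> x)"
    by (rule sum.mono_neutral_left) (use assms in \<open>auto simp: not_supp\<close>)
  finally show ?thesis .
qed

lemma val_continuous: "continuous_on S (val c t)"
  unfolding val_def[abs_def] by (intro continuous_intros)

context block
begin

text \<open>The Fejer kernel of order \<open>M\<close> in the variable L x, normalised to mean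
  1.\<close>

definition fej :: "real \<Rightarrow> real" where
  "fej x = (norm (\<Sum>p<M. expi (L * int p) x))\<^sup>2 / real M"

lemma fej_bounds: "0 \<le> fej x" "fej x \<le> real M"
proof -
  have "norm (\<Sum>p<M. expi (L * int p) x) \<le> real M"
    by (rule order_trans[OF norm_sum]) simp
  then have "(norm (\<Sum>p<M. expi (L * int p) x))\<^sup>2 \<le> (real M)\<^sup>2" by (intro power_mono) auto
  then show "fej x \<le> real M" using M by (simp add: fej_def field_simps power2_eq_square)
qed (simp add: fej_def)

lemma fej_continuous: "continuous_on S fej"
  unfolding fej_def[abs_def] using M by (intro continuous_intros) auto

lemma fej_expand: "complex_of_real (fej x) = (\<Sum>j\<in>{- int M<..<int M}. of_real (wt j) * expi (L * j) x)"
proof -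
  have "(\<Sum>j\<in>{- int M<..<int M}. of_real (wt j) * expi (L * j) x)
    = (\<Sum>j\<in>{- int M<..<int M}. of_int (int M - \<bar>j\<bar>) * expi (L * j) x) / of_nat M"
    unfolding sum_divide_distrib by (intro sum.cong refl) (simp add: wt_def of_int_abs[symmetric] del: of_int_abs)
  also have "\<dots> = (\<Sum>p<M. expi (L * int p) x) * cnj (\<Sum>p<M. expi (L * int p) x) / of_nat M"
    by (subst fejer_square) (auto simp: distrib_left expi_add cnj_expi)
  also have "\<dots> = complex_of_real (fej x)"
    by (simp only: complex_norm_square[symmetric] fej_def) simp
  finally show ?thesis by simp
qed

lemma LINT_fej: "(LINT x|lebesgue_on {0..1}. fej x) = 1"
proof -
  have "complex_of_real (LINT x|lebesgue_on {0..1}. fej x) = (LINT x|lebesgue_on {0..1}. complex_of_real (fej x))"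
    by simp
  also have "\<dots> = (\<Sum>j\<in>{- int M<..<int M}. of_real (wt j) * (LINT x|lebesgue_on {0..1}. expi (L * j) x))"
    unfolding fej_expand
    by (subst Bochner_Integration.integral_sum) (auto intro!: LINT_eq_integral continuous_intros)
  also have "\<dots> = (\<Sum>j\<in>{- int M<..<int M}. if j = 0 then 1 else 0)"
    using L_pos M by (intro sum.cong) (auto simp: LINT_expi wt_def)
  also have "\<dots> = 1" using M by simp
  finally show ?thesis by (simp only: of_real_eq_1_iff)
qed

text \<open>The frequencies of one wave type are a fixed carrier plus the multiples
  \<open>L * j\<close>, and the weights \<open>wt j\<close> sum them to a modulated Fejer kernel.
  There are at most four types.\<close>

lemma val_blk_le:
  assumes "tpoly (blk A a b)" "norm (a t) \<le> C" "norm (b t) \<le> C" "A \<ge> 0"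
  shows "\<bar>val (blk A a b) t x\<bar> \<le> 4 * A * C * fej x"
proof -
  have C: "0 \<le> C" using assms norm_ge_zero order_trans by blast
  have "complex_of_real (val (blk A a b) t x) = (\<Sum>\<xi>\<in>freqs. blk A a b \<xi> t * expi \<xi> x)"
    by (rule of_real_val[OF assms(1) finite_freqs supp_blk])
  also have "\<dots> = (\<Sum>p\<in>idx. blk A a b (enc p) t * expi (enc p) x)"
    unfolding freqs_def by (simp add: sum.reindex[OF inj_enc])
  also have "\<dots> = (\<Sum>p\<in>idx. (A * amp a b (fst p) t * expi (L * (int k * int M * fst (fst p)) + snd (fst p) * f) x)
       * (of_real (wt (snd p)) * expi (L * snd p) x))"
  proof (intro sum.cong refl)
    fix p assume p: "p \<in> idx"
    have "enc p = (L * (int k * int M * fst (fst p)) + snd (fst p) * f) + L * snd p"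
      by (simp add: enc_def algebra_simps)
    then have "expi (enc p) x = expi (L * (int k * int M * fst (fst p)) + snd (fst p) * f) x * expi (L * snd p) x"
      by (simp only: expi_add)
    then show "blk A a b (enc p) t * expi (enc p) x = (A * amp a b (fst p) t * expi (L * (int k * int M * fst (fst p)) + snd (fst p) * f) x)
       * (of_real (wt (snd p)) * expi (L * snd p) x)"
      using p by (simp add: blk_def freqs_def dec_enc)
  qed
  also have "\<dots> = (\<Sum>\<tau>\<in>wave_types k. (A * amp a b \<tau> t * expi (L * (int k * int M * fst \<tau>) + snd \<tau> * f) x) * fej x)"
    unfolding idx_def fej_expand sum_distrib_left
    by (subst sum.cartesian_product) (simp add: case_prod_unfold)
  finally have "\<bar>val (blk A a b) t x\<bar> = norm (\<Sum>\<tau>\<in>wave_types k. (A * amp a b \<tau> t * expi (L * (int k * int M * fst \<tau>) + snd \<tau> * f) x) * fej x)"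
    by (metis norm_of_real)
  also have "\<dots> \<le> (\<Sum>\<tau>\<in>wave_types k. A * C * fej x)"
  proof (rule order_trans[OF norm_sum sum_mono])
    fix \<tau> assume "\<tau> \<in> wave_types k"
    have "norm (amp a b \<tau> t) \<le> C" using assms by (simp add: amp_def)
    then show "norm ((A * amp a b \<tau> t * expi (L * (int k * int M * fst \<tau>) + snd \<tau> * f) x) * fej x) \<le> A * C * fej x"
      using assms fej_bounds by (auto simp: norm_mult intro!: mult_right_mono mult_left_mono)
  qed
  also have "\<dots> \<le> 4 * (A * C * fej x)"
    using assms fej_bounds C
    by (auto simp: wave_types_def card_insert_if intro!: mult_right_mono)
  finally show ?thesis by (simp add: mult_ac)
qed

text \<open>Interpolation between the maximum \<open>M\<close> and the mean 1 of the kernel: fej^q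
  <= M^(q-1) fej.\<close>

lemma Lq_blk:
  assumes "tpoly (blk A a b)" "norm (a t) \<le> C" "norm (b t) \<le> C" "A \<ge> 0" "q \<ge> 1"
  shows "(LINT x|lebesgue_on {0..1}. \<bar>val (blk A a b) t x\<bar> powr q) \<le> (4 * A * C) powr q * real M powr (q - 1)"
proof -
  have C: "0 \<le> C" using assms norm_ge_zero order_trans by blast
  have pw: "\<bar>val (blk A a b) t x\<bar> powr q \<le> (4 * A * C) powr q * real M powr (q - 1) * fej x" for x
  proof -
    have "\<bar>val (blk A a b) t x\<bar> powr q \<le> (4 * A * C * fej x) powr q"
      using val_blk_le[OF assms(1-4)] assms by (intro powr_mono2) auto
    also have "\<dots> = (4 * A * C) powr q * fej x powr q"
      using assms C fej_bounds by (simp add: powr_mult)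
    also have "\<dots> \<le> (4 * A * C) powr q * (real M powr (q - 1) * fej x)"
    proof (rule mult_left_mono)
      have "fej x powr q = fej x powr (q - 1) * fej x"
        using fej_bounds(1)[of x] powr_add[of "fej x" "q - 1" 1] by simp
      also have "\<dots> \<le> real M powr (q - 1) * fej x"
        using fej_bounds assms by (intro mult_right_mono powr_mono2) auto
      finally show "fej x powr q \<le> real M powr (q - 1) * fej x" .
    qed simp
    finally show ?thesis by (simp add: mult_ac)
  qed
  have "(LINT x|lebesgue_on {0..1}. \<bar>val (blk A a b) t x\<bar> powr q)
     \<le> (LINT x|lebesgue_on {0..1}. (4 * A * C) powr q * real M powr (q - 1) * fej x)"
  proof (rule integral_mono)
    show "integrable (lebesgue_on {0..1}) (\<lambda>x. \<bar>val (blk A a b) t x\<bar> powr q)"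
      using assms by (intro LINT_eq_integral continuous_on_powr' val_continuous continuous_intros) auto
    show "integrable (lebesgue_on {0..1}) (\<lambda>x. (4 * A * C) powr q * real M powr (q - 1) * fej x)"
      by (intro LINT_eq_integral continuous_intros fej_continuous)
  qed (rule pw)
  also have "\<dots> = (4 * A * C) powr q * real M powr (q - 1)" by (simp add: LINT_fej)
  finally show ?thesis .
qed

end

subsection \<open>Removing one mode of the residual\<close>

lemma sum_tuples_uminus:
  fixes X :: "int set" and h :: "(nat \<Rightarrow> int) \<Rightarrow> 'b::comm_monoid_add"
  assumes "\<And>\<xi>. \<xi> \<in> X \<Longrightarrow> - \<xi> \<in> X"
  shows "(\<Sum>\<xi>\<in>{\<xi>\<in>{..<k::nat} \<rightarrow>\<^sub>E X. (\<Sum>i<k. \<xi> i) = - g}. h \<xi>)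
    = (\<Sum>\<xi>\<in>{\<xi>\<in>{..<k} \<rightarrow>\<^sub>E X. (\<Sum>i<k. \<xi> i) = g}. h (\<lambda>i\<in>{..<k}. - \<xi> i))"
  by (rule sum.reindex_bij_witness[of _ "\<lambda>\<xi>. \<lambda>i\<in>{..<k}. - \<xi> i" "\<lambda>\<xi>. \<lambda>i\<in>{..<k}. - \<xi> i"])
    (auto simp: assms PiE_iff extensional_def restrict_def sum_negf fun_eq_iff intro!: arg_cong[where f = h])

lemma sum_UN_le:
  fixes g :: "'a \<Rightarrow> real"
  assumes "finite P" "\<And>p. p \<in> P \<Longrightarrow> finite (B p)" "\<And>p x. p \<in> P \<Longrightarrow> x \<in> B p \<Longrightarrow> 0 \<le> g x"
  shows "sum g (\<Union>p\<in>P. B p) \<le> (\<Sum>p\<in>P. sum g (B p))"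
  using assms
proof (induction rule: finite_induct)
  case (insert p P)
  have "sum g (B p \<union> (\<Union>p\<in>P. B p)) + sum g (B p \<inter> (\<Union>p\<in>P. B p)) = sum g (B p) + sum g (\<Union>p\<in>P. B p)"
    using insert by (intro sum.union_inter) auto
  moreover have "0 \<le> sum g (B p \<inter> (\<Union>p\<in>P. B p))" using insert by (intro sum_nonneg) auto
  moreover have "sum g (\<Union>p\<in>P. B p) \<le> (\<Sum>p\<in>P. sum g (B p))" using insert by auto
  ultimately show ?case using insert by simp
qed simp

lemma powr_int_le:
  fixes g :: int and s :: real
  assumes "g \<noteq> 0" "s \<ge> s'"
  shows "\<bar>of_int g\<bar> powr (-s) \<le> \<bar>real_of_int g\<bar> powr (-s')"
  using assms by (intro powr_mono) auto

section \<open>Size of the interactions of one packet\<close>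

context block
begin

text \<open>With m = M div (2 k) one has 2 m + 1 >= M/(2 k), and the normalisation of
  \<open>A\<close> cancels all powers of \<open>M\<close>. As the bound does not depend on
  \<open>M\<close>, a profile divided by \<open>rho A\<close> stays bounded while \<open>M\<close>
  grows.\<close>

lemma rho_ge_const:
  assumes A: "A > 0" "A ^ k * real M ^ (k - 1) = 1"
  shows "rho A \<ge> 1 / ((2 * real k) ^ (k - 1) * 2 ^ k)"
proof -
  define m where "m = M div (2 * k)"
  have m: "2 * k * m \<le> M" by (simp add: m_def)
  have "M < 2 * k + 2 * k * m"
    using k dividend_less_times_div[of "2 * k" M] by (simp add: m_def)
  also have "\<dots> \<le> 2 * k * (2 * m + 1)" by (simp add: algebra_simps)
  finally have "real M \<le> real (2 * k * (2 * m + 1))" by (simp only: of_nat_le_iff less_imp_le)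
  then have "real M \<le> 2 * real k * (2 * real m + 1)" by (simp add: algebra_simps)
  then have "real M / (2 * real k) \<le> 2 * real m + 1" using k by (simp add: field_simps)
  then have "(real M / (2 * real k)) ^ (k - 1) \<le> (2 * real m + 1) ^ (k - 1)" by (intro power_mono) auto
  then have "(real M / (2 * real k)) ^ (k - 1) * (A / 2) ^ k \<le> (2 * real m + 1) ^ (k - 1) * (A / 2) ^ k"
    using A by (intro mult_right_mono) auto
  also have "\<dots> \<le> rho A" using rho_ge[OF _ m, of A] A by simp
  also have "(real M / (2 * real k)) ^ (k - 1) * (A / 2) ^ k = (A ^ k * real M ^ (k - 1)) / ((2 * real k) ^ (k - 1) * 2 ^ k)"
    by (simp add: power_divide)
  finally show ?thesis using A by simp
qed

lemma sum_freqs_le: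
  assumes "\<And>\<xi>. \<xi> \<in> freqs \<Longrightarrow> m \<xi> \<le> K" "K \<ge> 0"
  shows "sum m freqs \<le> 8 * real M * K"
proof -
  have "sum m freqs \<le> (\<Sum>\<xi>\<in>freqs. K)" by (intro sum_mono assms)
  also have "\<dots> = real (card freqs) * K" by simp
  also have "\<dots> \<le> real (8 * M) * K" using card_freqs assms by (intro mult_right_mono) (simp_all only: of_nat_le_iff)
  finally show ?thesis by simp
qed

lemma M_le: "\<xi> \<in> freqs \<Longrightarrow> int M \<le> \<bar>\<xi>\<bar>"
  using freqs_bounds(1)[of \<xi>] L_pos mult_right_mono[of 1 L "int M"] by linarith

text \<open>Sums other than 0 and \<plusminus>f are at least L/2 in modulus, so one of three powers
  of decay is worth 2/L and the other two are summable with total \<open>H\<close>. In Young's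
  inequality one slot contributes A C and each of the k - 1 others 8 M A C. The normalisation
  cancels the powers of \<open>M\<close>, so smallness can come from \<open>L\<close> only.\<close>

lemma pure_bound:
  assumes H: "\<And>F::int set. finite F \<Longrightarrow> (\<Sum>g\<in>F. if g = 0 then 0 else \<bar>of_int g\<bar> powr (-2)) \<le> H"
    and m: "\<And>\<xi>. 0 \<le> m \<xi>" "\<And>\<xi>. \<xi> \<in> freqs \<Longrightarrow> m \<xi> \<le> A * C" and A: "A > 0" "A ^ k * real M ^ (k - 1) = 1"
    and C: "C \<ge> 0" and s: "s \<ge> 3"
  shows "(\<Sum>\<xi>\<in>{\<xi>\<in>{..<k} \<rightarrow>\<^sub>E freqs. (\<Sum>i<k. \<xi> i) \<noteq> 0 \<and> \<bar>\<Sum>i<k. \<xi> i\<bar> \<noteq> f}.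
        (\<Prod>i<k. m (\<xi> i)) * \<bar>of_int (\<Sum>i<k. \<xi> i)\<bar> powr (-s)) \<le> 8 ^ (k - 1) * C ^ k * H * (2 / of_int L)"
proof -
  let ?h = "\<lambda>g::int. (if g = 0 then 0 else \<bar>real_of_int g\<bar> powr (-2)) * (2 / of_int L)"
  have h0: "0 \<le> ?h y" for y using L_pos by simp
  have "(\<Sum>\<xi>\<in>{\<xi>\<in>{..<k} \<rightarrow>\<^sub>E freqs. (\<Sum>i<k. \<xi> i) \<noteq> 0 \<and> \<bar>\<Sum>i<k. \<xi> i\<bar> \<noteq> f}.
        (\<Prod>i<k. m (\<xi> i)) * \<bar>of_int (\<Sum>i<k. \<xi> i)\<bar> powr (-s))
     \<le> (\<Sum>\<xi>\<in>{\<xi>\<in>{..<k} \<rightarrow>\<^sub>E freqs. (\<Sum>i<k. \<xi> i) \<noteq> 0 \<and> \<bar>\<Sum>i<k. \<xi> i\<bar> \<noteq> f}. (\<Prod>i<k. m (\<xi> i)) * ?h (\<Sum>i<k. \<xi> i))"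
  proof (intro sum_mono mult_left_mono prod_nonneg ballI m(1))
    fix \<xi> assume "\<xi> \<in> {\<xi>\<in>{..<k} \<rightarrow>\<^sub>E freqs. (\<Sum>i<k. \<xi> i) \<noteq> 0 \<and> \<bar>\<Sum>i<k. \<xi> i\<bar> \<noteq> f}"
    then have \<xi>: "\<xi> \<in> {..<k} \<rightarrow>\<^sub>E freqs" "(\<Sum>i<k. \<xi> i) \<noteq> 0" "\<bar>\<Sum>i<k. \<xi> i\<bar> \<noteq> f" by auto
    define g where "g = (\<Sum>i<k. \<xi> i)"
    have g: "g \<noteq> 0" "2 * \<bar>g\<bar> \<ge> L" using resonance[OF \<xi>(1,2)] \<xi> f unfolding g_def by auto
    have "\<bar>real_of_int g\<bar> powr (-s) \<le> \<bar>real_of_int g\<bar> powr (-3)" by (rule powr_int_le) (use g s in auto)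
    also have "\<dots> = \<bar>real_of_int g\<bar> powr (-2) * \<bar>real_of_int g\<bar> powr (-1)"
      by (subst powr_add[symmetric]) simp
    also have "\<dots> \<le> \<bar>real_of_int g\<bar> powr (-2) * (2 / of_int L)"
    proof (rule mult_left_mono)
      have "real_of_int L \<le> real_of_int (2 * \<bar>g\<bar>)" using g by (simp only: of_int_le_iff)
      then show "\<bar>real_of_int g\<bar> powr (-1) \<le> 2 / of_int L"
        using L_pos g by (simp add: powr_minus field_simps)
    qed simp
    finally show "\<bar>real_of_int (\<Sum>i<k. \<xi> i)\<bar> powr (-s) \<le> ?h (\<Sum>i<k. \<xi> i)" using g unfolding g_def by simp
  qed
  also have "\<dots> \<le> (\<Sum>\<xi>\<in>{..<k} \<rightarrow>\<^sub>E freqs. (\<Prod>i<k. m (\<xi> i)) * ?h (\<Sum>i<k. \<xi> i))"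
  proof (rule sum_mono2)
    show "finite ({..<k} \<rightarrow>\<^sub>E freqs)" by (rule finite_tuples[OF finite_freqs])
    show "{\<xi>\<in>{..<k} \<rightarrow>\<^sub>E freqs. (\<Sum>i<k. \<xi> i) \<noteq> 0 \<and> \<bar>\<Sum>i<k. \<xi> i\<bar> \<noteq> f} \<subseteq> {..<k} \<rightarrow>\<^sub>E freqs"
      by (rule Collect_restrict)
    show "0 \<le> (\<Prod>i<k. m (\<xi> i)) * ?h (\<Sum>i<k. \<xi> i)" for \<xi>
      by (intro mult_nonneg_nonneg prod_nonneg ballI m(1) h0)
  qed
  also have "\<dots> \<le> (A * C) * (H * (2 / of_int L)) * (\<Prod>j\<in>{..<k} - {0}. 8 * real M * (A * C))"
  proof (rule young_tuples[where i = 0 and S = "\<lambda>_. freqs" and m = m])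
    show "sum ?h F \<le> H * (2 / of_int L)" if "finite F" for F
      unfolding sum_distrib_right[symmetric] using H[OF that] L_pos by (intro mult_right_mono) auto
    show "0 \<le> ?h y" for y by (rule h0)
    show "sum m freqs \<le> 8 * real M * (A * C)" using m(2) A C by (intro sum_freqs_le) auto
  qed (use k finite_freqs m A C in auto)
  also have "\<dots> = (A ^ k * real M ^ (k - 1)) * (8 ^ (k - 1) * C ^ k * H * (2 / of_int L))"
    using k by (simp add: power_mult_distrib) (cases k; simp)
  finally show ?thesis using A by simp
qed

text \<open>Single out a slot in \<open>freqs\<close>, measured by its maximum A C, and a slot in
  \<open>X\<close>, measured by its l^1 norm \<open>CX\<close>; because A M >= 1, each remaining
  slot has l^1 norm at most (CX + 8 C) A M. By the normalisation, A (A M)^(k-2) equals 1/(A M), a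
  negative power of \<open>M\<close> for the amplitude chosen later. The factor k^2 bounds the
  number of choices of the two slots.\<close>

lemma mixed_bound:
  assumes H: "\<And>F::int set. finite F \<Longrightarrow> (\<Sum>g\<in>F. if g = 0 then 0 else \<bar>of_int g\<bar> powr (-2)) \<le> H"
    and m: "\<And>\<xi>. 0 \<le> m \<xi>" "\<And>\<xi>. \<xi> \<in> freqs \<Longrightarrow> m \<xi> \<le> A * C" and A: "A > 0" "A ^ k * real M ^ (k - 1) = 1" "A * real M \<ge> 1"
    and C: "C \<ge> 0" and s: "s \<ge> 3" and X: "finite X" "X \<inter> freqs = {}" "sum m X \<le> CX"
  shows "(\<Sum>\<xi>\<in>{\<xi>\<in>mixed k X freqs. (\<Sum>i<k. \<xi> i) \<noteq> 0}. (\<Prod>i<k. m (\<xi> i)) * \<bar>of_int (\<Sum>i<k. \<xi> i)\<bar> powr (-s))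
    \<le> real k ^ 2 * C * H * CX * (CX + 8 * C) ^ (k - 2) / (A * real M)"
proof -
  have H0: "0 \<le> H" using H[of "{}"] by simp
  have CX0: "0 \<le> CX" using order_trans[OF sum_nonneg[of X m] X(3)] m by auto
  let ?h = "\<lambda>g::int. if g = 0 then 0 else \<bar>real_of_int g\<bar> powr (-2)"
  let ?g = "\<lambda>\<xi>. (\<Prod>i<k. m (\<xi> i)) * ?h (\<Sum>i<k. \<xi> i)"
  let ?S = "\<lambda>p j. if j = fst p then freqs else if j = snd p then X else X \<union> freqs"
  let ?P = "{p\<in>{..<k} \<times> {..<k}. fst p \<noteq> snd p}"
  let ?Y = "(CX + 8 * C) * (A * real M)"
  have finS: "finite (?S p j)" for p j using X finite_freqs by auto
  have finB: "finite (PiE {..<k} (?S p))" for p by (intro finite_PiE finS) auto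
  have g0: "0 \<le> ?g \<xi>" for \<xi> by (intro mult_nonneg_nonneg prod_nonneg) (auto simp: m)
  have finP: "finite ?P" by (rule finite_subset[of _ "{..<k} \<times> {..<k}"]) auto
  have sub: "mixed k X freqs \<subseteq> (\<Union>p\<in>?P. PiE {..<k} (?S p))"
  proof
    fix \<xi> assume "\<xi> \<in> mixed k X freqs"
    then obtain i j where "i < k" "\<xi> i \<in> freqs" "j < k" "\<xi> j \<in> X" "\<xi> \<in> {..<k} \<rightarrow>\<^sub>E (X \<union> freqs)"
      by (auto simp: mixed_def)
    then have "(i, j) \<in> ?P" "\<xi> \<in> PiE {..<k} (?S (i, j))" using X(2) by (auto simp: PiE_iff)
    then show "\<xi> \<in> (\<Union>p\<in>?P. PiE {..<k} (?S p))" by blast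
  qed
  have one: "sum ?g (PiE {..<k} (?S p)) \<le> (A * C) * H * (CX * ?Y ^ (k - 2))" if p: "p \<in> ?P" for p
  proof -
    let ?W = "\<lambda>j. if j = snd p then CX else ?Y"
    have "sum ?g (PiE {..<k} (?S p)) \<le> (A * C) * H * (\<Prod>j\<in>{..<k} - {fst p}. ?W j)"
    proof (rule young_tuples[where i = "fst p" and m = m and h = ?h])
      show "sum m (?S p j) \<le> ?W j" if "j \<in> {..<k} - {fst p}" for j
      proof (cases "j = snd p")
        case True
        then show ?thesis using that X by auto
      next
        case False
        have "sum m (X \<union> freqs) = sum m X + sum m freqs" using X finite_freqs by (intro sum.union_disjoint) auto
        also have "\<dots> \<le> CX + 8 * real M * (A * C)" using m A C X by (intro add_mono sum_freqs_le) auto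
        also have "\<dots> \<le> CX * (A * real M) + 8 * real M * (A * C)" using CX0 A by (simp add: mult_le_cancel_left1)
        also have "\<dots> = ?Y" by (simp add: algebra_simps)
        finally show ?thesis using False that by simp
      qed
      show "sum ?h F \<le> H" if "finite F" for F using H[OF that] .
      show "m y \<le> A * C" if "y \<in> ?S p (fst p)" for y using that m(2) by simp
      show "fst p \<in> {..<k}" using p by auto
      show "0 \<le> A * C" using A C by simp
    qed (use X(1) finite_freqs m in auto)
    also have "(\<Prod>j\<in>{..<k} - {fst p}. ?W j) = CX * (\<Prod>j\<in>{..<k} - {fst p} - {snd p}. ?W j)"
      using p by (subst prod.remove[of _ "snd p"]) auto
    also have "(\<Prod>j\<in>{..<k} - {fst p} - {snd p}. ?W j) = (\<Prod>j\<in>{..<k} - {fst p} - {snd p}. ?Y)"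
      by (intro prod.cong) auto
    also have "\<dots> = ?Y ^ (k - 2)"
    proof -
      have "fst p \<in> {..<k}" "snd p \<in> {..<k} - {fst p}" using p by auto
      then have "card ({..<k} - {fst p} - {snd p}) = k - 2" by (simp only: card_Diff_singleton card_lessThan)
      then show ?thesis by (simp only: prod_constant)
    qed
    finally show ?thesis .
  qed
  have "(\<Sum>\<xi>\<in>{\<xi>\<in>mixed k X freqs. (\<Sum>i<k. \<xi> i) \<noteq> 0}. (\<Prod>i<k. m (\<xi> i)) * \<bar>of_int (\<Sum>i<k. \<xi> i)\<bar> powr (-s))
     \<le> sum ?g {\<xi>\<in>mixed k X freqs. (\<Sum>i<k. \<xi> i) \<noteq> 0}"
    using s by (intro sum_mono mult_left_mono prod_nonneg ballI m(1)) (auto simp del: of_int_sum intro!: powr_int_le)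
  also have "\<dots> \<le> sum ?g (\<Union>p\<in>?P. PiE {..<k} (?S p))"
  proof (rule sum_mono2)
    show "finite (\<Union>p\<in>?P. PiE {..<k} (?S p))" using finP finB by blast
    show "{\<xi>\<in>mixed k X freqs. (\<Sum>i<k. \<xi> i) \<noteq> 0} \<subseteq> (\<Union>p\<in>?P. PiE {..<k} (?S p))" using sub by blast
  qed (rule g0)
  also have "\<dots> \<le> (\<Sum>p\<in>?P. sum ?g (PiE {..<k} (?S p)))" by (intro sum_UN_le finP finB g0)
  also have "\<dots> \<le> (\<Sum>p\<in>?P. (A * C) * H * (CX * ?Y ^ (k - 2)))" by (intro sum_mono one)
  also have "\<dots> = real (card ?P) * ((A * C) * H * (CX * ?Y ^ (k - 2)))" by simp
  also have "\<dots> \<le> real (k ^ 2) * ((A * C) * H * (CX * ?Y ^ (k - 2)))"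
  proof (rule mult_right_mono)
    have "card ?P \<le> card ({..<k} \<times> {..<k})" by (rule card_mono) auto
    then show "real (card ?P) \<le> real (k ^ 2)" by (simp only: of_nat_le_iff) (simp add: power2_eq_square)
    show "0 \<le> (A * C) * H * (CX * ?Y ^ (k - 2))" using A C H0 CX0 by (intro mult_nonneg_nonneg zero_le_power) auto
  qed
  also have "\<dots> = real k ^ 2 * C * H * CX * (CX + 8 * C) ^ (k - 2) * (A * (A * real M) ^ (k - 2))"
    by (simp add: power_mult_distrib)
  also have "A * (A * real M) ^ (k - 2) = (A ^ k * real M ^ (k - 1)) / (A * real M)"
  proof -
    obtain j where j: "k = Suc (Suc j)" using k by (metis add_2_eq_Suc le_Suc_ex)
    show ?thesis using A(1) M unfolding j by (simp add: power_mult_distrib field_simps)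
  qed
  finally show ?thesis using A by simp
qed

lemma blk_derivative:
  assumes "a \<in> flat" "b \<in> flat"
  shows "vector_derivative (blk A a b \<xi>) (at t)
    = blk A (\<lambda>t. vector_derivative a (at t)) (\<lambda>t. vector_derivative b (at t)) \<xi> t"
proof (cases "\<xi> \<in> freqs")
  case True
  have "(amp a b \<tau> has_vector_derivative amp (\<lambda>t. vector_derivative a (at t)) (\<lambda>t. vector_derivative b (at t)) \<tau> t) (at t)" for \<tau>
    using assms[THEN flat_has_vector_derivative, of t] vector_derivative_cnj[OF assms(2)[THEN flat_has_vector_derivative, of t]]
    by (cases "snd \<tau> = 0"; cases "snd \<tau> = 1") (simp_all add: amp_def[abs_def])
  from has_vector_derivative_mult_right[OF this[of "fst (dec \<xi>)"], of "of_real (A * wt (snd (dec \<xi>)))"]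
  have "(blk A a b \<xi> has_vector_derivative
      blk A (\<lambda>t. vector_derivative a (at t)) (\<lambda>t. vector_derivative b (at t)) \<xi> t) (at t)"
    using True by (simp add: blk_def[abs_def])
  then show ?thesis by (rule vector_derivative_at)
next
  case False
  then show ?thesis by (simp add: blk_def[abs_def])
qed

text \<open>The third derivative after one antiderivative costs xi^2, so the weight with s >= 3
  leaves 1/|xi| <= 1/M per frequency, and at most 8 M frequencies give a multiple of
  \<open>A\<close>. The constant is 8 times 80, where 80 bounds 8 pi^2, the coefficient in 2 (2 pi
  |xi|)^2.\<close>

lemma airy_bound:
  assumes ab: "a \<in> flat" "b \<in> flat" and A: "A \<ge> 0"
    and C: "\<And>t. t \<in> {0..1} \<Longrightarrow> norm (a t) \<le> C" "\<And>t. t \<in> {0..1} \<Longrightarrow> norm (b t) \<le> C"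
      "\<And>t. t \<in> {0..1} \<Longrightarrow> norm (vector_derivative a (at t)) \<le> C" "\<And>t. t \<in> {0..1} \<Longrightarrow> norm (vector_derivative b (at t)) \<le> C"
    and s: "s \<ge> 3" and \<sigma>: "\<bar>\<sigma>\<bar> \<le> 1" and F: "finite F"
  shows "(\<Sum>\<xi>\<in>F. supn (airy \<sigma> (blk A a b) \<xi>) * \<bar>of_int \<xi>\<bar> powr (-s)) \<le> 640 * C * A"
proof -
  have C0: "0 \<le> C" using order_trans[OF norm_ge_zero C(1)[of 0]] by simp
  have 1: "supn (airy \<sigma> (blk A a b) \<xi>) * \<bar>of_int \<xi>\<bar> powr (-s) \<le> 80 * (A * C) / real M" if \<xi>: "\<xi> \<in> freqs" for \<xi>
  proof -
    have Mle: "int M \<le> \<bar>\<xi>\<bar>" using M_le[OF \<xi>] .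
    have x1: "1 \<le> \<bar>real_of_int \<xi>\<bar>" and xM: "real M \<le> \<bar>real_of_int \<xi>\<bar>"
      using Mle M by linarith+
    define y where "y = 2 * pi * \<bar>real_of_int \<xi>\<bar>"
    have y1: "y \<ge> 1" using x1 pi_gt3 mult_mono[of 1 "2 * pi" 1 "\<bar>real_of_int \<xi>\<bar>"] by (simp add: y_def)
    have "supn (airy \<sigma> (blk A a b) \<xi>) \<le> (A * C + y ^ 3 * (A * C)) / y"
    proof (rule supn_le)
      fix t :: real assume t: "t \<in> {0..1}"
      let ?D = "vector_derivative (blk A a b \<xi>) (at t)"
      let ?z = "2 * of_real pi * \<i> * of_int \<xi> :: complex"
      have z: "norm ?z = y" by (simp add: y_def norm_mult)
      have "norm (?D + ?z ^ 3 * blk A a b \<xi> t) \<le> norm ?D + y ^ 3 * norm (blk A a b \<xi> t)"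
        by (rule order_trans[OF norm_triangle_ineq])
          (simp only: norm_mult[of "?z ^ 3"] norm_power[of ?z] z order_refl)
      also have "\<dots> \<le> A * C + y ^ 3 * (A * C)"
        unfolding blk_derivative[OF ab]
        using y1 A by (intro add_mono mult_left_mono blk_bound C t) auto
      finally have "\<bar>\<sigma>\<bar> * norm (?D + ?z ^ 3 * blk A a b \<xi> t) \<le> 1 * (A * C + y ^ 3 * (A * C))"
        using \<sigma> by (intro mult_mono) auto
      then have "\<bar>\<sigma>\<bar> * norm (?D + ?z ^ 3 * blk A a b \<xi> t) / y \<le> (A * C + y ^ 3 * (A * C)) / y"
        using y1 by (intro divide_right_mono) auto
      then show "norm (airy \<sigma> (blk A a b) \<xi> t) \<le> (A * C + y ^ 3 * (A * C)) / y"
        unfolding airy_def norm_divide z norm_mult[of "of_real \<sigma>"] norm_of_real .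
    qed
    also have "\<dots> = A * C * (1 / y + y ^ 2)" using y1 by (simp add: field_simps power2_eq_square power3_eq_cube)
    also have "\<dots> \<le> A * C * (80 * \<bar>real_of_int \<xi>\<bar> ^ 2)"
    proof (rule mult_left_mono)
      have "1 / y \<le> 1" using y1 by simp
      also have "\<dots> \<le> y ^ 2" using y1 by simp
      finally have "1 / y + y ^ 2 \<le> 2 * y ^ 2" by simp
      also have "\<dots> = 8 * pi\<^sup>2 * \<bar>real_of_int \<xi>\<bar> ^ 2" by (simp add: y_def power_mult_distrib)
      also have "\<dots> \<le> 8 * 10 * \<bar>real_of_int \<xi>\<bar> ^ 2"
      proof (intro mult_right_mono mult_left_mono)
        have "pi * pi \<le> 3.15 * 3.15" using pi_less_4 pi_ge_two pi_approx by (intro mult_mono) auto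
        then show "pi\<^sup>2 \<le> 10" by (simp add: power2_eq_square)
      qed auto
      finally show "1 / y + y ^ 2 \<le> 80 * \<bar>real_of_int \<xi>\<bar> ^ 2" by simp
    qed (use A C0 in auto)
    finally have "supn (airy \<sigma> (blk A a b) \<xi>) * \<bar>of_int \<xi>\<bar> powr (-s) \<le> (A * C * (80 * \<bar>real_of_int \<xi>\<bar> ^ 2)) * \<bar>real_of_int \<xi>\<bar> powr (-3)"
      using x1 s A C0 by (intro mult_mono powr_int_le) auto
    also have "\<dots> = 80 * (A * C) * (\<bar>real_of_int \<xi>\<bar> ^ 2 * \<bar>real_of_int \<xi>\<bar> powr (-3))" by simp
    also have "\<bar>real_of_int \<xi>\<bar> ^ 2 * \<bar>real_of_int \<xi>\<bar> powr (-3) = 1 / \<bar>real_of_int \<xi>\<bar>"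
    proof -
      have "\<bar>real_of_int \<xi>\<bar> ^ 2 = \<bar>real_of_int \<xi>\<bar> powr 2" using x1 by (simp add: powr_numeral)
      then have "\<bar>real_of_int \<xi>\<bar> ^ 2 * \<bar>real_of_int \<xi>\<bar> powr (-3) = \<bar>real_of_int \<xi>\<bar> powr (2 + (-3))"
        by (simp only: powr_add)
      also have "\<dots> = \<bar>real_of_int \<xi>\<bar> powr (-1)" by simp
      finally show ?thesis using x1 by (simp add: powr_minus_divide)
    qed
    also have "80 * (A * C) * (1 / \<bar>real_of_int \<xi>\<bar>) \<le> 80 * (A * C) * (1 / real M)"
      using A C0 xM M by (intro mult_left_mono divide_left_mono) auto
    finally show ?thesis by simp
  qed
  have "(\<Sum>\<xi>\<in>F. supn (airy \<sigma> (blk A a b) \<xi>) * \<bar>of_int \<xi>\<bar> powr (-s))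
     = (\<Sum>\<xi>\<in>F \<inter> freqs. supn (airy \<sigma> (blk A a b) \<xi>) * \<bar>of_int \<xi>\<bar> powr (-s))"
  proof (rule sum.mono_neutral_right)
    have "airy \<sigma> (blk A a b) \<xi> = (\<lambda>t. 0)" if "\<xi> \<notin> freqs" for \<xi>
      using that by (simp add: airy_def[abs_def] blk_def[abs_def])
    then show "\<forall>\<xi>\<in>F - F \<inter> freqs. supn (airy \<sigma> (blk A a b) \<xi>) * \<bar>of_int \<xi>\<bar> powr (-s) = 0" by simp
  qed (use F in auto)
  also have "\<dots> \<le> (\<Sum>\<xi>\<in>F \<inter> freqs. 80 * (A * C) / real M)" by (intro sum_mono 1) auto
  also have "\<dots> \<le> (\<Sum>\<xi>\<in>freqs. 80 * (A * C) / real M)" using A C0 finite_freqs by (intro sum_mono2) auto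
  also have "\<dots> \<le> 8 * real M * (80 * (A * C) / real M)" using A C0 by (intro sum_freqs_le) auto
  also have "\<dots> = 640 * C * A" using M by simp
  finally show ?thesis .
qed

text \<open>All frequencies lie between \<open>M\<close> and L k^2 M, so the Sobolev weight is at
  most M^(2r) up to a factor that depends on \<open>L\<close>, \<open>k\<close> and \<open>r\<close>
  only; the exponent |r| in that factor covers both signs of \<open>r\<close>.\<close>

lemma sobolev_bound:
  assumes C: "\<And>t. t \<in> {0..1} \<Longrightarrow> norm (a t) \<le> C" "\<And>t. t \<in> {0..1} \<Longrightarrow> norm (b t) \<le> C" and A: "A \<ge> 0"
    and tp: "tpoly (blk A a b)"
  shows "(\<Sum>\<xi>\<in>supp (blk A a b). (1 + (of_int \<xi>)\<^sup>2) powr r * (supn (blk A a b \<xi>))\<^sup>2)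
    \<le> 8 * C\<^sup>2 * (2 * (of_int L * real k ^ 2)\<^sup>2) powr \<bar>r\<bar> * (A\<^sup>2 * real M powr (1 + 2 * r))"
proof -
  let ?D = "of_int L * real k ^ 2 :: real"
  have C0: "0 \<le> C" using order_trans[OF norm_ge_zero C(1)[of 0]] by simp
  have D1: "?D \<ge> 1" using L_pos k mult_mono[of 1 "real_of_int L" 1 "real k ^ 2"] by simp
  have 1: "(1 + (of_int \<xi>)\<^sup>2) powr r * (supn (blk A a b \<xi>))\<^sup>2 \<le> (2 * ?D\<^sup>2) powr \<bar>r\<bar> * real M powr (2 * r) * (A * C)\<^sup>2"
    if \<xi>: "\<xi> \<in> freqs" for \<xi>
  proof (intro mult_mono power_mono)
    have "int M \<le> \<bar>\<xi>\<bar>" using M_le[OF \<xi>] .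
    then have lo: "real M \<le> \<bar>real_of_int \<xi>\<bar>" by linarith
    have "real_of_int \<bar>\<xi>\<bar> \<le> real_of_int (L * (int k ^ 2 * int M))" using freqs_bounds(2)[OF \<xi>] by (simp only: of_int_le_iff)
    then have hi: "\<bar>real_of_int \<xi>\<bar> \<le> ?D * real M" by simp
    have M2: "(real M)\<^sup>2 = real M powr 2" using M powr_realpow[of "real M" 2] by simp
    show "(1 + (real_of_int \<xi>)\<^sup>2) powr r \<le> (2 * ?D\<^sup>2) powr \<bar>r\<bar> * real M powr (2 * r)"
    proof (cases "r \<ge> 0")
      case True
      have "1 + (real_of_int \<xi>)\<^sup>2 \<le> 1 + (?D * real M)\<^sup>2" using power_mono[OF hi, of 2] by simp
      also have "\<dots> \<le> 2 * (?D * real M)\<^sup>2"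
        using mult_mono[of 1 ?D 1 "real M"] D1 M by (simp add: one_le_power)
      finally have "(1 + (real_of_int \<xi>)\<^sup>2) powr r \<le> (2 * (?D * real M)\<^sup>2) powr r" using True by (intro powr_mono2) auto
      also have "2 * (?D * real M)\<^sup>2 = (2 * ?D\<^sup>2) * real M powr 2" unfolding M2[symmetric] by (simp add: power_mult_distrib)
      also have "((2 * ?D\<^sup>2) * real M powr 2) powr r = (2 * ?D\<^sup>2) powr r * (real M powr 2) powr r"
        by (subst powr_mult) auto
      also have "(real M powr 2) powr r = real M powr (2 * r)" by (rule powr_powr)
      finally show ?thesis using True by simp
    next
      case False
      have "(real M)\<^sup>2 \<le> 1 + (real_of_int \<xi>)\<^sup>2" using power_mono[OF lo, of 2] by simp
      then have "(1 + (real_of_int \<xi>)\<^sup>2) powr r \<le> (real M powr 2) powr r"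
        using False M unfolding M2[symmetric] by (intro powr_mono2') auto
      also have "\<dots> = 1 * real M powr (2 * r)" by (simp only: powr_powr mult_1)
      also have "\<dots> \<le> (2 * ?D\<^sup>2) powr \<bar>r\<bar> * real M powr (2 * r)"
      proof (rule mult_right_mono)
        have "1 \<le> ?D\<^sup>2" using D1 by (rule one_le_power)
        then show "1 \<le> (2 * ?D\<^sup>2) powr \<bar>r\<bar>" by (intro ge_one_powr_ge_zero) auto
      qed simp
      finally show ?thesis .
    qed
    show "supn (blk A a b \<xi>) \<le> A * C" using C A by (intro supn_le blk_bound) auto
    show "0 \<le> supn (blk A a b \<xi>)" by (intro supn_nonneg flat_continuous tpolyD[OF tp])
  qed auto
  have "(\<Sum>\<xi>\<in>supp (blk A a b). (1 + (of_int \<xi>)\<^sup>2) powr r * (supn (blk A a b \<xi>))\<^sup>2)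
      \<le> (\<Sum>\<xi>\<in>freqs. (1 + (of_int \<xi>)\<^sup>2) powr r * (supn (blk A a b \<xi>))\<^sup>2)"
    by (intro sum_mono2 supp_blk finite_freqs) auto
  also have "\<dots> \<le> 8 * real M * ((2 * ?D\<^sup>2) powr \<bar>r\<bar> * real M powr (2 * r) * (A * C)\<^sup>2)"
    using 1 by (intro sum_freqs_le) auto
  also have "\<dots> = 8 * C\<^sup>2 * (2 * ?D\<^sup>2) powr \<bar>r\<bar> * (A\<^sup>2 * (real M powr 1 * real M powr (2 * r)))"
    by (simp add: power_mult_distrib)
  also have "real M powr 1 * real M powr (2 * r) = real M powr (1 + 2 * r)" by (rule powr_add[symmetric])
  finally show ?thesis .
qed

end

lemma eventually_powr_le:
  fixes K \<gamma> \<epsilon> :: real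
  assumes "\<gamma> < 0" "\<epsilon> > 0"
  shows "\<forall>\<^sub>F M in sequentially. K * real M powr \<gamma> \<le> \<epsilon>"
proof -
  have "(\<lambda>M. K * real M powr \<gamma>) \<longlonglongrightarrow> K * 0"
    by (intro tendsto_intros tendsto_neg_powr assms filterlim_real_sequentially)
  then have "\<forall>\<^sub>F M in sequentially. K * real M powr \<gamma> < \<epsilon>"
    using assms by (intro order_tendstoD) auto
  then show ?thesis by eventually_elim simp
qed

text \<open>The step \<open>L\<close> is fixed before \<open>M\<close>, since only \<open>L\<close> controls the interactions within the packet.\<close>

lemma one_mode_step:
  fixes c :: "int \<Rightarrow> real \<Rightarrow> complex" and f B :: int
  assumes k: "k \<ge> 2" and s: "s \<ge> 3" and \<sigma>: "\<bar>\<sigma>\<bar> \<le> 1" and c: "tpoly c" and f: "f > 0" and \<delta>: "\<delta> > 0"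
    and p: "p < 2" and r: "r < 1/2 - 1/real k"
  obtains v where "tpoly v" "\<And>\<xi>. \<xi> \<in> supp v \<Longrightarrow> B < \<bar>\<xi>\<bar>" "supp c \<inter> supp v = {}"
    "mass k s (\<lambda>\<xi> t. c \<xi> t + v \<xi> t)
       \<le> mass k s c + (supn (resid \<sigma> k c f) + supn (resid \<sigma> k c (-f))) * of_int f powr (-s) + \<delta>"
    "\<And>F. finite F \<Longrightarrow> 0 \<notin> F \<Longrightarrow>
      (\<Sum>\<xi>\<in>F. supn (\<lambda>t. resid \<sigma> k (\<lambda>\<xi> t. c \<xi> t + v \<xi> t) \<xi> t - (if \<bar>\<xi>\<bar> = f then 0 else resid \<sigma> k c \<xi> t))
        * \<bar>of_int \<xi>\<bar> powr (-s)) \<le> \<delta>"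
    "\<And>t q. t \<in> {0..1} \<Longrightarrow> 1 \<le> q \<Longrightarrow> q \<le> p \<Longrightarrow> (LINT x|lebesgue_on {0..1}. \<bar>val v t x\<bar> powr q) \<le> \<delta>"
    "(\<Sum>\<xi>\<in>supp v. (1 + (of_int \<xi>)\<^sup>2) powr r * (supn (v \<xi>))\<^sup>2) \<le> \<delta>"
proof -
  have "(1::real) < 2" by simp
  then obtain H where H: "H \<ge> 0" "\<And>F::int set. finite F \<Longrightarrow> (\<Sum>g\<in>F. if g = 0 then 0 else \<bar>real_of_int g\<bar> powr (-2)) \<le> H"
    by (rule sum_powr_int_bound) (rule that)
  \<comment> \<open>The sign is part of the target: the packet has to produce minus the residual at
    \<open>f\<close>.\<close>
  have "(\<lambda>t. (-1) * resid \<sigma> k c f t) \<in> flat" using c k by (intro flat_scale resid_flat) auto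
  moreover have "k - 1 > 0" using k by simp
  ultimately obtain a b0 where a: "a \<in> flat" "\<And>t. cnj (a t) = a t" and b0: "b0 \<in> flat"
    and fac: "\<And>t. (-1) * resid \<sigma> k c f t = a t ^ (k - 1) * b0 t"
    by (rule flat_factor_power) (rule that)
  let ?D = "\<lambda>g t. vector_derivative g (at t) :: complex"
  define \<beta> where "\<beta> = (2 * real k) ^ (k - 1) * 2 ^ k"
  \<comment> \<open>Fixed before \<open>L\<close> and \<open>M\<close>: \<open>\<beta>\<close> will
    bound the reciprocal of \<open>rho A\<close> whatever \<open>M\<close> is. Time derivatives are
    included because the linear part contains them.\<close>
  define C where "C = 1 + supn a + \<beta> * supn b0 + supn (?D a) + \<beta> * supn (?D b0)"
  define CX where "CX = (\<Sum>\<xi>\<in>supp c. supn (c \<xi>))"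
  \<comment> \<open>Three errors share the budget: mixed tuples, pure tuples and the linear
    part.\<close>
  define d where "d = \<delta> / 3"
  have d: "d > 0" using \<delta> by (simp add: d_def)
  have \<beta>: "\<beta> > 0" using k by (simp add: \<beta>_def)
  have nn: "supn g \<ge> 0" if "g \<in> flat" for g using that by (intro supn_nonneg flat_continuous)
  have C1: "C \<ge> 1" unfolding C_def using a b0 \<beta> nn flat_deriv by (simp add: add_nonneg_nonneg)
  have fin: "finite (supp c)" using c by (rule tpolyD)
  define N0 where "N0 = Max (insert 0 (abs ` supp c))"
  have N0: "0 \<le> N0" "\<And>\<xi>. \<xi> \<in> supp c \<Longrightarrow> \<bar>\<xi>\<bar> \<le> N0" using fin by (auto simp: N0_def)
  define R where "R = 8 ^ (k - 1) * C ^ k * H * 2 / d"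
  have R0: "0 \<le> R" using C1 H d by (simp add: R_def)
  \<comment> \<open>The summands meet the condition of the locale, put the packet beyond
    \<open>B\<close> and beyond the support of \<open>c\<close>, and bring the bound of
    \<open>pure_bound\<close> below \<open>d\<close>.\<close>
  define L where "L = 2 * int k * f + \<bar>B\<bar> + 1 + N0 + \<lceil>R\<rceil>"
  have kf: "0 \<le> 2 * int k * f" using f by simp
  have Lc: "L \<ge> 2 * int k * f" "L > B" "L > N0" "L \<ge> \<lceil>R\<rceil>" "L > 0"
  proof -
    have "0 \<le> \<lceil>R\<rceil>" using R0 by simp
    then show "L \<ge> 2 * int k * f" "L > B" "L > N0" "L \<ge> \<lceil>R\<rceil>" "L > 0"
      using N0(1) kf unfolding L_def by linarith+
  qed
  have RL: "8 ^ (k - 1) * C ^ k * H * (2 / of_int L) \<le> d"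
  proof -
    have "R \<le> of_int L" using Lc(4) by (simp add: ceiling_le_iff)
    then show ?thesis using Lc(5) d by (simp add: R_def field_simps)
  qed
  define K1 where "K1 = real k ^ 2 * C * H * CX * (CX + 8 * C) ^ (k - 2)"
  define K4 where "K4 = 8 * C\<^sup>2 * (2 * (of_int L * real k ^ 2)\<^sup>2) powr \<bar>r\<bar>"
  have k0: "real k > 0" using k by simp
  \<comment> \<open>Four demands on \<open>M\<close>: mixed tuples, linear part, L^q norm and
    Sobolev norm. The hypothesis on \<open>r\<close> says precisely that the last exponent is
    negative.\<close>
  have e1: "\<forall>\<^sub>F M in sequentially. K1 * real M powr (- (1 / real k)) \<le> d"
    by (intro eventually_powr_le d) (use k in auto)
  have e2: "\<forall>\<^sub>F M in sequentially. (640 * C) * real M powr (1 / real k - 1) \<le> d"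
    by (intro eventually_powr_le d) (use k in auto)
  have e3: "\<forall>\<^sub>F M in sequentially. (4 * C) powr 2 * real M powr (p / 2 - 1) \<le> \<delta>"
    by (intro eventually_powr_le \<delta>) (use p in auto)
  have e4: "\<forall>\<^sub>F M in sequentially. K4 * real M powr (2 / real k - 1 + 2 * r) \<le> \<delta>"
    by (intro eventually_powr_le \<delta>) (use r in auto)
  obtain M where Mc: "M \<ge> 1" "K1 * real M powr (- (1 / real k)) \<le> d" "(640 * C) * real M powr (1 / real k - 1) \<le> d"
    "(4 * C) powr 2 * real M powr (p / 2 - 1) \<le> \<delta>" "K4 * real M powr (2 / real k - 1 + 2 * r) \<le> \<delta>"
    using eventually_happens'[OF _ eventually_conj[OF eventually_ge_at_top[of 1] eventually_conj[OF e1 eventually_conj[OF e2 eventually_conj[OF e3 e4]]]]]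
    by auto
  interpret block k M f L by unfold_locales (use k Mc f Lc in auto)
  define A where "A = real M powr (1 / real k - 1)"
  have M0: "real M > 0" "real M \<ge> 1" using Mc by auto
  have A0: "A > 0" using M0 by (simp add: A_def)
  have AM: "A * real M = real M powr (1 / real k)"
  proof -
    have "A * real M = real M powr (1 / real k - 1) * real M powr 1" using M0 by (simp add: A_def)
    also have "\<dots> = real M powr (1 / real k - 1 + 1)" by (rule powr_add[symmetric])
    finally show ?thesis by simp
  qed
  have AM1: "A * real M \<ge> 1" unfolding AM using M0 by (intro ge_one_powr_ge_zero) auto
  have AkM: "A ^ k * real M ^ (k - 1) = 1"
  proof -
    have "A ^ k = A powr real k" using A0 by (simp add: powr_realpow)
    also have "\<dots> = real M powr (1 - real k)" unfolding A_def powr_powr using k by (simp add: left_diff_distrib)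
    finally have 1: "A ^ k = real M powr (1 - real k)" .
    have "real M ^ (k - 1) = real M powr real (k - 1)" using M0 by (simp add: powr_realpow)
    then have 2: "real M ^ (k - 1) = real M powr (real k - 1)" using k by (simp add: of_nat_diff)
    show ?thesis unfolding 1 2 powr_add[symmetric] using M0 by simp
  qed
  have rho: "rho A \<ge> 1 / \<beta>" using rho_ge_const[OF A0 AkM] by (simp add: \<beta>_def)
  have rho0: "rho A > 0" using rho \<beta> by (meson less_le_trans zero_less_divide_1_iff)
  have rhoi: "1 / rho A \<le> \<beta>" using rho rho0 \<beta> by (simp add: field_simps)
  \<comment> \<open>Division by \<open>rho A\<close> makes the coefficient that the packet generates
    at \<open>f\<close> exactly a^(k-1) b0.\<close>
  define b where "b = (\<lambda>t. of_real (1 / rho A) * b0 t)"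
  have b: "b \<in> flat" unfolding b_def by (intro flat_scale b0)
  have bD: "?D b t = of_real (1 / rho A) * ?D b0 t" for t
    unfolding b_def by (intro vector_derivative_at has_vector_derivative_mult_right flat_has_vector_derivative b0)
  have nrm: "norm (of_real (1 / rho A) * z) \<le> \<beta> * norm z" for z :: complex
    using rhoi rho0 by (simp only: norm_mult norm_of_real) (intro mult_right_mono, auto)
  note cont = flat_continuous[of _ "{0..1}"]
  have Q: "0 \<le> supn a" "0 \<le> \<beta> * supn b0" "0 \<le> supn (?D a)" "0 \<le> \<beta> * supn (?D b0)"
    using \<beta> by (auto intro!: mult_nonneg_nonneg nn a b0 flat_deriv)
  have Ca: "norm (a t) \<le> C" if "t \<in> {0..1}" for t
    using supn_ge[OF cont[OF a(1)] that] Q unfolding C_def by linarith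
  have Cb: "norm (b t) \<le> C" if "t \<in> {0..1}" for t
  proof -
    have "norm (b t) \<le> \<beta> * supn b0" unfolding b_def
      by (rule order_trans[OF nrm mult_left_mono[OF supn_ge[OF cont[OF b0] that]]]) (use \<beta> in auto)
    then show ?thesis using Q unfolding C_def by linarith
  qed
  have Cda: "norm (?D a t) \<le> C" if "t \<in> {0..1}" for t
    using supn_ge[OF cont[OF flat_deriv[OF a(1)]] that] Q unfolding C_def by linarith
  have Cdb: "norm (?D b t) \<le> C" if "t \<in> {0..1}" for t
  proof -
    have "norm (?D b t) \<le> \<beta> * supn (?D b0)" unfolding bD
      by (rule order_trans[OF nrm mult_left_mono[OF supn_ge[OF cont[OF flat_deriv[OF b0]] that]]]) (use \<beta> in auto)
    then show ?thesis using Q unfolding C_def by linarith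
  qed
  define v where "v = blk A a b"
  have v: "tpoly v" unfolding v_def by (rule blk_tpoly[OF a(1) b a(2)])
  have sv: "supp v \<subseteq> freqs" unfolding v_def by (rule supp_blk)
  have large: "L \<le> \<bar>\<xi>\<bar>" if "\<xi> \<in> freqs" for \<xi>
    using freqs_bounds(1)[OF that] Lc(5) Mc(1) mult_left_mono[of 1 "int M" L] by linarith
  have dis: "supp c \<inter> freqs = {}" using large N0(2) Lc(3) by fastforce
  define m where "m = (\<lambda>\<xi>. if \<xi> \<in> freqs then A * C else supn (c \<xi>))"
  have m0: "0 \<le> m \<xi>" for \<xi> using A0 C1 nn[OF tpolyD(3)[OF c]] by (simp add: m_def)
  have mV: "m \<xi> \<le> A * C" if "\<xi> \<in> freqs" for \<xi> using that by (simp add: m_def)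
  have mX: "sum m (supp c) \<le> CX"
    unfolding CX_def using dis by (intro sum_mono) (auto simp: m_def)
  have sC: "s \<ge> 3" "0 \<le> C" using s C1 by auto
  have mix: "(\<Sum>\<xi>\<in>{\<xi>\<in>mixed k (supp c) freqs. (\<Sum>i<k. \<xi> i) \<noteq> 0}. (\<Prod>i<k. m (\<xi> i)) * \<bar>of_int (\<Sum>i<k. \<xi> i)\<bar> powr (-s)) \<le> d"
    using order_trans[OF mixed_bound[OF H(2) m0 mV A0 AkM AM1 sC(2,1) fin dis mX] order_trans[OF _ Mc(2)]]
    by (simp add: K1_def AM powr_minus_divide)
  have pure: "(\<Sum>\<xi>\<in>{\<xi>\<in>{..<k} \<rightarrow>\<^sub>E freqs. (\<Sum>i<k. \<xi> i) \<noteq> 0 \<and> \<bar>\<Sum>i<k. \<xi> i\<bar> \<noteq> f}.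
        (\<Prod>i<k. m (\<xi> i)) * \<bar>of_int (\<Sum>i<k. \<xi> i)\<bar> powr (-s)) \<le> d"
    by (rule order_trans[OF pure_bound[OF H(2) m0 mV A0 AkM sC(2,1)] RL])
  have lin: "(\<Sum>\<xi>\<in>F. supn (airy \<sigma> v \<xi>) * \<bar>of_int \<xi>\<bar> powr (-s)) \<le> d" if "finite F" for F
    unfolding v_def using Mc(3) A0
    by (intro order_trans[OF airy_bound[OF a(1) b _ Ca Cb Cda Cdb sC(1) \<sigma> that]]) (auto simp: A_def)
  have killf: "conv k v f t = - resid \<sigma> k c f t" for t
  proof -
    have "conv k v f t = of_real (rho A) * (a t ^ (k - 1) * b t)" unfolding v_def by (rule conv_blk)
    also have "\<dots> = a t ^ (k - 1) * b0 t" using rho0 by (simp add: b_def)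
    finally show ?thesis using fac[of t] by simp
  qed
  have kill: "conv k v g t = - resid \<sigma> k c g t" if "\<bar>g\<bar> = f" for g t
  proof (cases "g = f")
    case False
    then have "g = - f" using that by linarith
    then show ?thesis using killf[of t] by (simp add: conv_uminus[OF v] resid_uminus[OF c])
  qed (use killf in simp)
  have killmassf: "(\<Sum>\<xi>\<in>{\<xi>\<in>{..<k} \<rightarrow>\<^sub>E freqs. (\<Sum>i<k. \<xi> i) = f}. supn (\<lambda>t. \<Prod>i<k. v (\<xi> i) t)) \<le> supn (resid \<sigma> k c f)"
  proof -
    let ?ab = "\<lambda>t. a t ^ (k - 1) * b t"
    let ?w = "\<lambda>\<xi>. \<Prod>i<k. A * wt (snd (dec (\<xi> i)))"
    have ab: "continuous_on {0..1} ?ab" by (intro continuous_intros cont a b)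
    have 1: "supn (\<lambda>t. \<Prod>i<k. v (\<xi> i) t) = ?w \<xi> * supn ?ab"
      if "\<xi> \<in> {\<xi>\<in>{..<k} \<rightarrow>\<^sub>E freqs. (\<Sum>i<k. \<xi> i) = f}" for \<xi>
    proof -
      have \<xi>: "\<xi> \<in> {..<k} \<rightarrow>\<^sub>E freqs" "(\<Sum>i<k. \<xi> i) = f" using that by auto
      have "0 \<le> ?w \<xi>" using \<xi>(1) wt_dec A0 by (intro prod_nonneg ballI mult_nonneg_nonneg) (auto simp: PiE_iff)
      then show ?thesis unfolding v_def blk_prod_f[OF \<xi>] supn_cmult[OF ab] by (simp only: norm_of_real abs_of_nonneg)
    qed
    have "(\<Sum>\<xi>\<in>{\<xi>\<in>{..<k} \<rightarrow>\<^sub>E freqs. (\<Sum>i<k. \<xi> i) = f}. supn (\<lambda>t. \<Prod>i<k. v (\<xi> i) t)) = rho A * supn ?ab"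
      unfolding rho_def sum_distrib_right by (intro sum.cong refl 1)
    also have "\<dots> = supn (\<lambda>t. of_real (rho A) * ?ab t)" unfolding supn_cmult[OF ab] using rho0 by simp
    also have "(\<lambda>t. of_real (rho A) * ?ab t) = (\<lambda>t. (-1) * resid \<sigma> k c f t)"
      unfolding fac using rho0 by (simp add: b_def fun_eq_iff)
    also have "supn \<dots> = supn (resid \<sigma> k c f)"
      using k by (subst supn_cmult) (auto intro!: cont resid_flat c)
    finally show ?thesis by simp
  qed
  have killmass: "(\<Sum>\<xi>\<in>{\<xi>\<in>{..<k} \<rightarrow>\<^sub>E freqs. (\<Sum>i<k. \<xi> i) = g}. supn (\<lambda>t. \<Prod>i<k. v (\<xi> i) t)) \<le> supn (resid \<sigma> k c g)"
    if "\<bar>g\<bar> = f" for g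
  proof (cases "g = f")
    case False
    then have g: "g = - f" using that by linarith
    have cn: "(\<lambda>t. \<Prod>i<k. v ((\<lambda>i\<in>{..<k}. - \<xi> i) i) t) = (\<lambda>t. cnj (\<Prod>i<k. v (\<xi> i) t))" for \<xi>
      by (simp add: tpolyD(4)[OF v])
    have rc: "resid \<sigma> k c (- f) = (\<lambda>t. cnj (resid \<sigma> k c f t))" by (rule ext) (rule resid_uminus[OF c])
    have "(\<Sum>\<xi>\<in>{\<xi>\<in>{..<k} \<rightarrow>\<^sub>E freqs. (\<Sum>i<k. \<xi> i) = - f}. supn (\<lambda>t. \<Prod>i<k. v (\<xi> i) t))
      = (\<Sum>\<xi>\<in>{\<xi>\<in>{..<k} \<rightarrow>\<^sub>E freqs. (\<Sum>i<k. \<xi> i) = f}. supn (\<lambda>t. \<Prod>i<k. v ((\<lambda>i\<in>{..<k}. - \<xi> i) i) t))"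
      by (rule sum_tuples_uminus) (rule freqs_minus)
    then show ?thesis using killmassf unfolding g cn rc supn_cnj by simp
  qed (use killmassf in simp)
  have mc: "supn (c \<xi>) \<le> m \<xi>" if "\<xi> \<in> supp c" for \<xi> using that dis by (auto simp: m_def)
  have mv: "supn (v \<xi>) \<le> m \<xi>" if "\<xi> \<in> freqs" for \<xi>
    using that A0 by (auto simp: m_def v_def intro!: supn_le blk_bound Ca Cb)
  have k0': "k > 0" using k by simp
  have step_mass: "mass k s (\<lambda>\<xi> t. c \<xi> t + v \<xi> t)
      \<le> mass k s c + (supn (resid \<sigma> k c f) + supn (resid \<sigma> k c (-f))) * of_int f powr (-s) + d + d"
    by (rule perturb(2)[OF c v refl sv finite_freqs dis k0' mc mv mix pure f kill killmass lin])
  have step_resid: "(\<Sum>\<xi>\<in>F. supn (\<lambda>t. resid \<sigma> k (\<lambda>\<xi> t. c \<xi> t + v \<xi> t) \<xi> t - (if \<bar>\<xi>\<bar> = f then 0 else resid \<sigma> k c \<xi> t))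
        * \<bar>of_int \<xi>\<bar> powr (-s)) \<le> d + d + d" if "finite F" "0 \<notin> F" for F
    by (rule perturb(3)[OF c v refl sv finite_freqs dis k0' mc mv mix pure f kill killmass lin]) (use that in auto)
  show ?thesis
  proof (rule that[of v])
    show "tpoly v" by (rule v)
    show "B < \<bar>\<xi>\<bar>" if "\<xi> \<in> supp v" for \<xi> using large[of \<xi>] sv that Lc(2) by auto
    show "supp c \<inter> supp v = {}" using dis sv by auto
    show "mass k s (\<lambda>\<xi> t. c \<xi> t + v \<xi> t)
       \<le> mass k s c + (supn (resid \<sigma> k c f) + supn (resid \<sigma> k c (-f))) * of_int f powr (-s) + \<delta>"
      using step_mass d unfolding d_def by simp
    show "(\<Sum>\<xi>\<in>F. supn (\<lambda>t. resid \<sigma> k (\<lambda>\<xi> t. c \<xi> t + v \<xi> t) \<xi> t - (if \<bar>\<xi>\<bar> = f then 0 else resid \<sigma> k c \<xi> t))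
        * \<bar>of_int \<xi>\<bar> powr (-s)) \<le> \<delta>" if "finite F" "0 \<notin> F" for F
      using step_resid[OF that] unfolding d_def by simp
    show "(LINT x|lebesgue_on {0..1}. \<bar>val v t x\<bar> powr q) \<le> \<delta>" if t: "t \<in> {0..1}" and q: "1 \<le> q" "q \<le> p" for t q
    proof -
      have "(LINT x|lebesgue_on {0..1}. \<bar>val v t x\<bar> powr q) \<le> (4 * A * C) powr q * real M powr (q - 1)"
        unfolding v_def by (rule Lq_blk) (use v A0 q Ca[OF t] Cb[OF t] in \<open>auto simp: v_def\<close>)
      also have "\<dots> = (4 * C) powr q * (A powr q * real M powr (q - 1))"
        using A0 C1 by (simp add: powr_mult mult_ac)
      also have "A powr q * real M powr (q - 1) = real M powr (q / real k - 1)"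
        unfolding A_def powr_powr powr_add[symmetric] by (simp add: algebra_simps)
      \<comment> \<open>Since 4 C >= 1 and q <= p < 2 <= k, both factors are replaced by values that
        do not depend on \<open>q\<close>; these entered the choice of \<open>M\<close>.\<close>
      also have "(4 * C) powr q * real M powr (q / real k - 1) \<le> (4 * C) powr 2 * real M powr (p / 2 - 1)"
      proof (intro mult_mono powr_mono)
        have "q / real k \<le> q / 2" using k q by (intro divide_left_mono) auto
        then show "q / real k - 1 \<le> p / 2 - 1" using q by simp
      qed (use q p C1 M0 in auto)
      also note Mc(4)
      finally show ?thesis .
    qed
    have "(\<Sum>\<xi>\<in>supp v. (1 + (of_int \<xi>)\<^sup>2) powr r * (supn (v \<xi>))\<^sup>2) \<le> K4 * (A\<^sup>2 * real M powr (1 + 2 * r))"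
      unfolding v_def K4_def by (rule sobolev_bound) (use Ca Cb A0 v in \<open>auto simp: v_def\<close>)
    also have "A\<^sup>2 = A powr 2" using A0 by simp
    also have "A powr 2 * real M powr (1 + 2 * r) = real M powr (2 / real k - 1 + 2 * r)"
      unfolding A_def powr_powr powr_add[symmetric] by (simp add: algebra_simps)
    also note Mc(5)
    finally show "(\<Sum>\<xi>\<in>supp v. (1 + (of_int \<xi>)\<^sup>2) powr r * (supn (v \<xi>))\<^sup>2) \<le> \<delta>" .
  qed
qed

subsection \<open>The cascade\<close>

definition psum :: "(nat \<Rightarrow> int \<Rightarrow> real \<Rightarrow> complex) \<Rightarrow> nat \<Rightarrow> int \<Rightarrow> real \<Rightarrow> complex" where
  "psum w n \<xi> t = (\<Sum>i\<le>n. w i \<xi> t)"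

text \<open>What the passage to the limit needs. By \<open>far\<close>, each coefficient is constant
  in \<open>n\<close> from some index on. The exponents in \<open>Lq\<close> and \<open>sob\<close>
  increase to their endpoints, so a fixed exponent below the endpoint is covered for all but
  finitely many \<open>n\<close>. The rate 1/8 beats the factor 4^(n+1) in
  \<open>Lp_series\<close>.\<close>

locale cascade =
  fixes \<sigma> s K :: real and k :: nat and w :: "nat \<Rightarrow> int \<Rightarrow> real \<Rightarrow> complex"
  assumes k: "k \<ge> 2"
    and w: "tpoly (w n)"
    and disj: "i \<noteq> j \<Longrightarrow> supp (w i) \<inter> supp (w j) = {}"
    and far: "\<xi> \<in> supp (w n) \<Longrightarrow> int n \<le> \<bar>\<xi>\<bar>"
    and psum: "tpoly (psum w n)"
    and mass: "mass k s (psum w n) \<le> K"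
    and resid_mass: "finite F \<Longrightarrow> 0 \<notin> F \<Longrightarrow> (\<Sum>\<xi>\<in>F. supn (resid \<sigma> k (psum w n) \<xi>) * \<bar>of_int \<xi>\<bar> powr (-s)) \<le> K"
    and resid_lim: "\<xi> \<noteq> 0 \<Longrightarrow> (\<lambda>n. supn (resid \<sigma> k (psum w n) \<xi>)) \<longlonglongrightarrow> 0"
    and Lq: "n > 0 \<Longrightarrow> t \<in> {0..1} \<Longrightarrow> 1 \<le> q \<Longrightarrow> q \<le> 2 - 1 / real (Suc n) \<Longrightarrow>
        (LINT x|lebesgue_on {0..1}. \<bar>val (w n) t x\<bar> powr q) \<le> (1/8) ^ n"
    and sob: "n > 0 \<Longrightarrow> (\<Sum>\<xi>\<in>supp (w n). (1 + (of_int \<xi>)\<^sup>2) powr (1/2 - 1/real k - 1 / real (Suc n)) * (supn (w n \<xi>))\<^sup>2) \<le> (1/8) ^ n"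
    and w0: "w 0 1 1 \<noteq> 0"

lemma resid_finite_support:
  assumes c: "tpoly c"
  obtains Y where "finite Y" "supp c \<subseteq> Y" "\<And>\<xi> t. \<xi> \<notin> Y \<Longrightarrow> conv k c \<xi> t = 0" "\<And>\<xi>. \<xi> \<notin> Y \<Longrightarrow> resid \<sigma> k c \<xi> = (\<lambda>t. 0)"
proof -
  define Y where "Y = supp c \<union> (\<lambda>\<xi>. \<Sum>i<k. \<xi> i) ` ({..<k} \<rightarrow>\<^sub>E supp c)"
  have cv: "conv k c \<xi> t = 0" if "\<xi> \<notin> Y" for \<xi> t
  proof -
    have "{\<eta>\<in>{..<k} \<rightarrow>\<^sub>E supp c. (\<Sum>i<k. \<eta> i) = \<xi>} = {}" using that by (auto simp: Y_def)
    then show ?thesis unfolding conv_def by (simp only: sum.empty)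
  qed
  have "resid \<sigma> k c \<xi> = (\<lambda>t. 0)" if "\<xi> \<notin> Y" for \<xi>
  proof -
    have "c \<xi> = (\<lambda>t. 0)" using that by (auto simp: Y_def supp_def)
    then show ?thesis using cv[OF that] by (simp add: resid_def[abs_def] airy_def)
  qed
  moreover have "finite Y" unfolding Y_def using finite_tuples[OF tpolyD(1)[OF c]] tpolyD(1)[OF c] by auto
  ultimately show ?thesis using cv by (intro that[of Y]) (auto simp: Y_def)
qed

text \<open>The residual masses are bounded by a potential argument: up to summable errors, \<open>mass\<close> plus the weighted
  sum of the residual does not increase along the sequence.\<close>

theorem cascade_exists:
  assumes k: "k \<ge> 2" and s: "s \<ge> 3" and \<sigma>: "\<bar>\<sigma>\<bar> \<le> 1"
  obtains w K where "cascade \<sigma> s K k w"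
proof -
  \<comment> \<open>The seed is 2 cos(2 pi x) times \<open>bump 1 0\<close>. Its coefficient at mode
    1 is never changed and makes the limit nonzero.\<close>
  define c0 :: "int \<Rightarrow> real \<Rightarrow> complex" where "c0 = (\<lambda>\<xi> t. if \<bar>\<xi>\<bar> = 1 then 1 * of_real (bump 1 0 t) else 0)"
  have c0: "tpoly c0"
    unfolding tpoly_def
  proof (intro conjI allI)
    have "supp c0 \<subseteq> {-1..1}" by (auto simp: supp_def c0_def split: if_splits)
    then show "finite (supp c0)" by (rule finite_subset) simp
    show "c0 \<xi> \<in> flat" for \<xi>
      using flat.bump[of 1 1 0] flat_zero by (cases "\<bar>\<xi>\<bar> = 1") (simp_all add: c0_def)
  qed (auto simp: supp_def c0_def)
  \<comment> \<open>Pairs are enumerated and only the first component is used, so every positive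
    integer is visited infinitely often.\<close>
  define fn :: "nat \<Rightarrow> int" where "fn = (\<lambda>n. 1 + int (fst (prod_decode n)))"
  have fn: "fn n > 0" for n by (simp add: fn_def)
  have fn_inf: "\<exists>n\<ge>j. fn n = \<bar>\<xi>\<bar>" if "\<xi> \<noteq> 0" for \<xi> j
    using that by (intro exI[of _ "prod_encode (nat (\<bar>\<xi>\<bar> - 1), j)"]) (auto simp: fn_def le_prod_encode_2)
  define \<delta> :: "nat \<Rightarrow> real" where "\<delta> = (\<lambda>n. (1/8) ^ Suc n)"
  define R where "R = resid \<sigma> k"
  define good where "good = (\<lambda>n c v. tpoly v \<and> (\<forall>\<xi>\<in>supp v. int (Suc n) < \<bar>\<xi>\<bar>) \<and> supp c \<inter> supp v = {} \<and>
    mass k s (\<lambda>\<xi> t. c \<xi> t + v \<xi> t) \<le> mass k s c + (supn (R c (fn n)) + supn (R c (- fn n))) * of_int (fn n) powr (-s) + \<delta> n \<and>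
    (\<forall>F. finite F \<and> 0 \<notin> F \<longrightarrow> (\<Sum>\<xi>\<in>F. supn (\<lambda>t. R (\<lambda>\<xi> t. c \<xi> t + v \<xi> t) \<xi> t - (if \<bar>\<xi>\<bar> = fn n then 0 else R c \<xi> t))
        * \<bar>of_int \<xi>\<bar> powr (-s)) \<le> \<delta> n) \<and>
    (\<forall>t q. t \<in> {0..1} \<and> 1 \<le> q \<and> q \<le> 2 - 1 / real (Suc (Suc n)) \<longrightarrow> (LINT x|lebesgue_on {0..1}. \<bar>val v t x\<bar> powr q) \<le> \<delta> n) \<and>
    (\<Sum>\<xi>\<in>supp v. (1 + (of_int \<xi>)\<^sup>2) powr (1/2 - 1/real k - 1 / real (Suc (Suc n))) * (supn (v \<xi>))\<^sup>2) \<le> \<delta> n)"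
  have step: "\<exists>v. good n c v" if c: "tpoly c" for n c
  proof -
    have "\<delta> n > 0" "2 - 1 / real (Suc (Suc n)) < 2" "1/2 - 1/real k - 1 / real (Suc (Suc n)) < 1/2 - 1/real k"
      by (simp_all add: \<delta>_def)
    from one_mode_step[OF k s \<sigma> c fn this, where B = "int (Suc n)"] obtain v where
      "tpoly v" "\<And>\<xi>. \<xi> \<in> supp v \<Longrightarrow> int (Suc n) < \<bar>\<xi>\<bar>" "supp c \<inter> supp v = {}"
      "mass k s (\<lambda>\<xi> t. c \<xi> t + v \<xi> t) \<le> mass k s c + (supn (resid \<sigma> k c (fn n)) + supn (resid \<sigma> k c (- fn n))) * of_int (fn n) powr (-s) + \<delta> n"
      "\<And>F. finite F \<Longrightarrow> 0 \<notin> F \<Longrightarrow> (\<Sum>\<xi>\<in>F. supn (\<lambda>t. resid \<sigma> k (\<lambda>\<xi> t. c \<xi> t + v \<xi> t) \<xi> t - (if \<bar>\<xi>\<bar> = fn n then 0 else resid \<sigma> k c \<xi> t))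
        * \<bar>of_int \<xi>\<bar> powr (-s)) \<le> \<delta> n"
      "\<And>t q. t \<in> {0..1} \<Longrightarrow> 1 \<le> q \<Longrightarrow> q \<le> 2 - 1 / real (Suc (Suc n)) \<Longrightarrow> (LINT x|lebesgue_on {0..1}. \<bar>val v t x\<bar> powr q) \<le> \<delta> n"
      "(\<Sum>\<xi>\<in>supp v. (1 + (of_int \<xi>)\<^sup>2) powr (1/2 - 1/real k - 1 / real (Suc (Suc n))) * (supn (v \<xi>))\<^sup>2) \<le> \<delta> n"
      by blast
    then show ?thesis unfolding good_def R_def by (intro exI[of _ v] conjI allI impI ballI) auto
  qed
  have "\<exists>c. \<forall>n. (tpoly (c n) \<and> (n = 0 \<longrightarrow> c n = c0)) \<and>
      (\<exists>v. good n (c n) v \<and> c (Suc n) = (\<lambda>\<xi> t. c n \<xi> t + v \<xi> t))"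
  proof (rule dependent_nat_choice)
    show "\<exists>c. tpoly c \<and> (0 = (0::nat) \<longrightarrow> c = c0)" using c0 by blast
    fix c and n :: nat assume "tpoly c \<and> (n = 0 \<longrightarrow> c = c0)"
    then have c: "tpoly c" by blast
    from step[OF this] obtain v where v: "good n c v" by blast
    then have tv: "tpoly v" by (simp add: good_def)
    have "tpoly (\<lambda>\<xi> t. c \<xi> t + v \<xi> t)"
      unfolding tpoly_def
    proof (intro conjI allI)
      have "supp (\<lambda>\<xi> t. c \<xi> t + v \<xi> t) \<subseteq> supp c \<union> supp v" by (auto simp: supp_def)
      then show "finite (supp (\<lambda>\<xi> t. c \<xi> t + v \<xi> t))" "0 \<notin> supp (\<lambda>\<xi> t. c \<xi> t + v \<xi> t)"
        using tpolyD(1,2)[OF c] tpolyD(1,2)[OF tv] by (auto intro: finite_subset)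
      show "(\<lambda>t. c \<xi> t + v \<xi> t) \<in> flat" for \<xi> by (intro flat.add tpolyD c tv)
    qed (simp add: tpolyD(4)[OF c] tpolyD(4)[OF tv])
    then show "\<exists>y. (tpoly y \<and> (Suc n = 0 \<longrightarrow> y = c0)) \<and> (\<exists>v. good n c v \<and> y = (\<lambda>\<xi> t. c \<xi> t + v \<xi> t))"
      using v by blast
  qed
  then obtain c where tc: "\<And>n. tpoly (c n)" and c00: "c 0 = c0"
    and ex: "\<And>n. \<exists>v. good n (c n) v \<and> c (Suc n) = (\<lambda>\<xi> t. c n \<xi> t + v \<xi> t)" by blast
  from choice[of "\<lambda>n v. good n (c n) v \<and> c (Suc n) = (\<lambda>\<xi> t. c n \<xi> t + v \<xi> t)"] ex obtain v where
    v: "\<And>n. good n (c n) (v n)" and cS: "\<And>n. c (Suc n) = (\<lambda>\<xi> t. c n \<xi> t + v n \<xi> t)" by blast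
  define w where "w = (\<lambda>n. case n of 0 \<Rightarrow> c0 | Suc m \<Rightarrow> v m)"
  have wS: "w (Suc n) = v n" and w0: "w 0 = c0" for n by (simp_all add: w_def)
  have pw: "psum w n = c n" for n
  proof (induction n)
    case 0
    then show ?case by (simp add: fun_eq_iff psum_def w0 c00)
  next
    case (Suc n)
    have "psum w (Suc n) = (\<lambda>\<xi> t. psum w n \<xi> t + w (Suc n) \<xi> t)" by (simp add: fun_eq_iff psum_def)
    then show ?case by (simp add: Suc wS cS)
  qed
  have sub: "supp (w i) \<subseteq> supp (c n)" if "i \<le> n" for i n
    using that
  proof (induction n)
    case 0
    then show ?case by (simp add: w0 c00)
  next
    case (Suc n)
    have d: "supp (c n) \<inter> supp (v n) = {}" using v[of n] by (simp add: good_def)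
    have "\<xi> \<in> supp (c (Suc n))" if "\<xi> \<in> supp (c n)" for \<xi>
    proof -
      have "v n \<xi> t = 0" for t using d that by (intro not_supp) auto
      then show ?thesis using that by (simp add: cS supp_def)
    qed
    moreover have "\<xi> \<in> supp (c (Suc n))" if "\<xi> \<in> supp (v n)" for \<xi>
    proof -
      have "c n \<xi> t = 0" for t using d that by (intro not_supp) auto
      then show ?thesis using that by (simp add: cS supp_def)
    qed
    ultimately show ?case using Suc wS by (cases "i = Suc n") auto
  qed
  have dlt: "supp (w i) \<inter> supp (w j) = {}" if "i < j" for i j
  proof -
    obtain m where j: "j = Suc m" using \<open>i < j\<close> less_imp_Suc_add by blast
    have "supp (c m) \<inter> supp (v m) = {}" using v[of m] by (simp add: good_def)
    then show ?thesis using sub[of i m] that j wS by auto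
  qed
  have cont: "continuous_on {0..1} (R (c n) \<xi>)" for n \<xi>
    unfolding R_def using k by (intro flat_continuous resid_flat tc) auto
  define e where "e = (\<lambda>n \<xi>. supn (R (c n) \<xi>) * \<bar>of_int \<xi>\<bar> powr (-s))"
  have e0: "0 \<le> e n \<xi>" for n \<xi> unfolding e_def by (intro mult_nonneg_nonneg supn_nonneg cont) auto
  have e_sum: "(\<Sum>\<xi>\<in>F. e (Suc n) \<xi>) \<le> (\<Sum>\<xi>\<in>F. if \<bar>\<xi>\<bar> = fn n then 0 else e n \<xi>) + \<delta> n" if F: "finite F" "0 \<notin> F" for n F
  proof -
    let ?d = "\<lambda>\<xi> t. R (c (Suc n)) \<xi> t - (if \<bar>\<xi>\<bar> = fn n then 0 else R (c n) \<xi> t)"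
    have "(\<Sum>\<xi>\<in>F. e (Suc n) \<xi>) \<le> (\<Sum>\<xi>\<in>F. (if \<bar>\<xi>\<bar> = fn n then 0 else e n \<xi>) + supn (?d \<xi>) * \<bar>of_int \<xi>\<bar> powr (-s))"
    proof (rule sum_mono)
      fix \<xi>
      have "supn (R (c (Suc n)) \<xi>) = supn (\<lambda>t. (if \<bar>\<xi>\<bar> = fn n then 0 else R (c n) \<xi> t) + ?d \<xi> t)" by simp
      also have "\<dots> \<le> supn (\<lambda>t. if \<bar>\<xi>\<bar> = fn n then 0 else R (c n) \<xi> t) + supn (?d \<xi>)"
        by (intro supn_add; cases "\<bar>\<xi>\<bar> = fn n"; simp; intro continuous_intros cont)
      also have "supn (\<lambda>t. if \<bar>\<xi>\<bar> = fn n then 0 else R (c n) \<xi> t) = (if \<bar>\<xi>\<bar> = fn n then 0 else supn (R (c n) \<xi>))"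
        by simp
      finally have "supn (R (c (Suc n)) \<xi>) * \<bar>of_int \<xi>\<bar> powr (-s)
          \<le> ((if \<bar>\<xi>\<bar> = fn n then 0 else supn (R (c n) \<xi>)) + supn (?d \<xi>)) * \<bar>of_int \<xi>\<bar> powr (-s)"
        by (rule mult_right_mono) simp
      then show "e (Suc n) \<xi> \<le> (if \<bar>\<xi>\<bar> = fn n then 0 else e n \<xi>) + supn (?d \<xi>) * \<bar>of_int \<xi>\<bar> powr (-s)"
        by (cases "\<bar>\<xi>\<bar> = fn n") (simp_all add: e_def distrib_right)
    qed
    also have "\<dots> = (\<Sum>\<xi>\<in>F. if \<bar>\<xi>\<bar> = fn n then 0 else e n \<xi>) + (\<Sum>\<xi>\<in>F. supn (?d \<xi>) * \<bar>of_int \<xi>\<bar> powr (-s))"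
      by (rule sum.distrib)
    also have "(\<Sum>\<xi>\<in>F. supn (?d \<xi>) * \<bar>of_int \<xi>\<bar> powr (-s)) \<le> \<delta> n"
      using v[of n] F unfolding good_def cS by blast
    finally show ?thesis by simp
  qed
  obtain Y where Y: "finite Y" "\<And>\<xi>. \<xi> \<notin> Y \<Longrightarrow> R (c 0) \<xi> = (\<lambda>t. 0)"
    using resid_finite_support[OF tc[of 0]] unfolding R_def by metis
  define K0 where "K0 = mass k s (c 0) + (\<Sum>\<xi>\<in>Y. e 0 \<xi>)"
  \<comment> \<open>One step loses at most twice \<open>\<delta> n\<close>, that is 8^(-n)/4, which
    is less than 8^(-n) - 8^(-n-1). The last term on the right makes the bound inductive.\<close>
  have pot: "mass k s (c n) + (\<Sum>\<xi>\<in>F. e n \<xi>) \<le> K0 + 1 - (1/8) ^ n" if "finite F" "0 \<notin> F" for n F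
    using that
  proof (induction n arbitrary: F)
    case 0
    have "(\<Sum>\<xi>\<in>F. e 0 \<xi>) = (\<Sum>\<xi>\<in>F \<inter> Y. e 0 \<xi>)"
      using 0 Y by (intro sum.mono_neutral_right) (auto simp: e_def)
    also have "\<dots> \<le> (\<Sum>\<xi>\<in>Y. e 0 \<xi>)" using Y e0 by (intro sum_mono2) auto
    finally show ?case by (simp add: K0_def)
  next
    case (Suc n)
    let ?P = "{fn n, - fn n}"
    \<comment> \<open>The set is enlarged by the two modes about to be removed, so that the mass
      created can be charged to their terms in the potential.\<close>
    let ?F = "F \<union> ?P"
    have F: "finite ?F" "0 \<notin> ?F" using Suc.prems fn[of n] by auto
    have P: "fn n \<noteq> - fn n" using fn[of n] by linarith
    have m: "mass k s (c (Suc n)) \<le> mass k s (c n) + (e n (fn n) + e n (- fn n)) + \<delta> n"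
      using v[of n] fn[of n] unfolding good_def cS e_def by (simp add: distrib_right)
    have "(\<Sum>\<xi>\<in>F. e (Suc n) \<xi>) \<le> (\<Sum>\<xi>\<in>?F. e (Suc n) \<xi>)" using F e0 by (intro sum_mono2) auto
    also have "\<dots> \<le> (\<Sum>\<xi>\<in>?F. if \<bar>\<xi>\<bar> = fn n then 0 else e n \<xi>) + \<delta> n" by (rule e_sum[OF F])
    also have "(\<Sum>\<xi>\<in>?F. if \<bar>\<xi>\<bar> = fn n then 0 else e n \<xi>) = (\<Sum>\<xi>\<in>?F - ?P. e n \<xi>)"
    proof -
      have "(\<Sum>\<xi>\<in>?F. if \<bar>\<xi>\<bar> = fn n then 0 else e n \<xi>) = (\<Sum>\<xi>\<in>?F - ?P. if \<bar>\<xi>\<bar> = fn n then 0 else e n \<xi>)"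
        using F fn[of n] by (intro sum.mono_neutral_right) auto
      also have "\<dots> = (\<Sum>\<xi>\<in>?F - ?P. e n \<xi>)" by (intro sum.cong) (auto simp: abs_if split: if_splits)
      finally show ?thesis .
    qed
    finally have 1: "(\<Sum>\<xi>\<in>F. e (Suc n) \<xi>) \<le> (\<Sum>\<xi>\<in>?F - ?P. e n \<xi>) + \<delta> n" .
    have "(\<Sum>\<xi>\<in>?F. e n \<xi>) = (\<Sum>\<xi>\<in>?F - ?P. e n \<xi>) + (\<Sum>\<xi>\<in>?P. e n \<xi>)"
      using F by (intro sum.subset_diff) auto
    also have "(\<Sum>\<xi>\<in>?P. e n \<xi>) = e n (fn n) + e n (- fn n)" using P by simp
    finally have "mass k s (c (Suc n)) + (\<Sum>\<xi>\<in>F. e (Suc n) \<xi>) \<le> mass k s (c n) + (\<Sum>\<xi>\<in>?F. e n \<xi>) + 2 * \<delta> n"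
      using 1 m by linarith
    also have "\<dots> \<le> K0 + 1 - (1/8) ^ n + 2 * \<delta> n" using Suc.IH[OF F] by simp
    also have "\<dots> \<le> K0 + 1 - (1/8) ^ Suc n" by (simp add: \<delta>_def)
    finally show ?case .
  qed
  have mass0: "0 \<le> mass k s (c n)" for n
    unfolding mass_def by (intro sum_nonneg mult_nonneg_nonneg supn_nonneg tuple_continuous tc) auto
  have lim: "(\<lambda>n. supn (R (c n) \<xi>)) \<longlonglongrightarrow> 0" if \<xi>: "\<xi> \<noteq> 0" for \<xi>
  proof -
    \<comment> \<open>After a visit at step \<open>n0\<close>, the weighted residual of the mode
      consists of later errors only and is at most of order 8^(-n0); further visits only lower
      it.\<close>
    have dec: "e m \<xi> \<le> (1/8) ^ n0 - (1/8) ^ m" if "fn n0 = \<bar>\<xi>\<bar>" "Suc n0 \<le> m" for n0 m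
      using that(2)
    proof (induction m rule: dec_induct)
      case base
      have "0 \<le> (1/8 :: real) ^ n0" by simp
      moreover have "e (Suc n0) \<xi> \<le> (1/8) ^ Suc n0" using e_sum[of "{\<xi>}" n0] \<xi> that(1) by (simp add: \<delta>_def)
      ultimately show ?case unfolding power_Suc by linarith
    next
      case (step m)
      have "(if \<bar>\<xi>\<bar> = fn m then 0 else e m \<xi>) \<le> e m \<xi>" using e0 by simp
      moreover have "e (Suc m) \<xi> \<le> (if \<bar>\<xi>\<bar> = fn m then 0 else e m \<xi>) + (1/8) ^ Suc m"
        using e_sum[of "{\<xi>}" m] \<xi> unfolding \<delta>_def by simp
      moreover have "0 \<le> (1/8 :: real) ^ m" by simp
      ultimately show ?case using step.IH unfolding power_Suc by linarith
    qed
    have "(\<lambda>n. e n \<xi>) \<longlonglongrightarrow> 0"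
    proof (rule LIMSEQ_I)
      fix r :: real assume r: "r > 0"
      have "(\<lambda>n. (1/8 :: real) ^ n) \<longlonglongrightarrow> 0" by (rule LIMSEQ_realpow_zero) auto
      then obtain j where j: "\<And>n. n \<ge> j \<Longrightarrow> (1/8 :: real) ^ n < r" using LIMSEQ_D[OF _ r] by force
      obtain n0 where n0: "n0 \<ge> j" "fn n0 = \<bar>\<xi>\<bar>" using fn_inf[OF \<xi>] by blast
      have "norm (e m \<xi> - 0) < r" if "m \<ge> Suc n0" for m
      proof -
        have "e m \<xi> \<le> (1/8) ^ n0 - (1/8) ^ m" using dec n0 that by blast
        also have "\<dots> < r" using j[OF n0(1)] by (smt (verit) zero_le_power divide_nonneg_nonneg)
        finally show ?thesis using e0[of m \<xi>] by simp
      qed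
      then show "\<exists>no. \<forall>n\<ge>no. norm (e n \<xi> - 0) < r" by blast
    qed
    then have "(\<lambda>n. e n \<xi> * \<bar>of_int \<xi>\<bar> powr s) \<longlonglongrightarrow> 0 * \<bar>of_int \<xi>\<bar> powr s" by (intro tendsto_intros)
    moreover have "e n \<xi> * \<bar>of_int \<xi>\<bar> powr s = supn (R (c n) \<xi>)" for n
      using \<xi> by (simp add: e_def mult.assoc flip: powr_add)
    ultimately show ?thesis by simp
  qed
  have "cascade \<sigma> s (K0 + 1) k w"
  proof
    show "tpoly (w n)" for n using v c0 by (cases n) (auto simp: w_def good_def)
    show "supp (w i) \<inter> supp (w j) = {}" if "i \<noteq> j" for i j
      using dlt[of i j] dlt[of j i] that by (cases "i < j") auto
    show "int n \<le> \<bar>\<xi>\<bar>" if "\<xi> \<in> supp (w n)" for \<xi> n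
      using that v by (cases n) (force simp: w_def good_def)+
    show "tpoly (psum w n)" for n by (simp add: pw tc)
    show "mass k s (psum w n) \<le> K0 + 1" for n using pot[of "{}" n] unfolding pw by (smt (verit) finite.emptyI empty_iff sum.empty zero_le_power divide_nonneg_nonneg)
    show "(\<Sum>\<xi>\<in>F. supn (resid \<sigma> k (psum w n) \<xi>) * \<bar>of_int \<xi>\<bar> powr (-s)) \<le> K0 + 1" if "finite F" "0 \<notin> F" for F n
      using pot[OF that, of n] mass0[of n] unfolding pw e_def R_def by (smt (verit) zero_le_power divide_nonneg_nonneg)
    show "(\<lambda>n. supn (resid \<sigma> k (psum w n) \<xi>)) \<longlonglongrightarrow> 0" if "\<xi> \<noteq> 0" for \<xi>
      using lim[OF that] by (simp add: pw R_def)
    show "(LINT x|lebesgue_on {0..1}. \<bar>val (w n) t x\<bar> powr q) \<le> (1/8) ^ n"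
      if "n > 0" "t \<in> {0..1}" "1 \<le> q" "q \<le> 2 - 1 / real (Suc n)" for n t q
    proof -
      obtain m where n: "n = Suc m" using \<open>n > 0\<close> gr0_implies_Suc by blast
      show ?thesis using v[of m] that unfolding good_def n wS \<delta>_def by blast
    qed
    show "(\<Sum>\<xi>\<in>supp (w n). (1 + (of_int \<xi>)\<^sup>2) powr (1/2 - 1/real k - 1 / real (Suc n)) * (supn (w n \<xi>))\<^sup>2) \<le> (1/8) ^ n"
      if "n > 0" for n
    proof -
      obtain m where n: "n = Suc m" using \<open>n > 0\<close> gr0_implies_Suc by blast
      show ?thesis using v[of m] unfolding good_def n wS \<delta>_def by blast
    qed
    show "w 0 1 1 \<noteq> 0" by (simp add: w0 c0_def bump_def)
  qed (rule k)
  then show ?thesis by (rule that)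
qed

subsection \<open>Convergence of series\<close>

lemma continuous_on_suminf:
  fixes h :: "nat \<Rightarrow> 'a::topological_space \<Rightarrow> real"
  assumes "\<And>n. continuous_on S (h n)" "\<And>n t. t \<in> S \<Longrightarrow> norm (h n t) \<le> B n" "summable B"
  shows "continuous_on S (\<lambda>t. \<Sum>n. h n t)"
proof (rule uniform_limit_theorem[OF _ Weierstrass_m_test[of S h B]])
  show "\<forall>\<^sub>F n in sequentially. continuous_on S (\<lambda>t. \<Sum>i<n. h i t)"
    by (intro always_eventually allI continuous_on_sum assms)
qed (use assms in auto)

lemma continuous_on_infsum:
  fixes h :: "'b \<Rightarrow> 'a::topological_space \<Rightarrow> real"
  assumes "\<And>n. continuous_on S (h n)" "\<And>n t. t \<in> S \<Longrightarrow> norm (h n t) \<le> B n" "B summable_on UNIV"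
  shows "continuous_on S (\<lambda>t. \<Sum>\<^sub>\<infinity>n. h n t)"
proof (rule uniform_limit_theorem[OF _ Weierstrass_m_test_general[of UNIV S h B]])
  show "\<forall>\<^sub>F X in finite_subsets_at_top UNIV. continuous_on S (\<lambda>t. \<Sum>i\<in>X. h i t)"
    by (intro always_eventually allI continuous_on_sum assms)
qed (use assms in auto)

text \<open>A pointwise substitute for Minkowski's inequality. If S denotes the weighted sum, then
  2^(n+1) y_n <= S^(1/p) for every n, because (2^(n+1))^p <= 4^(n+1) for p <= 2; and the numbers
  2^(-(n+1)) add up to 1.\<close>

lemma suminf_powr_le:
  fixes y :: "nat \<Rightarrow> real"
  assumes p: "1 \<le> p" "p \<le> 2" and y: "\<And>n. 0 \<le> y n" and S: "summable (\<lambda>n. 4 ^ Suc n * y n powr p)"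
  shows "summable y" "(\<Sum>n. y n) powr p \<le> (\<Sum>n. 4 ^ Suc n * y n powr p)"
proof -
  define S where "S = (\<Sum>n. 4 ^ Suc n * y n powr p)"
  have S0: "0 \<le> S" unfolding S_def using assms(4) by (intro suminf_nonneg) auto
  have le: "y n \<le> S powr (1/p) * (1/2) ^ Suc n" for n
  proof -
    have "(2 ^ Suc n * y n) powr p = (2 ^ Suc n) powr p * y n powr p" using y by (simp add: powr_mult)
    also have "\<dots> \<le> 4 ^ Suc n * y n powr p"
    proof (rule mult_right_mono)
      have "(2 ^ Suc n :: real) powr p \<le> (2 ^ Suc n) powr 2" using p by (intro powr_mono one_le_power) auto
      also have "\<dots> = (2 ^ Suc n :: real) ^ 2" by simp
      also have "\<dots> = (2\<^sup>2) ^ Suc n" by (simp only: power_mult[symmetric] mult.commute)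
      also have "\<dots> = 4 ^ Suc n" by simp
      finally show "(2 ^ Suc n :: real) powr p \<le> 4 ^ Suc n" .
    qed simp
    also have "\<dots> \<le> S"
      unfolding S_def using sum_le_suminf[OF assms(4), of "{n}"] by simp
    finally have "((2 ^ Suc n * y n) powr p) powr (1/p) \<le> S powr (1/p)" using p by (intro powr_mono2) auto
    then have "2 ^ Suc n * y n \<le> S powr (1/p)" using p y by (simp add: powr_powr)
    moreover have "z \<le> X * (1 / q)" if "q * z \<le> X" "0 < q" for q z X :: real
      using that by (simp add: field_simps)
    ultimately have "y n \<le> S powr (1/p) * (1 / 2 ^ Suc n)" by simp
    then show ?thesis by (simp only: power_one_over)
  qed
  have geo: "(\<lambda>n. S powr (1/p) * (1/2) ^ Suc n) sums (S powr (1/p) * 1)" by (intro sums_mult power_half_series)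
  show sy: "summable y"
    by (rule summable_comparison_test'[OF sums_summable[OF geo], of 0]) (use le y in auto)
  have "(\<Sum>n. y n) \<le> S powr (1/p)"
    using suminf_le[OF le sy sums_summable[OF geo]] sums_unique[OF geo] by simp
  then have "(\<Sum>n. y n) powr p \<le> (S powr (1/p)) powr p"
    using p y by (intro powr_mono2 suminf_nonneg sy) auto
  also have "\<dots> = S" using p S0 by (simp add: powr_powr)
  finally show "(\<Sum>n. y n) powr p \<le> (\<Sum>n. 4 ^ Suc n * y n powr p)" by (simp add: S_def)
qed

lemma measurable_abs_powr:
  fixes g :: "'a \<Rightarrow> real"
  assumes "g \<in> borel_measurable M"
  shows "(\<lambda>x. \<bar>g x\<bar> powr p) \<in> borel_measurable M"
  using assms by measurable

text \<open>The pointwise inequality is integrated term by term. The weighted series has finite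
  integral, hence is finite almost everywhere, and then serves both for convergence and as a
  majorant.\<close>

lemma Lp_series:
  fixes g :: "nat \<Rightarrow> 'a \<Rightarrow> real"
  assumes p: "1 \<le> p" "p \<le> 2" and int: "\<And>n. integrable M (\<lambda>x. \<bar>g n x\<bar> powr p)"
    and meas: "\<And>n. g n \<in> borel_measurable M" and B: "\<And>n. 4 ^ Suc n * (LINT x|M. \<bar>g n x\<bar> powr p) \<le> B n" and sB: "summable B"
  shows "AE x in M. summable (\<lambda>n. \<bar>g n x\<bar>)" "integrable M (\<lambda>x. \<bar>\<Sum>n. g n x\<bar> powr p)"
    "(LINT x|M. \<bar>\<Sum>n. g n x\<bar> powr p) \<le> suminf B"
proof -
  let ?h = "\<lambda>n x. 4 ^ Suc n * \<bar>g n x\<bar> powr p"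
  have hint: "integrable M (?h n)" for n using int by simp
  have h0: "0 \<le> ?h n x" for n x by simp
  have Ih: "(LINT x|M. ?h n x) \<le> B n" for n using B[of n] by simp
  have Ih0: "0 \<le> (LINT x|M. ?h n x)" for n by (intro integral_nonneg_AE) auto
  have sI: "summable (\<lambda>n. LINT x|M. ?h n x)"
    by (rule summable_comparison_test'[OF sB, of 0]) (use Ih Ih0 in auto)
  have "(\<integral>\<^sup>+x. (\<Sum>n. ennreal (?h n x)) \<partial>M) = (\<Sum>n. \<integral>\<^sup>+x. ennreal (?h n x) \<partial>M)"
    using hint by (intro nn_integral_suminf) auto
  also have "\<dots> = (\<Sum>n. ennreal (LINT x|M. ?h n x))"
    using hint by (intro suminf_cong nn_integral_eq_integral) auto
  also have "\<dots> \<noteq> \<infinity>" using ennreal_suminf_neq_top[OF sI Ih0] by simp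
  finally have "AE x in M. (\<Sum>n. ennreal (?h n x)) \<noteq> \<infinity>"
    using hint by (intro nn_integral_PInf_AE) auto
  then have AEs: "AE x in M. summable (\<lambda>n. ?h n x)"
    by eventually_elim (rule summable_suminf_not_top; simp)
  show AEg: "AE x in M. summable (\<lambda>n. \<bar>g n x\<bar>)"
    using AEs by eventually_elim (rule suminf_powr_le(1)[OF p]; simp)
  have Fint: "integrable M (\<lambda>x. \<Sum>n. ?h n x)" and FI: "(LINT x|M. (\<Sum>n. ?h n x)) = (\<Sum>n. (LINT x|M. ?h n x))"
  proof -
    have nh: "norm (?h n x) = ?h n x" for n x by simp
    have s: "AE x in M. summable (\<lambda>n. norm (?h n x))" "summable (\<lambda>n. LINT x|M. norm (?h n x))"
      unfolding nh by (fact AEs, fact sI)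
    show "integrable M (\<lambda>x. \<Sum>n. ?h n x)" by (rule integrable_suminf[OF hint s])
    show "(LINT x|M. (\<Sum>n. ?h n x)) = (\<Sum>n. (LINT x|M. ?h n x))" by (rule integral_suminf[OF hint s])
  qed
  have bnd: "AE x in M. \<bar>\<Sum>n. g n x\<bar> powr p \<le> (\<Sum>n. ?h n x)"
    using AEs AEg
  proof eventually_elim
    case (elim x)
    have "\<bar>\<Sum>n. g n x\<bar> \<le> (\<Sum>n. \<bar>g n x\<bar>)" using summable_norm[of "\<lambda>n. g n x"] elim by simp
    then have "\<bar>\<Sum>n. g n x\<bar> powr p \<le> (\<Sum>n. \<bar>g n x\<bar>) powr p" using p by (intro powr_mono2) auto
    also have "\<dots> \<le> (\<Sum>n. ?h n x)" using elim by (intro suminf_powr_le(2)[OF p]) auto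
    finally show ?case .
  qed
  show fint: "integrable M (\<lambda>x. \<bar>\<Sum>n. g n x\<bar> powr p)"
  proof (rule Bochner_Integration.integrable_bound[OF Fint])
    show "(\<lambda>x. \<bar>\<Sum>n. g n x\<bar> powr p) \<in> borel_measurable M" using meas by measurable
    show "AE x in M. norm (\<bar>\<Sum>n. g n x\<bar> powr p) \<le> norm (\<Sum>n. ?h n x)" using bnd by eventually_elim auto
  qed
  have "(LINT x|M. \<bar>\<Sum>n. g n x\<bar> powr p) \<le> (LINT x|M. (\<Sum>n. ?h n x))" by (rule integral_mono_AE[OF fint Fint bnd])
  also have "\<dots> \<le> suminf B" unfolding FI by (intro suminf_le Ih sI sB)
  finally show "(LINT x|M. \<bar>\<Sum>n. g n x\<bar> powr p) \<le> suminf B" .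
qed

section \<open>Integrable functions as distributions\<close>

lemma test_funD:
  assumes "\<phi> \<in> test_fun"
  shows "continuous_on S \<phi>"
proof -
  have "C_n 0 \<phi>" using assms by (auto simp: test_fun_def smooth_def)
  then show ?thesis by (auto intro: continuous_on_subset)
qed

lemma dist_of_fun_distribution:
  assumes g: "integrable (lebesgue_on {0..1}) g"
  shows "distribution (dist_of_fun (\<lambda>x. complex_of_real (g x)))"
proof -
  let ?M = "lebesgue_on {0..1::real}"
  have prod: "integrable ?M (\<lambda>x. complex_of_real (g x) * \<phi> x)" if ct: "continuous_on {0..1} \<phi>" for \<phi>
  proof -
    obtain C where C: "\<And>x. x \<in> {0..1} \<Longrightarrow> norm (\<phi> x) \<le> C"
      using compact_continuous_image[OF ct compact_Icc] compact_imp_bounded bounded_iff by (metis imageI)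
    show ?thesis
    proof (rule Bochner_Integration.integrable_bound[of ?M "\<lambda>x. C * g x"])
      show "integrable ?M (\<lambda>x. C * g x)" using g by simp
      have "\<phi> \<in> borel_measurable ?M" using LINT_eq_integral(1)[OF ct] by auto
      then show "(\<lambda>x. complex_of_real (g x) * \<phi> x) \<in> borel_measurable ?M" using g by measurable
      have "norm (complex_of_real (g x) * \<phi> x) \<le> norm (C * g x)" if "x \<in> {0..1}" for x
        using mult_left_mono[OF C[OF that], of "\<bar>g x\<bar>"] order_trans[OF norm_ge_zero C[OF that]]
        by (simp add: norm_mult abs_mult mult.commute)
      then show "AE x in ?M. norm (complex_of_real (g x) * \<phi> x) \<le> norm (C * g x)"
        by (intro AE_I2) simp
    qed
  qed
  have lin: "dist_of_fun (\<lambda>x. complex_of_real (g x)) (\<lambda>x. a * \<phi> x + b * \<psi> x)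
      = a * dist_of_fun (\<lambda>x. complex_of_real (g x)) \<phi> + b * dist_of_fun (\<lambda>x. complex_of_real (g x)) \<psi>"
    if "\<phi> \<in> test_fun" "\<psi> \<in> test_fun" for \<phi> \<psi> a b
  proof -
    have "(\<lambda>x. complex_of_real (g x) * (a * \<phi> x + b * \<psi> x))
       = (\<lambda>x. a * (complex_of_real (g x) * \<phi> x) + b * (complex_of_real (g x) * \<psi> x))"
      by (simp add: fun_eq_iff algebra_simps)
    then show ?thesis
      unfolding dist_of_fun_def using prod[OF test_funD[OF that(1)]] prod[OF test_funD[OF that(2)]] by simp
  qed
  have "norm (dist_of_fun (\<lambda>x. complex_of_real (g x)) \<phi>) \<le> (LINT x|?M. \<bar>g x\<bar>) * (\<Sum>j\<le>0. SUP x\<in>{0..1}. norm ((D ^^ j) \<phi> x))"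
    if "\<phi> \<in> test_fun" for \<phi>
  proof -
    let ?S = "SUP x\<in>{0..1}. norm (\<phi> x)"
    have S: "norm (\<phi> x) \<le> ?S" if "x \<in> {0..1}" for x
    proof (rule cSUP_upper[OF that])
      have "compact ((\<lambda>x. norm (\<phi> x)) ` {0..1})"
        by (intro compact_continuous_image continuous_intros test_funD \<open>\<phi> \<in> test_fun\<close>) auto
      then show "bdd_above ((\<lambda>x. norm (\<phi> x)) ` {0..1})" by (simp add: bounded_imp_bdd_above compact_imp_bounded)
    qed
    have "norm (dist_of_fun (\<lambda>x. complex_of_real (g x)) \<phi>) \<le> (LINT x|?M. norm (complex_of_real (g x) * \<phi> x))"
      unfolding dist_of_fun_def by (rule integral_norm_bound)
    also have "\<dots> \<le> (LINT x|?M. ?S * \<bar>g x\<bar>)"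
    proof (rule integral_mono)
      show "integrable ?M (\<lambda>x. norm (complex_of_real (g x) * \<phi> x))" using prod[OF test_funD[OF that]] by (rule integrable_norm)
      show "integrable ?M (\<lambda>x. ?S * \<bar>g x\<bar>)" using g by simp
      show "norm (complex_of_real (g x) * \<phi> x) \<le> ?S * \<bar>g x\<bar>" if "x \<in> space ?M" for x
        using mult_right_mono[OF S, of x "\<bar>g x\<bar>"] that by (simp add: norm_mult mult.commute)
    qed
    finally show ?thesis by (simp add: mult.commute)
  qed
  then show ?thesis unfolding distribution_def using lin by blast
qed

context cascade
begin

subsection \<open>The limit of the cascade\<close>

text \<open>By \<open>far\<close>, packets of index above |xi| do not contain the mode, so this
  partial sum already is the limit.\<close>

definition sol_coeff :: "int \<Rightarrow> real \<Rightarrow> complex" where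
  "sol_coeff \<xi> t = psum w (nat \<bar>\<xi>\<bar>) \<xi> t"

text \<open>For each time in [0,1] the series converges for almost every \<open>x\<close>
  (\<open>sol_summable\<close>); on the remaining null set its value does not matter.\<close>

definition sol :: "real \<Rightarrow> real \<Rightarrow> real" where
  "sol t x = (\<Sum>n. val (w n) t x)"

lemma psum_single:
  assumes "\<xi> \<in> supp (w i)" "i \<le> n"
  shows "psum w n \<xi> = w i \<xi>"
proof
  fix t
  have "w j \<xi> t = 0" if "j \<noteq> i" for j using disj[OF that] assms(1) by (intro not_supp) auto
  then show "psum w n \<xi> t = w i \<xi> t"
    unfolding psum_def using assms(2) by (subst sum.remove[of _ i]) (auto intro!: sum.neutral)
qed

lemma coeff_w: "\<xi> \<in> supp (w i) \<Longrightarrow> sol_coeff \<xi> = w i \<xi>"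
  using psum_single[of \<xi> i "nat \<bar>\<xi>\<bar>"] far[of \<xi> i] by (auto simp: sol_coeff_def[abs_def])

lemma psum_supp: "\<xi> \<in> supp (psum w n) \<Longrightarrow> \<exists>i\<le>n. \<xi> \<in> supp (w i)"
proof (rule ccontr)
  assume "\<xi> \<in> supp (psum w n)" and "\<not> (\<exists>i\<le>n. \<xi> \<in> supp (w i))"
  then have "psum w n \<xi> t = 0" for t unfolding psum_def by (intro sum.neutral) (auto intro: not_supp)
  then show False using \<open>\<xi> \<in> supp (psum w n)\<close> by (simp add: supp_def)
qed

lemma psum_coeff: "\<xi> \<in> supp (psum w n) \<Longrightarrow> psum w n \<xi> = sol_coeff \<xi>"
  using psum_supp psum_single coeff_w by metis

lemma psum_eventually: "\<bar>\<xi>\<bar> \<le> int n \<Longrightarrow> psum w n \<xi> = sol_coeff \<xi>"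
proof (cases "\<exists>i. \<xi> \<in> supp (w i)")
  case True
  assume "\<bar>\<xi>\<bar> \<le> int n"
  moreover obtain i where "\<xi> \<in> supp (w i)" using True by blast
  ultimately show ?thesis using psum_single[of \<xi> i n] coeff_w[of \<xi> i] far[of \<xi> i] by simp
next
  case False
  then have "psum w m \<xi> t = 0" for m t using psum_supp by (intro not_supp) blast
  then show ?thesis by (simp add: sol_coeff_def fun_eq_iff)
qed

lemma coeff_flat: "sol_coeff \<xi> \<in> flat"
  using tpolyD(3)[OF psum] by (simp add: sol_coeff_def[abs_def])

lemma coeff_continuous: "continuous_on S (sol_coeff \<xi>)"
  by (rule flat_continuous[OF coeff_flat])

lemma val_psum: "val (psum w n) t x = (\<Sum>i\<le>n. val (w i) t x)"
proof -
  let ?X = "\<Union>i\<le>n. supp (w i)"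
  have fin: "finite ?X" using tpolyD(1)[OF w] by auto
  have "complex_of_real (val (psum w n) t x) = (\<Sum>\<xi>\<in>?X. psum w n \<xi> t * expi \<xi> x)"
    using psum_supp by (intro of_real_val psum fin) blast
  also have "\<dots> = (\<Sum>i\<le>n. \<Sum>\<xi>\<in>?X. w i \<xi> t * expi \<xi> x)"
    unfolding psum_def sum_distrib_right by (rule sum.swap)
  also have "\<dots> = (\<Sum>i\<le>n. complex_of_real (val (w i) t x))"
    using fin by (intro sum.cong refl of_real_val[symmetric] w) auto
  also have "\<dots> = complex_of_real (\<Sum>i\<le>n. val (w i) t x)" by simp
  finally show ?thesis by (simp only: of_real_eq_iff)
qed

definition wmax :: "nat \<Rightarrow> real" where
  "wmax n = (\<Sum>\<xi>\<in>supp (w n). supn (w n \<xi>))"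

lemma w_continuous: "continuous_on S (w n \<xi>)"
  by (rule flat_continuous[OF tpolyD(3)[OF w]])

lemma wmax_nonneg: "0 \<le> wmax n"
  unfolding wmax_def by (intro sum_nonneg supn_nonneg w_continuous)

lemma val_w_le: "t \<in> {0..1} \<Longrightarrow> \<bar>val (w n) t x\<bar> \<le> wmax n"
proof -
  assume t: "t \<in> {0..1}"
  have "\<bar>val (w n) t x\<bar> = norm (\<Sum>\<xi>\<in>supp (w n). w n \<xi> t * expi \<xi> x)"
    using of_real_val[OF w[of n] tpolyD(1)[OF w[of n]] order_refl, of t x] by (metis norm_of_real)
  also have "\<dots> \<le> wmax n"
    unfolding wmax_def
    by (rule order_trans[OF norm_sum sum_mono]) (simp add: norm_mult supn_ge[OF w_continuous t])
  finally show ?thesis .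
qed

lemma val_w_diff_le: "\<bar>val (w n) t x - val (w n) t0 x\<bar> \<le> (\<Sum>\<xi>\<in>supp (w n). norm (w n \<xi> t - w n \<xi> t0))"
proof -
  have "complex_of_real (val (w n) t x - val (w n) t0 x) = (\<Sum>\<xi>\<in>supp (w n). (w n \<xi> t - w n \<xi> t0) * expi \<xi> x)"
    using of_real_val[OF w[of n] tpolyD(1)[OF w[of n]] order_refl, of _ x]
    by (simp add: sum_subtractf left_diff_distrib)
  then have "\<bar>val (w n) t x - val (w n) t0 x\<bar> = norm (\<Sum>\<xi>\<in>supp (w n). (w n \<xi> t - w n \<xi> t0) * expi \<xi> x)"
    by (metis norm_of_real)
  also have "\<dots> \<le> (\<Sum>\<xi>\<in>supp (w n). norm (w n \<xi> t - w n \<xi> t0))"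
    by (rule order_trans[OF norm_sum]) (simp add: norm_mult)
  finally show ?thesis .
qed

lemma cont_powr_int:
  fixes g :: "real \<Rightarrow> real"
  assumes "continuous_on {0..1} g" "p \<ge> 1"
  shows "integrable (lebesgue_on {0..1}) (\<lambda>x::real. \<bar>g x\<bar> powr p)"
  using assms by (intro LINT_eq_integral(1) continuous_on_powr' continuous_intros) auto

lemma LINT_le_const:
  fixes g :: "real \<Rightarrow> real"
  assumes "continuous_on {0..1} g" "\<And>x. x \<in> {0..1} \<Longrightarrow> g x \<le> C"
  shows "(LINT x|lebesgue_on {0..1}. g x) \<le> C"
proof -
  have "(LINT x|lebesgue_on {0..1}. g x) \<le> (LINT x|lebesgue_on {0..1::real}. C)"
    using assms by (intro integral_mono LINT_eq_integral continuous_intros) auto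
  then show ?thesis by (simp add: measure_restrict_space)
qed

text \<open>For \<open>p < 2\<close>, the crude second case concerns finitely many \<open>n\<close> only.\<close>

definition maj :: "real \<Rightarrow> nat \<Rightarrow> real" where
  "maj p n = (if n > 0 \<and> p \<le> 2 - 1 / real (Suc n) then 32 * (1/2) ^ n else 4 ^ Suc n * (2 * wmax n) powr p)"

lemma summable_maj: "p < 2 \<Longrightarrow> summable (maj p)"
proof -
  assume p: "p < 2"
  have "(\<lambda>n. 1 / real (Suc n)) \<longlonglongrightarrow> 0" by (rule LIMSEQ_Suc[OF lim_1_over_n])
  then have "\<forall>\<^sub>F n in sequentially. 1 / real (Suc n) < 2 - p" by (rule order_tendstoD) (use p in simp)
  then have "\<forall>\<^sub>F n in sequentially. maj p n = 32 * (1/2) ^ n"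
    using eventually_gt_at_top[of 0] by eventually_elim (auto simp: maj_def)
  then show ?thesis by (subst summable_cong) (auto intro!: summable_mult summable_geometric)
qed

lemma Lq_maj:
  assumes t: "t \<in> {0..1}" "t0 \<in> {0..1}" and p: "1 \<le> p" "p < 2"
  shows "4 ^ Suc n * (LINT x|lebesgue_on {0..1}. \<bar>val (w n) t x\<bar> powr p) \<le> maj p n"
    and "4 ^ Suc n * (LINT x|lebesgue_on {0..1}. \<bar>val (w n) t x - val (w n) t0 x\<bar> powr p) \<le> maj p n"
proof -
  let ?I = "\<lambda>g. LINT x|lebesgue_on {0..1::real}. \<bar>g x\<bar> powr p :: real"
  have c: "continuous_on {0..1} (\<lambda>x. \<bar>val (w n) t x - val (w n) t0 x\<bar> powr p)"
    "continuous_on {0..1} (\<lambda>x. \<bar>val (w n) t x\<bar> powr p)" for t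
    using p by (intro continuous_on_powr' continuous_intros val_continuous; simp)+
  have "?I (val (w n) t) \<le> (if n > 0 \<and> p \<le> 2 - 1 / real (Suc n) then (1/8) ^ n else (2 * wmax n) powr p)
     \<and> ?I (\<lambda>x. val (w n) t x - val (w n) t0 x) \<le> (if n > 0 \<and> p \<le> 2 - 1 / real (Suc n) then 8 * (1/8) ^ n else (2 * wmax n) powr p)"
  proof (cases "n > 0 \<and> p \<le> 2 - 1 / real (Suc n)")
    case True
    have L: "?I (val (w n) t) \<le> (1/8) ^ n" if "t \<in> {0..1}" for t using Lq[OF _ that] True p by auto
    \<comment> \<open>A crude triangle inequality, using 2^p <= 4. It turns 8^(-n) into 8 times
      8^(-n), and multiplication by 4^(n+1) gives the 32 (1/2)^n in \<open>maj\<close>.\<close>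
    have pw: "\<bar>a - b\<bar> powr p \<le> 4 * (\<bar>a\<bar> powr p + \<bar>b\<bar> powr p)" for a b :: real
    proof -
      have "\<bar>a - b\<bar> powr p \<le> (2 * max \<bar>a\<bar> \<bar>b\<bar>) powr p" using p by (intro powr_mono2) auto
      also have "\<dots> = 2 powr p * (max \<bar>a\<bar> \<bar>b\<bar>) powr p" by (subst powr_mult) auto
      also have "\<dots> \<le> 4 * (\<bar>a\<bar> powr p + \<bar>b\<bar> powr p)"
      proof (rule mult_mono)
        have "2 powr p \<le> 2 powr (2::real)" using p by (intro powr_mono) auto
        then show "2 powr p \<le> 4" by simp
        show "(max \<bar>a\<bar> \<bar>b\<bar>) powr p \<le> \<bar>a\<bar> powr p + \<bar>b\<bar> powr p" by (auto simp: max_def)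
      qed auto
      finally show ?thesis .
    qed
    have "?I (\<lambda>x. val (w n) t x - val (w n) t0 x)
       \<le> (LINT x|lebesgue_on {0..1}. 4 * (\<bar>val (w n) t x\<bar> powr p + \<bar>val (w n) t0 x\<bar> powr p))"
      by (intro integral_mono pw LINT_eq_integral continuous_intros c)
    also have "\<dots> = 4 * (?I (val (w n) t) + ?I (val (w n) t0))"
      using LINT_eq_integral(1)[OF c(2)] by simp
    also have "\<dots> \<le> 4 * ((1/8) ^ n + (1/8) ^ n)" by (intro mult_left_mono add_mono L t) auto
    finally show ?thesis using True L[OF t(1)] by simp
  next
    case False
    have "?I (val (w n) t) \<le> (2 * wmax n) powr p"
    proof (intro LINT_le_const c powr_mono2)
      show "\<bar>val (w n) t x\<bar> \<le> 2 * wmax n" for x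
        using val_w_le[OF t(1), of n x] wmax_nonneg[of n] by linarith
    qed (use p in auto)
    moreover have "?I (\<lambda>x. val (w n) t x - val (w n) t0 x) \<le> (2 * wmax n) powr p"
    proof (intro LINT_le_const c powr_mono2)
      show "\<bar>val (w n) t x - val (w n) t0 x\<bar> \<le> 2 * wmax n" for x
        using val_w_le[OF t(1), of n x] val_w_le[OF t(2), of n x] by linarith
    qed (use p in auto)
    ultimately show ?thesis unfolding if_not_P[OF False] by blast
  qed
  then have 1: "4 ^ Suc n * ?I (val (w n) t) \<le> 4 ^ Suc n * (if n > 0 \<and> p \<le> 2 - 1 / real (Suc n) then (1/8) ^ n else (2 * wmax n) powr p)"
    and 2: "4 ^ Suc n * ?I (\<lambda>x. val (w n) t x - val (w n) t0 x) \<le> 4 ^ Suc n * (if n > 0 \<and> p \<le> 2 - 1 / real (Suc n) then 8 * (1/8) ^ n else (2 * wmax n) powr p)"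
    by (intro mult_left_mono; simp)+
  have e: "(4::real) ^ Suc n * (8 * (1/8) ^ n) = 32 * (1/2) ^ n" "(4::real) ^ Suc n * (1/8) ^ n \<le> 32 * (1/2) ^ n"
    by (simp_all add: power_divide power_mult_distrib[symmetric] field_simps)
  show "4 ^ Suc n * ?I (val (w n) t) \<le> maj p n" by (rule order_trans[OF 1]) (use e in \<open>auto simp: maj_def\<close>)
  show "4 ^ Suc n * ?I (\<lambda>x. val (w n) t x - val (w n) t0 x) \<le> maj p n" by (rule order_trans[OF 2]) (use e in \<open>auto simp: maj_def\<close>)
qed

lemma val_w_measurable: "val (w n) t \<in> borel_measurable (lebesgue_on {0..1})"
  using LINT_eq_integral(1)[OF val_continuous[of "{0..1}" "w n" t]] by auto

lemma sol_summable: "t \<in> {0..1} \<Longrightarrow> AE x in lebesgue_on {0..1}. summable (\<lambda>n. \<bar>val (w n) t x\<bar>)"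
  by (rule Lp_series(1)[where p = 1, OF _ _ cont_powr_int[OF val_continuous] val_w_measurable Lq_maj(1) summable_maj]) auto

lemma sol_Lp:
  assumes "t \<in> {0..1}" "1 \<le> p" "p < 2"
  shows "integrable (lebesgue_on {0..1}) (\<lambda>x. \<bar>sol t x\<bar> powr p)"
  unfolding sol_def
  by (rule Lp_series(2)[OF _ _ cont_powr_int[OF val_continuous] val_w_measurable Lq_maj(1) summable_maj]) (use assms in auto)

lemma sol_measurable: "sol t \<in> borel_measurable (lebesgue_on {0..1})"
  unfolding sol_def[abs_def] using val_w_measurable by measurable

lemma sol_integrable: "t \<in> {0..1} \<Longrightarrow> integrable (lebesgue_on {0..1}) (sol t)"
  using sol_Lp[of t 1] sol_measurable[of t] integrable_abs_iff[of "sol t"] by simp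

lemma sol_0: "sol 0 x = 0"
proof -
  have "val (w n) 0 x = 0" for n
    using flat_nonpos[OF tpolyD(3)[OF w]] by (simp add: val_def)
  then show ?thesis by (simp add: sol_def)
qed

lemma sol_Ct_Lp:
  assumes p: "1 \<le> p" "p < 2"
  shows "Ct_Lp p sol"
  unfolding Ct_Lp_def
proof (intro conjI ballI)
  fix t :: real assume "t \<in> {0..1}"
  then show "sol t \<in> Lp p" unfolding Lp_def using sol_Lp p sol_measurable by auto
next
  fix t0 :: real assume t0: "t0 \<in> {0..1}"
  \<comment> \<open>The first entry makes the series over \<open>n\<close> uniformly summable; the
    second makes each term continuous in \<open>t\<close> with value 0 at \<open>t0\<close>. The
    n-th contribution to the difference lies below both, by \<open>Lq_maj\<close> and
    \<open>val_w_diff_le\<close>.\<close>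
  define h where "h = (\<lambda>n t. min (maj p n) (4 ^ Suc n * (\<Sum>\<xi>\<in>supp (w n). norm (w n \<xi> t - w n \<xi> t0)) powr p))"
  have h0: "0 \<le> h n t" for n t by (simp add: h_def maj_def)
  have hcont: "continuous_on {0..1} (h n)" for n
    unfolding h_def using p by (intro continuous_intros continuous_on_powr' w_continuous) (auto intro!: sum_nonneg)
  have hm: "h n t \<le> maj p n" for n t by (simp add: h_def)
  have bd: "(LINT x|lebesgue_on {0..1}. \<bar>sol t x - sol t0 x\<bar> powr p) \<le> (\<Sum>n. h n t)" if t: "t \<in> {0..1}" for t
  proof -
    have "AE x in lebesgue_on {0..1}. \<bar>sol t x - sol t0 x\<bar> powr p = \<bar>\<Sum>n. val (w n) t x - val (w n) t0 x\<bar> powr p"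
      using sol_summable[OF t] sol_summable[OF t0]
      by eventually_elim (simp add: sol_def suminf_diff summable_rabs_cancel)
    then have "(LINT x|lebesgue_on {0..1}. \<bar>sol t x - sol t0 x\<bar> powr p)
        = (LINT x|lebesgue_on {0..1}. \<bar>\<Sum>n. val (w n) t x - val (w n) t0 x\<bar> powr p)"
      by (intro integral_cong_AE measurable_abs_powr borel_measurable_diff borel_measurable_suminf sol_measurable val_w_measurable)
    also have "\<dots> \<le> (\<Sum>n. h n t)"
    proof (rule Lp_series(3))
      show "4 ^ Suc n * (LINT x|lebesgue_on {0..1}. \<bar>val (w n) t x - val (w n) t0 x\<bar> powr p) \<le> h n t" for n
        unfolding h_def
      proof (rule min.boundedI[OF Lq_maj(2)[OF t t0 p]])
        show "4 ^ Suc n * (LINT x|lebesgue_on {0..1}. \<bar>val (w n) t x - val (w n) t0 x\<bar> powr p)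
          \<le> 4 ^ Suc n * (\<Sum>\<xi>\<in>supp (w n). norm (w n \<xi> t - w n \<xi> t0)) powr p"
          using p by (intro mult_left_mono LINT_le_const continuous_on_powr' continuous_intros val_continuous powr_mono2 val_w_diff_le) auto
      qed
      show "summable (\<lambda>n. h n t)" by (rule summable_comparison_test'[OF summable_maj[OF p(2)], of 0]) (use h0 hm in auto)
      show "integrable (lebesgue_on {0..1}) (\<lambda>x. \<bar>val (w n) t x - val (w n) t0 x\<bar> powr p)" for n
        using p by (intro cont_powr_int continuous_intros val_continuous) auto
      show "(\<lambda>x. val (w n) t x - val (w n) t0 x) \<in> borel_measurable (lebesgue_on {0..1})" for n
        using val_w_measurable by measurable
    qed (use p in auto)
    finally show ?thesis .
  qed
  have "continuous_on {0..1} (\<lambda>t. \<Sum>n. h n t)"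
    by (rule continuous_on_suminf[OF hcont _ summable_maj[OF p(2)]]) (use h0 hm in auto)
  then have "((\<lambda>t. \<Sum>n. h n t) \<longlongrightarrow> (\<Sum>n. h n t0)) (at t0 within {0..1})" using t0 by (simp add: continuous_on)
  moreover have "h n t0 = 0" for n using p by (simp add: h_def maj_def)
  ultimately have lim: "((\<lambda>t. \<Sum>n. h n t) \<longlongrightarrow> 0) (at t0 within {0..1})" by simp
  have ev: "\<forall>\<^sub>F t in at t0 within {0..1}. t \<in> {0..1}" by (simp add: eventually_at_filter)
  have "((\<lambda>t. LINT x|lebesgue_on {0..1}. \<bar>sol t x - sol t0 x\<bar> powr p) \<longlongrightarrow> 0) (at t0 within {0..1})"
  proof (rule tendsto_sandwich[OF _ _ tendsto_const lim])
    show "\<forall>\<^sub>F t in at t0 within {0..1}. (LINT x|lebesgue_on {0..1}. \<bar>sol t x - sol t0 x\<bar> powr p) \<le> (\<Sum>n. h n t)"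
      using ev by eventually_elim (rule bd)
  qed auto
  then have "((\<lambda>t. (LINT x|lebesgue_on {0..1}. \<bar>sol t x - sol t0 x\<bar> powr p) powr (1/p)) \<longlongrightarrow> 0 powr (1/p)) (at t0 within {0..1})"
    using p by (intro tendsto_powr2 tendsto_const) (auto intro!: always_eventually)
  then show "((\<lambda>t. Lp_norm p (\<lambda>x. sol t x - sol t0 x)) \<longlongrightarrow> 0) (at t0 within {0..1})"
    by (simp add: Lp_norm_def)
qed

end

section \<open>Test pairings and Fourier coefficients of the limit\<close>

lemma LINT_val_mult:
  assumes c: "tpoly c" and \<psi>: "continuous_on {0..1} \<psi>" and X: "finite X" "supp c \<subseteq> X"
  shows "(LINT x|lebesgue_on {0..1}. complex_of_real (val c t x) * \<psi> x)
    = (\<Sum>\<eta>\<in>X. c \<eta> t * (LINT x|lebesgue_on {0..1}. expi \<eta> x * \<psi> x))"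
proof -
  have "(LINT x|lebesgue_on {0..1}. complex_of_real (val c t x) * \<psi> x)
      = (LINT x|lebesgue_on {0..1}. (\<Sum>\<eta>\<in>X. c \<eta> t * (expi \<eta> x * \<psi> x)))"
    unfolding of_real_val[OF c X] by (simp add: sum_distrib_right mult.assoc)
  also have "\<dots> = (\<Sum>\<eta>\<in>X. (LINT x|lebesgue_on {0..1}. c \<eta> t * (expi \<eta> x * \<psi> x)))"
    by (intro Bochner_Integration.integral_sum LINT_eq_integral(1) continuous_intros \<psi>)
  finally show ?thesis by simp
qed

lemma LINT_val_expi:
  assumes c: "tpoly c"
  shows "(LINT x|lebesgue_on {0..1}. complex_of_real (val c t x) * expi (- \<xi>) x) = c \<xi> t"
proof -
  have "(LINT x|lebesgue_on {0..1}. complex_of_real (val c t x) * expi (- \<xi>) x)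
      = (\<Sum>\<eta>\<in>insert \<xi> (supp c). c \<eta> t * (LINT x|lebesgue_on {0..1}. expi \<eta> x * expi (- \<xi>) x))"
    using tpolyD(1)[OF c] by (intro LINT_val_mult c continuous_intros) auto
  also have "\<dots> = (\<Sum>\<eta>\<in>insert \<xi> (supp c). if \<eta> = \<xi> then c \<eta> t else 0)"
    by (intro sum.cong refl) (simp add: expi_add[symmetric] LINT_expi)
  finally show ?thesis using tpolyD(1)[OF c] by simp
qed

lemma continuous_bounded:
  fixes \<psi> :: "real \<Rightarrow> complex"
  assumes "continuous_on {0..1} \<psi>"
  obtains C where "\<And>x. x \<in> {0..1} \<Longrightarrow> norm (\<psi> x) \<le> C"
  using supn_ge[OF assms] by blast

context cascade
begin

lemma sol_tail:
  assumes t: "t \<in> {0..1}"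
  shows "integrable (lebesgue_on {0..1}) (\<lambda>x. sol t x - val (psum w N) t x)"
    and "(LINT x|lebesgue_on {0..1}. \<bar>sol t x - val (psum w N) t x\<bar>) \<le> (1/8) ^ N"
proof -
  let ?M = "lebesgue_on {0..1::real}"
  show int: "integrable ?M (\<lambda>x. sol t x - val (psum w N) t x)"
    using sol_integrable[OF t] LINT_eq_integral(1)[OF val_continuous[of _ "psum w N" t]] by simp
  have "AE x in ?M. \<bar>sol t x - val (psum w N) t x\<bar> = \<bar>\<Sum>n. val (w (n + Suc N)) t x\<bar> powr 1"
    using sol_summable[OF t]
  proof eventually_elim
    case (elim x)
    have "sol t x = (\<Sum>n. val (w (n + Suc N)) t x) + (\<Sum>n<Suc N. val (w n) t x)"
      unfolding sol_def by (rule suminf_split_initial_segment[OF summable_rabs_cancel[OF elim]])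
    then show ?case by (simp add: val_psum lessThan_Suc_atMost)
  qed
  then have "(LINT x|?M. \<bar>sol t x - val (psum w N) t x\<bar>) = (LINT x|?M. \<bar>\<Sum>n. val (w (n + Suc N)) t x\<bar> powr 1)"
    using int by (intro integral_cong_AE measurable_abs_powr borel_measurable_suminf val_w_measurable) auto
  \<comment> \<open>Here 4^(n+1) meets 8^(-(n+N+1)), so the n-th bound is 8^(-N) 2^(-(n+1)), and
    these add up to 8^(-N).\<close>
  also have "\<dots> \<le> (\<Sum>n. (1/8) ^ N * (1/2) ^ Suc n)"
  proof (rule Lp_series(3))
    show "4 ^ Suc n * (LINT x|?M. \<bar>val (w (n + Suc N)) t x\<bar> powr 1) \<le> (1/8) ^ N * (1/2) ^ Suc n" for n
    proof -
      have "(LINT x|?M. \<bar>val (w (n + Suc N)) t x\<bar> powr 1) \<le> (1/8) ^ (n + Suc N)"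
        using t by (intro Lq) auto
      then have "4 ^ Suc n * (LINT x|?M. \<bar>val (w (n + Suc N)) t x\<bar> powr 1) \<le> 4 ^ Suc n * (1/8) ^ (n + Suc N)"
        by (intro mult_left_mono) auto
      also have "\<dots> = (1/8) ^ N * (4 ^ Suc n * (1/8) ^ Suc n)" by (simp add: power_add)
      also have "(4::real) ^ Suc n * (1/8) ^ Suc n = (4 * (1/8)) ^ Suc n" by (simp only: power_mult_distrib)
      finally show ?thesis by simp
    qed
    show "summable (\<lambda>n. (1/8 :: real) ^ N * (1/2) ^ Suc n)"
      by (intro summable_mult sums_summable[OF power_half_series])
    show "integrable ?M (\<lambda>x. \<bar>val (w (n + Suc N)) t x\<bar> powr 1)" for n
      by (intro cont_powr_int val_continuous) simp
  qed (auto intro: val_w_measurable)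
  also have "\<dots> = (1/8) ^ N" using sums_unique[OF sums_mult[OF power_half_series, of "(1/8) ^ N"]] by simp
  finally show "(LINT x|?M. \<bar>sol t x - val (psum w N) t x\<bar>) \<le> (1/8) ^ N" .
qed

text \<open>The error is the L^1 tail times the maximum of the test function, hence uniform in
  \<open>t\<close>. Fourier coefficients, continuity in time and the limit of the linear terms all
  rest on this estimate.\<close>

lemma sol_test:
  assumes t: "t \<in> {0..1}" and \<psi>: "continuous_on {0..1} \<psi>" and C: "\<And>x. x \<in> {0..1} \<Longrightarrow> norm (\<psi> x) \<le> C"
  shows "norm (dist_path sol t \<psi> - (LINT x|lebesgue_on {0..1}. complex_of_real (val (psum w N) t x) * \<psi> x)) \<le> C * (1/8) ^ N"
proof -
  let ?M = "lebesgue_on {0..1::real}"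
  let ?d = "\<lambda>x. sol t x - val (psum w N) t x"
  have \<psi>m: "\<psi> \<in> borel_measurable ?M" using LINT_eq_integral(1)[OF \<psi>] by auto
  have C0: "0 \<le> C" using order_trans[OF norm_ge_zero C[of 0]] by simp
  have bnd: "integrable ?M (\<lambda>x. complex_of_real (g x) * \<psi> x)" if g: "integrable ?M g" for g
  proof (rule Bochner_Integration.integrable_bound[of ?M "\<lambda>x. C * g x"])
    show "integrable ?M (\<lambda>x. C * g x)" using g by simp
    show "(\<lambda>x. complex_of_real (g x) * \<psi> x) \<in> borel_measurable ?M" using g \<psi>m by measurable
    have "norm (complex_of_real (g x) * \<psi> x) \<le> norm (C * g x)" if "x \<in> {0..1}" for x
      using mult_left_mono[OF C[OF that], of "\<bar>g x\<bar>"] C0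
      by (simp add: norm_mult abs_mult mult.commute)
    then show "AE x in ?M. norm (complex_of_real (g x) * \<psi> x) \<le> norm (C * g x)" by (intro AE_I2) simp
  qed
  have "dist_path sol t \<psi> - (LINT x|?M. complex_of_real (val (psum w N) t x) * \<psi> x)
      = (LINT x|?M. complex_of_real (sol t x) * \<psi> x - complex_of_real (val (psum w N) t x) * \<psi> x)"
    unfolding dist_path_def dist_of_fun_def
    by (rule Bochner_Integration.integral_diff[symmetric])
      (intro bnd sol_integrable t LINT_eq_integral(1) val_continuous)+
  also have "\<dots> = (LINT x|?M. complex_of_real (?d x) * \<psi> x)" by (simp add: left_diff_distrib)
  finally have "norm (dist_path sol t \<psi> - (LINT x|?M. complex_of_real (val (psum w N) t x) * \<psi> x))
      \<le> (LINT x|?M. norm (complex_of_real (?d x) * \<psi> x))"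
    by (simp only: integral_norm_bound)
  also have "\<dots> \<le> (LINT x|?M. C * \<bar>?d x\<bar>)"
  proof (rule integral_mono)
    show "integrable ?M (\<lambda>x. norm (complex_of_real (?d x) * \<psi> x))"
      by (intro integrable_norm bnd sol_tail t)
    show "integrable ?M (\<lambda>x. C * \<bar>?d x\<bar>)" using sol_tail(1)[OF t] by simp
    show "norm (complex_of_real (?d x) * \<psi> x) \<le> C * \<bar>?d x\<bar>" if "x \<in> space ?M" for x
      using mult_right_mono[OF C, of x "\<bar>?d x\<bar>"] that by (simp add: norm_mult mult.commute flip: of_real_diff)
  qed
  also have "\<dots> = C * (LINT x|?M. \<bar>?d x\<bar>)" by simp
  also have "\<dots> \<le> C * (1/8) ^ N" using C0 by (intro mult_left_mono sol_tail t)
  finally show ?thesis .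
qed

lemma power_eighth_lim: "(\<lambda>N. C * (1/8 :: real) ^ N) \<longlonglongrightarrow> 0"
proof -
  have "(\<lambda>N. C * (1/8 :: real) ^ N) \<longlonglongrightarrow> C * 0" by (intro tendsto_intros LIMSEQ_realpow_zero) auto
  then show ?thesis by simp
qed

lemma sol_fourier:
  assumes t: "t \<in> {0..1}"
  shows "fourier (dist_path sol t) \<xi> = sol_coeff \<xi> t"
proof -
  have "(\<lambda>N. (1/8 :: real) ^ N) \<longlonglongrightarrow> 0" using power_eighth_lim[of 1] by simp
  moreover have "\<forall>\<^sub>F N in sequentially. norm (fourier (dist_path sol t) \<xi> - sol_coeff \<xi> t) \<le> (1/8) ^ N"
  proof (rule eventually_sequentiallyI[of "nat \<bar>\<xi>\<bar>"])
    fix N assume "nat \<bar>\<xi>\<bar> \<le> N"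
    then have "psum w N \<xi> = sol_coeff \<xi>" by (intro psum_eventually) auto
    then show "norm (fourier (dist_path sol t) \<xi> - sol_coeff \<xi> t) \<le> (1/8) ^ N"
      using sol_test[OF t, of "expi (- \<xi>)" 1 N] LINT_val_expi[OF psum, of N t \<xi>]
      by (simp add: fourier_def continuous_on_expi continuous_on_id)
  qed
  ultimately have "norm (fourier (dist_path sol t) \<xi> - sol_coeff \<xi> t) \<le> 0"
    by (rule tendsto_lowerbound) auto
  then show ?thesis by simp
qed

lemma sol_Ct_distribution: "Ct_distribution (dist_path sol)"
  unfolding Ct_distribution_def
proof (intro conjI ballI)
  show "distribution (dist_path sol t)" if "t \<in> {0..1}" for t
    unfolding dist_path_def by (rule dist_of_fun_distribution[OF sol_integrable[OF that]])
  fix \<phi> assume \<phi>: "\<phi> \<in> test_fun"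
  obtain C where C: "\<And>x. x \<in> {0..1} \<Longrightarrow> norm (\<phi> x) \<le> C" using continuous_bounded[OF test_funD[OF \<phi>]] by blast
  let ?f = "\<lambda>N t. LINT x|lebesgue_on {0..1}. complex_of_real (val (psum w N) t x) * \<phi> x"
  have "uniform_limit {0..1} ?f (\<lambda>t. dist_path sol t \<phi>) sequentially"
  proof (rule uniform_limitI)
    fix e :: real assume "e > 0"
    then have "\<forall>\<^sub>F N in sequentially. C * (1/8) ^ N < e" by (rule order_tendstoD(2)[OF power_eighth_lim])
    then show "\<forall>\<^sub>F N in sequentially. \<forall>t\<in>{0..1}. dist (?f N t) (dist_path sol t \<phi>) < e"
      by eventually_elim (use sol_test[OF _ test_funD[OF \<phi>] C] in \<open>fastforce simp: dist_norm norm_minus_commute intro: le_less_trans\<close>)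
  qed
  moreover have "continuous_on {0..1} (?f N)" for N
    unfolding LINT_val_mult[OF psum test_funD[OF \<phi>] tpolyD(1)[OF psum] order_refl]
    by (intro continuous_intros flat_continuous tpolyD[OF psum])
  ultimately show "continuous_on {0..1} (\<lambda>t. dist_path sol t \<phi>)"
    by (intro uniform_limit_theorem[OF always_eventually]) auto
qed

text \<open>The supremum over time stands inside the sum, so that one majorant serves all times and
  continuity follows by uniform convergence. The sum is taken packet by packet: once 1/(n+1) < 1/2 -
  1/k - r, \<open>sob\<close> bounds the n-th group by 8^(-n).\<close>

lemma sobolev_summable:
  assumes r: "r < 1/2 - 1 / real k"
  shows "(\<lambda>\<xi>. (1 + (of_int \<xi>)\<^sup>2) powr r * (supn (sol_coeff \<xi>))\<^sup>2) summable_on UNIV"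
proof -
  let ?b = "\<lambda>\<xi>. (1 + (real_of_int \<xi>)\<^sup>2) powr r * (supn (sol_coeff \<xi>))\<^sup>2"
  let ?a = "\<lambda>n. \<Sum>\<xi>\<in>supp (w n). ?b \<xi>"
  have b0: "0 \<le> ?b \<xi>" for \<xi> by simp
  have sa: "summable ?a"
  proof -
    have "(\<lambda>n. 1 / real (Suc n)) \<longlonglongrightarrow> 0" by (rule LIMSEQ_Suc[OF lim_1_over_n])
    then have "\<forall>\<^sub>F n in sequentially. 1 / real (Suc n) < 1/2 - 1/real k - r" by (rule order_tendstoD) (use r in simp)
    then have "\<forall>\<^sub>F n in sequentially. norm (?a n) \<le> (1/8) ^ n"
      using eventually_gt_at_top[of 0]
    proof eventually_elim
      case (elim n)
      have "?a n \<le> (\<Sum>\<xi>\<in>supp (w n). (1 + (of_int \<xi>)\<^sup>2) powr (1/2 - 1/real k - 1 / real (Suc n)) * (supn (w n \<xi>))\<^sup>2)"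
        using elim by (intro sum_mono mult_mono powr_mono) (auto simp: coeff_w)
      also have "\<dots> \<le> (1/8) ^ n" using sob elim by blast
      finally show ?case using b0 by (simp add: sum_nonneg)
    qed
    then show ?thesis by (rule summable_comparison_test_ev) (auto intro: summable_geometric)
  qed
  show ?thesis
  proof (rule nonneg_bdd_above_summable_on)
    show "bdd_above (sum ?b ` {F. F \<subseteq> UNIV \<and> finite F})"
    proof (rule bdd_aboveI2)
      fix F :: "int set" assume "F \<in> {F. F \<subseteq> UNIV \<and> finite F}"
      then have F: "finite F" by simp
      define N where "N = Max (insert 0 ((\<lambda>\<xi>. nat \<bar>\<xi>\<bar>) ` F))"
      have N: "\<bar>\<xi>\<bar> \<le> int N" if "\<xi> \<in> F" for \<xi>
      proof -
        have "nat \<bar>\<xi>\<bar> \<le> N" unfolding N_def using F that by (intro Max_ge) auto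
        then show ?thesis by simp
      qed
      have fin: "finite (\<Union>n\<le>N. supp (w n))" using tpolyD(1)[OF w] by auto
      have "sum ?b F = sum ?b (F \<inter> (\<Union>n\<le>N. supp (w n)))"
      proof (rule sum.mono_neutral_right[OF F])
        show "\<forall>\<xi>\<in>F - F \<inter> (\<Union>n\<le>N. supp (w n)). ?b \<xi> = 0"
        proof
          fix \<xi> assume \<xi>: "\<xi> \<in> F - F \<inter> (\<Union>n\<le>N. supp (w n))"
          then have "\<xi> \<notin> supp (psum w N)" using psum_supp by blast
          then have "psum w N \<xi> = (\<lambda>t. 0)" by (auto intro: not_supp)
          moreover have "psum w N \<xi> = sol_coeff \<xi>" using N \<xi> by (intro psum_eventually) auto
          ultimately have "sol_coeff \<xi> = (\<lambda>t. 0)" by simp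
          then show "?b \<xi> = 0" by simp
        qed
      qed auto
      also have "\<dots> \<le> sum ?b (\<Union>n\<le>N. supp (w n))" using fin b0 by (intro sum_mono2) auto
      also have "\<dots> \<le> (\<Sum>n\<le>N. ?a n)" using tpolyD(1)[OF w] b0 by (intro sum_UN_le) auto
      also have "\<dots> \<le> suminf ?a" using b0 by (intro sum_le_suminf sa) (auto intro: sum_nonneg)
      finally show "sum ?b F \<le> suminf ?a" .
    qed
  qed (rule b0)
qed

lemma sol_Ct_sobolev:
  assumes r: "r < 1/2 - 1 / real k"
  shows "Ct_sobolev r (dist_path sol)"
  unfolding Ct_sobolev_def
proof (intro conjI ballI)
  let ?b = "\<lambda>\<xi>. (1 + (real_of_int \<xi>)\<^sup>2) powr r * (supn (sol_coeff \<xi>))\<^sup>2"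
  show "dist_path sol t \<in> sobolev r" if t: "t \<in> {0..1}" for t
    unfolding sobolev_def
  proof (intro CollectI conjI)
    show "distribution (dist_path sol t)" using sol_Ct_distribution t by (simp add: Ct_distribution_def)
    show "(\<lambda>\<xi>. (1 + (of_int \<xi>)\<^sup>2) powr r * (norm (fourier (dist_path sol t) \<xi>))\<^sup>2) summable_on UNIV"
      by (rule summable_on_comparison_test[OF sobolev_summable[OF r]])
        (auto simp: sol_fourier[OF t] intro!: mult_left_mono power_mono supn_ge coeff_continuous t)
  qed
  fix t0 :: real assume t0: "t0 \<in> {0..1}"
  let ?h = "\<lambda>\<xi> t. (1 + (real_of_int \<xi>)\<^sup>2) powr r * (norm (sol_coeff \<xi> t - sol_coeff \<xi> t0))\<^sup>2"
  have "continuous_on {0..1} (\<lambda>t. \<Sum>\<^sub>\<infinity>\<xi>. ?h \<xi> t)"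
  proof (rule continuous_on_infsum)
    show "continuous_on {0..1} (?h \<xi>)" for \<xi> by (intro continuous_intros coeff_continuous)
    show "norm (?h \<xi> t) \<le> 4 * ?b \<xi>" if t: "t \<in> {0..1}" for \<xi> t
    proof -
      have "norm (sol_coeff \<xi> t - sol_coeff \<xi> t0) \<le> 2 * supn (sol_coeff \<xi>)"
        using norm_triangle_ineq4[of "sol_coeff \<xi> t" "sol_coeff \<xi> t0"] supn_ge[OF coeff_continuous t, of \<xi>] supn_ge[OF coeff_continuous t0, of \<xi>]
        by linarith
      then have "(norm (sol_coeff \<xi> t - sol_coeff \<xi> t0))\<^sup>2 \<le> (2 * supn (sol_coeff \<xi>))\<^sup>2" by (intro power_mono) auto
      then have "?h \<xi> t \<le> (1 + (real_of_int \<xi>)\<^sup>2) powr r * (2 * supn (sol_coeff \<xi>))\<^sup>2" by (intro mult_left_mono) auto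
      then show ?thesis by (simp add: power_mult_distrib)
    qed
    show "(\<lambda>\<xi>. 4 * ?b \<xi>) summable_on UNIV" by (intro summable_on_cmult_right sobolev_summable r)
  qed
  then have "((\<lambda>t. \<Sum>\<^sub>\<infinity>\<xi>. ?h \<xi> t) \<longlongrightarrow> (\<Sum>\<^sub>\<infinity>\<xi>. ?h \<xi> t0)) (at t0 within {0..1})"
    using t0 unfolding continuous_on by blast
  then have "((\<lambda>t. sqrt (\<Sum>\<^sub>\<infinity>\<xi>. ?h \<xi> t)) \<longlongrightarrow> sqrt 0) (at t0 within {0..1})"
    by (intro tendsto_real_sqrt) simp
  moreover have "\<forall>\<^sub>F t in at t0 within {0..1}. sqrt (\<Sum>\<^sub>\<infinity>\<xi>. ?h \<xi> t) = sobolev_norm r (\<lambda>\<phi>. dist_path sol t \<phi> - dist_path sol t0 \<phi>)"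
    unfolding eventually_at_filter sobolev_norm_def
    using sol_fourier t0 by (intro always_eventually allI impI) (simp add: fourier_def)
  ultimately show "((\<lambda>t. sobolev_norm r (\<lambda>\<phi>. dist_path sol t \<phi> - dist_path sol t0 \<phi>)) \<longlongrightarrow> 0) (at t0 within {0..1})"
    using Lim_transform_eventually by fastforce
qed

section \<open>Absolute summability of the product\<close>

definition tmaj :: "(nat \<Rightarrow> int) \<Rightarrow> real" where
  "tmaj \<xi> = supn (\<lambda>t. \<Prod>i<k. sol_coeff (\<xi> i) t) * \<bar>of_int (\<Sum>i<k. \<xi> i)\<bar> powr (-s)"

lemma tuple_coeff_continuous: "continuous_on S (\<lambda>t. \<Prod>i<k. sol_coeff (\<xi> i) t)"
  by (intro continuous_intros coeff_continuous)

lemma tmaj_nonneg: "0 \<le> tmaj \<xi>"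
  unfolding tmaj_def by (intro mult_nonneg_nonneg supn_nonneg tuple_coeff_continuous) simp

lemma finite_tuples_bound:
  assumes "finite (F :: (nat \<Rightarrow> int) set)"
  obtains N where "\<And>\<xi> i n. \<xi> \<in> F \<Longrightarrow> i < k \<Longrightarrow> n \<ge> N \<Longrightarrow> \<bar>\<xi> i\<bar> \<le> int n"
proof -
  define N where "N = Max (insert 0 ((\<lambda>(\<xi>, i). nat \<bar>\<xi> i\<bar>) ` (F \<times> {..<k})))"
  have "\<bar>\<xi> i\<bar> \<le> int n" if "\<xi> \<in> F" "i < k" "n \<ge> N" for \<xi> i n
  proof -
    have "nat \<bar>\<xi> i\<bar> \<le> N" unfolding N_def using assms that by (intro Max_ge) (auto intro!: image_eqI[of _ _ "(\<xi>, i)"])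
    then show ?thesis using that by simp
  qed
  then show ?thesis by (rule that)
qed

text \<open>A finite set of tuples involves only boundedly large frequencies, on which the limit has
  the coefficients of a late partial sum. Its sum is therefore at most the \<open>mass\<close> of
  that partial sum, hence at most \<open>K\<close>.\<close>

lemma tmaj_summable: "tmaj summable_on nonzero_freqs k"
proof (rule nonneg_bdd_above_summable_on)
  show "bdd_above (sum tmaj ` {F. F \<subseteq> nonzero_freqs k \<and> finite F})"
  proof (rule bdd_aboveI2)
    fix F assume "F \<in> {F. F \<subseteq> nonzero_freqs k \<and> finite F}"
    then have F: "F \<subseteq> nonzero_freqs k" "finite F" by auto
    obtain N where N: "\<And>\<xi> i n. \<xi> \<in> F \<Longrightarrow> i < k \<Longrightarrow> n \<ge> N \<Longrightarrow> \<bar>\<xi> i\<bar> \<le> int n"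
      using finite_tuples_bound[OF F(2)] by blast
    let ?c = "psum w N"
    let ?T = "{\<xi>\<in>{..<k} \<rightarrow>\<^sub>E supp ?c. (\<Sum>i<k. \<xi> i) \<noteq> 0}"
    let ?g = "\<lambda>\<xi>. supn (\<lambda>t. \<Prod>i<k. ?c (\<xi> i) t) * \<bar>of_int (\<Sum>i<k. \<xi> i)\<bar> powr (-s)"
    have eq: "tmaj \<xi> = ?g \<xi>" if "\<xi> \<in> F" for \<xi>
    proof -
      have "(\<Prod>i<k. sol_coeff (\<xi> i) t) = (\<Prod>i<k. ?c (\<xi> i) t)" for t
        using N[OF that] by (intro prod.cong refl) (simp add: psum_eventually)
      then show ?thesis by (simp add: tmaj_def)
    qed
    have "sum tmaj F = sum ?g F" by (intro sum.cong refl eq)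
    also have "\<dots> = sum ?g (F \<inter> ?T)"
    proof (rule sum.mono_neutral_right[OF F(2)])
      show "\<forall>\<xi>\<in>F - F \<inter> ?T. ?g \<xi> = 0"
      proof
        fix \<xi> assume "\<xi> \<in> F - F \<inter> ?T"
        then have "\<xi> \<notin> {..<k} \<rightarrow>\<^sub>E supp ?c" "\<xi> \<in> {..<k} \<rightarrow>\<^sub>E UNIV" using F(1) by (auto simp: nonzero_freqs_def)
        then obtain i where i: "i < k" "\<xi> i \<notin> supp ?c" by (auto simp: PiE_iff)
        then have "(\<Prod>i<k. ?c (\<xi> i) t) = 0" for t by (intro prod_zero) (auto intro: not_supp)
        then show "?g \<xi> = 0" by (simp only: supn_zero mult_zero_left)
      qed
    qed auto
    also have "\<dots> \<le> sum ?g ?T"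
    proof (rule sum_mono2)
      show "finite ?T" using finite_tuples[OF tpolyD(1)[OF psum], of k] by (rule rev_finite_subset) auto
      show "0 \<le> ?g \<xi>" for \<xi> by (intro mult_nonneg_nonneg supn_nonneg tuple_continuous psum) simp
    qed auto
    also have "\<dots> = mass k s ?c" by (simp only: mass_def)
    also have "\<dots> \<le> K" by (rule mass)
    finally show "sum tmaj F \<le> K" .
  qed
qed (rule tmaj_nonneg)

lemma sol_product_exists: "product_exists k (\<lambda>_. dist_path sol) (- s)"
  unfolding product_exists_def
proof (intro conjI allI impI sol_Ct_distribution)
  have "(SUP t\<in>{0..1}. norm (\<Prod>i<k. fourier (dist_path sol t) (\<xi> i))) = supn (\<lambda>t. \<Prod>i<k. sol_coeff (\<xi> i) t)" for \<xi>
    unfolding supn_def by (intro SUP_cong refl) (simp add: sol_fourier)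
  then show "(\<lambda>\<xi>. (SUP t\<in>{0..1}. norm (\<Prod>i<k. fourier (dist_path sol t) (\<xi> i))) * \<bar>of_int (\<Sum>i<k. \<xi> i)\<bar> powr (- s))
      summable_on nonzero_freqs k"
    using tmaj_summable by (simp add: tmaj_def[abs_def])
qed

text \<open>The Fourier coefficient at frequency 1 and time 1 is that of the seed.\<close>

lemma sol_nonzero: "\<not> zero_ae (sol 1)"
proof
  assume "zero_ae (sol 1)"
  then have "AE x in lebesgue_on {0..1}. complex_of_real (sol 1 x) * expi (-1) x = 0"
    unfolding zero_ae_def by eventually_elim simp
  then have "fourier (dist_path sol 1) 1 = 0"
    unfolding fourier_def dist_path_def dist_of_fun_def by (rule integral_eq_zero_AE)
  then have "sol_coeff 1 1 = 0" by (simp add: sol_fourier)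
  moreover have "1 \<in> supp (w 0)" using w0 by (auto simp: supp_def)
  ultimately show False using w0 coeff_w by simp
qed

end

subsection \<open>Fourier coefficients of space-time test functions\<close>

definition pd :: "real \<times> real \<Rightarrow> (real \<times> real \<Rightarrow> complex) \<Rightarrow> real \<times> real \<Rightarrow> complex" where
  "pd v \<phi> p = frechet_derivative \<phi> (at p) v"

definition xper :: "(real \<times> real \<Rightarrow> complex) \<Rightarrow> bool" where
  "xper \<phi> \<longleftrightarrow> (\<forall>t x. \<phi> (t, x + 1) = \<phi> (t, x))"

text \<open>The Fourier coefficient at minus \<open>\<xi>\<close>: in a pairing without complex
  conjugation, this is the factor that multiplies the coefficient of the distribution at
  \<open>\<xi>\<close>.\<close>

definition Fc :: "(real \<times> real \<Rightarrow> complex) \<Rightarrow> int \<Rightarrow> real \<Rightarrow> complex" where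
  "Fc \<phi> \<xi> t = (LINT x|lebesgue_on {0..1}. expi \<xi> x * \<phi> (t, x))"

lemma smooth_pd: "smooth \<phi> \<Longrightarrow> smooth (pd v \<phi>)"
  unfolding smooth_def pd_def[abs_def] using C_n.simps(2) by blast

lemma smooth_differentiable: "smooth \<phi> \<Longrightarrow> \<phi> differentiable (at p)"
  unfolding smooth_def using C_n.simps(2)[of 0 \<phi>] by blast

lemma smooth_continuous: "smooth \<phi> \<Longrightarrow> continuous_on S \<phi>"
  unfolding smooth_def using C_n.simps(1)[of \<phi>] by (blast intro: continuous_on_subset)

lemma smooth_continuous_slice: "smooth \<phi> \<Longrightarrow> continuous_on S (\<lambda>x. \<phi> (t, x))"
  by (rule continuous_on_compose2[OF smooth_continuous[of \<phi> UNIV]]) (auto intro!: continuous_intros)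

lemma smooth_deriv:
  assumes "smooth \<phi>"
  shows "((\<lambda>x. \<phi> (t, x)) has_vector_derivative pd (0, 1) \<phi> (t, x)) (at x)"
    and "((\<lambda>t. \<phi> (t, x)) has_vector_derivative pd (1, 0) \<phi> (t, x)) (at t)"
proof -
  let ?F = "frechet_derivative \<phi> (at (t, x))"
  have F: "(\<phi> has_derivative ?F) (at (t, x))"
    using smooth_differentiable[OF assms] by (simp add: frechet_derivative_works)
  interpret F: bounded_linear ?F using F by (rule has_derivative_bounded_linear)
  have "((\<lambda>x. (t, x)) has_derivative (\<lambda>h. (0, h))) (at x)" by (auto intro!: derivative_eq_intros)
  from has_derivative_compose[OF this F]
  have "((\<lambda>x. \<phi> (t, x)) has_derivative (\<lambda>h. ?F (0, h))) (at x)" .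
  moreover have "?F (0, h) = h *\<^sub>R pd (0, 1) \<phi> (t, x)" for h
    using F.scaleR[of h "(0, 1)"] by (simp add: pd_def)
  ultimately show "((\<lambda>x. \<phi> (t, x)) has_vector_derivative pd (0, 1) \<phi> (t, x)) (at x)"
    by (simp add: has_vector_derivative_def)
  have "((\<lambda>t. (t, x)) has_derivative (\<lambda>h. (h, 0))) (at t)" by (auto intro!: derivative_eq_intros)
  from has_derivative_compose[OF this F]
  have "((\<lambda>t. \<phi> (t, x)) has_derivative (\<lambda>h. ?F (h, 0))) (at t)" .
  moreover have "?F (h, 0) = h *\<^sub>R pd (1, 0) \<phi> (t, x)" for h
    using F.scaleR[of h "(1, 0)"] by (simp add: pd_def)
  ultimately show "((\<lambda>t. \<phi> (t, x)) has_vector_derivative pd (1, 0) \<phi> (t, x)) (at t)"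
    by (simp add: has_vector_derivative_def)
qed

lemma smooth_pd_power: "smooth \<phi> \<Longrightarrow> smooth ((pd v ^^ j) \<phi>)"
  by (induction j) (auto intro: smooth_pd)

lemma D_power:
  assumes "smooth \<phi>"
  shows "(D ^^ j) (\<lambda>x. \<phi> (t, x)) = (\<lambda>x. (pd (0, 1) ^^ j) \<phi> (t, x))"
proof (induction j)
  case (Suc j)
  then show ?case
    by (auto simp: D_def intro!: vector_derivative_at smooth_deriv smooth_pd_power assms)
qed simp

lemma xper_pd:
  assumes "smooth \<phi>" "xper \<phi>"
  shows "xper (pd (0, 1) \<phi>)"
  unfolding xper_def
proof (intro allI)
  fix t x
  have "((\<lambda>x::real. x + 1) has_real_derivative 1) (at x)" by (auto intro!: derivative_eq_intros)
  then have "((\<lambda>x::real. x + 1) has_vector_derivative 1) (at x)"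
    by (simp add: has_real_derivative_iff_has_vector_derivative)
  then have "((\<lambda>x. \<phi> (t, x + 1)) has_vector_derivative 1 *\<^sub>R pd (0, 1) \<phi> (t, x + 1)) (at x)"
    using vector_diff_chain_at[of "\<lambda>x. x + 1" 1 x "\<lambda>x. \<phi> (t, x)" "pd (0, 1) \<phi> (t, x + 1)"]
      smooth_deriv(1)[OF assms(1), of t "x + 1"]
    by (simp add: o_def)
  moreover have "(\<lambda>x. \<phi> (t, x + 1)) = (\<lambda>x. \<phi> (t, x))" using assms(2) by (simp add: xper_def)
  ultimately show "pd (0, 1) \<phi> (t, x + 1) = pd (0, 1) \<phi> (t, x)"
    using smooth_deriv(1)[OF assms(1), of t x] by (simp add: vector_derivative_unique_at)
qed

lemma xper_pd_power: "smooth \<phi> \<Longrightarrow> xper \<phi> \<Longrightarrow> xper ((pd (0, 1) ^^ j) \<phi>)"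
  by (induction j) (auto intro: xper_pd smooth_pd_power)

lemma smooth_bounded:
  fixes \<phi> :: "real \<times> real \<Rightarrow> complex"
  assumes "smooth \<phi>"
  obtains C where "C \<ge> 0" "\<And>t x. t \<in> {0..1} \<Longrightarrow> x \<in> {0..1} \<Longrightarrow> norm (\<phi> (t, x)) \<le> C"
proof -
  have "compact (\<phi> ` ({0..1} \<times> {0..1}))"
    by (intro compact_continuous_image smooth_continuous assms compact_Times compact_Icc)
  then obtain C where "\<forall>z\<in>\<phi> ` ({0..1} \<times> {0..1}). norm z \<le> C"
    using compact_imp_bounded bounded_iff by blast
  then have *: "norm (\<phi> (t, x)) \<le> C" if "t \<in> {0..1}" "x \<in> {0..1}" for t x using that by blast
  moreover have "0 \<le> C" using order_trans[OF norm_ge_zero *[of 0 0]] by simp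
  ultimately show ?thesis by (rule that[rotated])
qed

lemma Fc_integral:
  assumes "smooth \<phi>"
  shows "Fc \<phi> \<xi> t = integral {0..1} (\<lambda>x. expi \<xi> x * \<phi> (t, x))"
  unfolding Fc_def by (intro LINT_eq_integral continuous_intros smooth_continuous_slice assms)

lemma Fc_le:
  assumes \<phi>: "smooth \<phi>" and t: "t \<in> {0..1}" and C: "\<And>t x. t \<in> {0..1} \<Longrightarrow> x \<in> {0..1} \<Longrightarrow> norm (\<phi> (t, x)) \<le> C"
  shows "norm (Fc \<phi> \<xi> t) \<le> C"
proof -
  have "norm (integral {0..1} (\<lambda>x. expi \<xi> x * \<phi> (t, x))) \<le> C * (1 - 0)"
    by (intro integral_bound continuous_intros smooth_continuous_slice \<phi>) (use C[OF t] in \<open>auto simp: norm_mult\<close>)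
  then show ?thesis by (simp add: Fc_integral[OF \<phi>])
qed

text \<open>Integration by parts; the boundary terms cancel by periodicity of
  \<open>expi \<xi>\<close> and of \<open>\<phi>\<close>.\<close>

lemma Fc_pd_x:
  assumes \<phi>: "smooth \<phi>" "xper \<phi>"
  shows "Fc (pd (0, 1) \<phi>) \<xi> t = - (2 * of_real pi * \<i> * of_int \<xi>) * Fc \<phi> \<xi> t"
proof -
  let ?z = "2 * of_real pi * \<i> * of_int \<xi> :: complex"
  have "((\<lambda>x. expi \<xi> x * \<phi> (t, x)) has_vector_derivative
      expi \<xi> x * pd (0, 1) \<phi> (t, x) + ?z * expi \<xi> x * \<phi> (t, x)) (at x within {0..1})" for x
    by (intro has_vector_derivative_mult expi_vector_derivative smooth_deriv(1)[OF \<phi>(1), THEN has_vector_derivative_at_within])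
  then have "((\<lambda>x. expi \<xi> x * pd (0, 1) \<phi> (t, x) + ?z * expi \<xi> x * \<phi> (t, x)) has_integral
      (expi \<xi> 1 * \<phi> (t, 1) - expi \<xi> 0 * \<phi> (t, 0))) {0..1}"
    by (intro fundamental_theorem_of_calculus) auto
  moreover have "expi \<xi> 1 * \<phi> (t, 1) = expi \<xi> 0 * \<phi> (t, 0)"
    using expi_periodic[of \<xi> 0] \<phi>(2)[unfolded xper_def, rule_format, of t 0] by simp
  ultimately have "integral {0..1} (\<lambda>x. expi \<xi> x * pd (0, 1) \<phi> (t, x) + ?z * (expi \<xi> x * \<phi> (t, x))) = 0"
    by (simp add: integral_unique mult.assoc)
  moreover have "integral {0..1} (\<lambda>x. expi \<xi> x * pd (0, 1) \<phi> (t, x) + ?z * (expi \<xi> x * \<phi> (t, x)))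
     = Fc (pd (0, 1) \<phi>) \<xi> t + ?z * Fc \<phi> \<xi> t"
    unfolding Fc_integral[OF \<phi>(1)] Fc_integral[OF smooth_pd[OF \<phi>(1)]]
    by (intro integral_unique has_integral_add has_integral_mult_right integrable_integral integrable_continuous_real
        continuous_intros smooth_continuous_slice smooth_pd \<phi>)
  ultimately show ?thesis by (simp add: add_eq_0_iff2)
qed

lemma Fc_pd_power:
  assumes "smooth \<phi>" "xper \<phi>"
  shows "Fc ((pd (0, 1) ^^ j) \<phi>) \<xi> t = (- (2 * of_real pi * \<i> * of_int \<xi>)) ^ j * Fc \<phi> \<xi> t"
  by (induction j) (simp_all add: Fc_pd_x smooth_pd_power xper_pd_power assms)

text \<open>Take as many x-derivatives as the ceiling of \<open>s\<close> and bound the resulting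
  derivative by its maximum over the unit square.\<close>

lemma Fc_decay:
  assumes "smooth \<phi>" "xper \<phi>"
  obtains C where "C \<ge> 0" "\<And>\<xi> t. \<xi> \<noteq> 0 \<Longrightarrow> t \<in> {0..1} \<Longrightarrow> norm (Fc \<phi> \<xi> t) \<le> C * \<bar>of_int \<xi>\<bar> powr (-s)"
proof -
  define m where "m = nat \<lceil>s\<rceil>"
  have ms: "s \<le> real m" unfolding m_def by linarith
  obtain C where C: "C \<ge> 0" "\<And>t x. t \<in> {0..1} \<Longrightarrow> x \<in> {0..1} \<Longrightarrow> norm ((pd (0, 1) ^^ m) \<phi> (t, x)) \<le> C"
    using smooth_bounded[OF smooth_pd_power[OF assms(1)]] by blast
  have "norm (Fc \<phi> \<xi> t) \<le> C * \<bar>of_int \<xi>\<bar> powr (-s)" if \<xi>: "\<xi> \<noteq> 0" and t: "t \<in> {0..1}" for \<xi> t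
  proof -
    have x1: "1 \<le> \<bar>real_of_int \<xi>\<bar>" using \<xi> by linarith
    have "(2 * pi * \<bar>real_of_int \<xi>\<bar>) ^ m * norm (Fc \<phi> \<xi> t) \<le> C"
      using Fc_le[OF smooth_pd_power[OF assms(1)] t C(2), of \<xi>]
      by (simp add: Fc_pd_power[OF assms] norm_mult norm_power)
    moreover have "\<bar>real_of_int \<xi>\<bar> powr s \<le> (2 * pi * \<bar>real_of_int \<xi>\<bar>) ^ m"
    proof -
      have "\<bar>real_of_int \<xi>\<bar> powr s \<le> \<bar>real_of_int \<xi>\<bar> powr real m" using x1 ms by (intro powr_mono) auto
      also have "\<dots> = \<bar>real_of_int \<xi>\<bar> ^ m" using x1 by (simp add: powr_realpow)
      also have "\<dots> \<le> (2 * pi * \<bar>real_of_int \<xi>\<bar>) ^ m"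
        using pi_gt3 by (intro power_mono) (auto simp: mult_le_cancel_right1)
      finally show ?thesis .
    qed
    ultimately have "\<bar>real_of_int \<xi>\<bar> powr s * norm (Fc \<phi> \<xi> t) \<le> C"
      by (meson mult_right_mono norm_ge_zero order_trans)
    then show ?thesis using x1 by (simp add: powr_minus field_simps)
  qed
  then show ?thesis using C(1) that by blast
qed

lemma Fc_has_vector_derivative:
  assumes \<phi>: "smooth \<phi>" and t: "t \<in> {0..1}"
  shows "(Fc \<phi> \<xi> has_vector_derivative Fc (pd (1, 0) \<phi>) \<xi> t) (at t within {0..1})"
proof -
  have "((\<lambda>t. integral (cbox 0 1) (\<lambda>x. expi \<xi> x * \<phi> (t, x))) has_vector_derivative
      integral (cbox 0 1) (\<lambda>x. expi \<xi> x * pd (1, 0) \<phi> (t, x))) (at t within {0..1})"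
  proof (rule leibniz_rule_vector_derivative)
    fix x t :: real
    show "((\<lambda>t. expi \<xi> x * \<phi> (t, x)) has_vector_derivative expi \<xi> x * pd (1, 0) \<phi> (t, x)) (at t within {0..1})"
      by (intro has_vector_derivative_mult_right smooth_deriv(2)[OF \<phi>, THEN has_vector_derivative_at_within])
    show "(\<lambda>x. expi \<xi> x * \<phi> (t, x)) integrable_on cbox 0 1"
      by (intro integrable_continuous continuous_intros smooth_continuous_slice \<phi>)
  next
    show "continuous_on ({0..1} \<times> cbox 0 1) (\<lambda>(t, x). expi \<xi> x * pd (1, 0) \<phi> (t, x))"
      unfolding case_prod_unfold prod.collapse
      by (intro continuous_intros smooth_continuous smooth_pd \<phi>)
  qed (use t in auto)
  moreover have "Fc \<phi> \<xi> = (\<lambda>t. integral {0..1} (\<lambda>x. expi \<xi> x * \<phi> (t, x)))"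
    by (rule ext) (rule Fc_integral[OF \<phi>])
  ultimately show ?thesis by (simp add: Fc_integral[OF smooth_pd[OF \<phi>]])
qed

lemma Fc_continuous: "smooth \<phi> \<Longrightarrow> continuous_on {0..1} (Fc \<phi> \<xi>)"
  by (meson Fc_has_vector_derivative continuous_on_eq_continuous_within has_vector_derivative_continuous)

subsection \<open>The weak equation\<close>

text \<open>Integration by parts in time leaves no boundary terms, as \<open>c\<close> vanishes at
  time 0 and \<open>\<phi>\<close> at time 1. What remains is the residual times
  \<open>Fc \<phi>\<close>, with a factor 2 pi xi from undoing the antiderivative. Decay of order s
  + 2 pays for this factor and for the weight, and leaves the gain 1/|xi| on which
  \<open>resid_weak_limit\<close> relies.\<close>

lemma mode_integral:
  assumes c: "tpoly c" and k: "k > 0" and \<phi>: "smooth \<phi>" "xper \<phi>" and \<phi>1: "\<And>x. \<phi> (1, x) = 0" and \<sigma>: "\<sigma> * \<sigma> = 1" and \<xi>: "\<xi> \<noteq> 0"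
    and C: "C \<ge> 0" "\<And>\<xi> t. \<xi> \<noteq> 0 \<Longrightarrow> t \<in> {0..1} \<Longrightarrow> norm (Fc \<phi> \<xi> t) \<le> C * \<bar>of_int \<xi>\<bar> powr (-(s + 2))"
  shows "norm (integral {0..1} (\<lambda>t. c \<xi> t * Fc (pd (1, 0) \<phi>) \<xi> t + c \<xi> t * Fc ((pd (0, 1) ^^ 3) \<phi>) \<xi> t
      + of_real \<sigma> * (conv k c \<xi> t * Fc (pd (0, 1) \<phi>) \<xi> t)))
    \<le> 2 * pi * C * (supn (resid \<sigma> k c \<xi>) * \<bar>of_int \<xi>\<bar> powr (-s) / \<bar>of_int \<xi>\<bar>)"
proof -
  let ?z = "2 * of_real pi * \<i> * of_int \<xi> :: complex"
  let ?R = "resid \<sigma> k c \<xi>" and ?d = "\<lambda>t. vector_derivative (c \<xi>) (at t)" and ?\<Phi> = "Fc \<phi> \<xi>"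
  have z: "?z \<noteq> 0" using \<xi> by simp
  have \<sigma>c: "complex_of_real \<sigma> * complex_of_real \<sigma> = 1" using \<sigma> by (metis of_real_1 of_real_mult)
  have abs\<sigma>: "\<bar>\<sigma>\<bar> = 1" using \<sigma> by (metis abs_mult_self_eq abs_one abs_mult power2_eq_1_iff power2_eq_square abs_minus)
  have "((\<lambda>t. c \<xi> t * Fc (pd (1, 0) \<phi>) \<xi> t + ?d t * ?\<Phi> t) has_integral (c \<xi> 1 * ?\<Phi> 1 - c \<xi> 0 * ?\<Phi> 0)) {0..1}"
  proof (rule fundamental_theorem_of_calculus)
    show "((\<lambda>t. c \<xi> t * ?\<Phi> t) has_vector_derivative c \<xi> t * Fc (pd (1, 0) \<phi>) \<xi> t + ?d t * ?\<Phi> t) (at t within {0..1})"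
      if "t \<in> {0..1}" for t
      by (rule has_vector_derivative_mult[OF flat_has_vector_derivative[OF tpolyD(3)[OF c], THEN has_vector_derivative_at_within]
            Fc_has_vector_derivative[OF \<phi>(1) that]])
  qed simp
  moreover have "c \<xi> 0 = 0" by (rule flat_nonpos[OF tpolyD(3)[OF c]]) simp
  moreover have "?\<Phi> 1 = 0" by (simp add: Fc_def \<phi>1)
  ultimately have I1: "((\<lambda>t. c \<xi> t * Fc (pd (1, 0) \<phi>) \<xi> t + ?d t * ?\<Phi> t) has_integral 0) {0..1}" by simp
  let ?g = "\<lambda>t. of_real \<sigma> * ?z * ?R t * ?\<Phi> t"
  have gc: "continuous_on {0..1} ?g"
  proof -
    have "continuous_on {0..1} ?R" by (intro flat_continuous resid_flat c k)
    moreover have "continuous_on {0..1} ?\<Phi>" by (rule Fc_continuous[OF \<phi>(1)])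
    ultimately show ?thesis by (intro continuous_intros)
  qed
  have Fx: "Fc (pd (0, 1) \<phi>) \<xi> t = - ?z * ?\<Phi> t" "Fc ((pd (0, 1) ^^ 3) \<phi>) \<xi> t = (- ?z) ^ 3 * ?\<Phi> t" for t
    by (rule Fc_pd_x[OF \<phi>], rule Fc_pd_power[OF \<phi>])
  have alg: "cc * Pt + cc * ((- Z) ^ 3 * P) + S * (cv * (- Z * P)) = (cc * Pt + dd * P) - S * Z * (S * (dd + Z ^ 3 * cc) / Z + cv) * P"
    if "Z \<noteq> 0" "S * S = 1" for cc Pt P S cv dd Z :: complex
  proof -
    have "S * Z * (S * (dd + Z ^ 3 * cc) / Z + cv) = (S * S) * (dd + Z ^ 3 * cc) + S * Z * cv"
      using that(1) by (simp add: field_simps)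
    then show ?thesis using that(2) by (simp add: algebra_simps)
  qed
  have pt: "c \<xi> t * Fc (pd (1, 0) \<phi>) \<xi> t + c \<xi> t * Fc ((pd (0, 1) ^^ 3) \<phi>) \<xi> t + of_real \<sigma> * (conv k c \<xi> t * Fc (pd (0, 1) \<phi>) \<xi> t)
      = (c \<xi> t * Fc (pd (1, 0) \<phi>) \<xi> t + ?d t * ?\<Phi> t) - ?g t" for t
    unfolding Fx resid_def airy_def by (rule alg[OF z \<sigma>c])
  have "integral {0..1} (\<lambda>t. c \<xi> t * Fc (pd (1, 0) \<phi>) \<xi> t + c \<xi> t * Fc ((pd (0, 1) ^^ 3) \<phi>) \<xi> t
      + of_real \<sigma> * (conv k c \<xi> t * Fc (pd (0, 1) \<phi>) \<xi> t)) = 0 - integral {0..1} ?g"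
    unfolding pt by (rule integral_unique[OF has_integral_diff[OF I1 integrable_integral[OF integrable_continuous_real[OF gc]]]])
  also have "norm \<dots> \<le> 2 * pi * C * (supn ?R * \<bar>of_int \<xi>\<bar> powr (-s) / \<bar>of_int \<xi>\<bar>) * (1 - 0)"
    unfolding diff_0 norm_minus_cancel
  proof (rule integral_bound[OF _ gc])
    fix t :: real assume t: "t \<in> {0..1}"
    have x1: "1 \<le> \<bar>real_of_int \<xi>\<bar>" using \<xi> by linarith
    have "norm (?g t) = 2 * pi * \<bar>real_of_int \<xi>\<bar> * (norm (?R t) * norm (?\<Phi> t))"
      using abs\<sigma> by (simp add: norm_mult)
    also have "\<dots> \<le> 2 * pi * \<bar>real_of_int \<xi>\<bar> * (supn ?R * (C * \<bar>of_int \<xi>\<bar> powr (-(s + 2))))"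
      using C t \<xi> by (intro mult_left_mono mult_mono supn_ge supn_nonneg flat_continuous resid_flat c k) auto
    also have "\<bar>real_of_int \<xi>\<bar> powr (-(s + 2)) = \<bar>real_of_int \<xi>\<bar> powr (-s) * (1 / \<bar>real_of_int \<xi>\<bar>\<^sup>2)"
    proof -
      have "\<bar>real_of_int \<xi>\<bar> powr (-(s + 2)) = \<bar>real_of_int \<xi>\<bar> powr (-s) * \<bar>real_of_int \<xi>\<bar> powr (-2)"
        by (subst powr_add[symmetric]) simp
      also have "\<bar>real_of_int \<xi>\<bar> powr (-2) = 1 / \<bar>real_of_int \<xi>\<bar>\<^sup>2"
        using x1 by (simp add: powr_minus_divide)
      finally show ?thesis .
    qed
    also have "2 * pi * \<bar>real_of_int \<xi>\<bar> * (supn ?R * (C * (\<bar>real_of_int \<xi>\<bar> powr (-s) * (1 / \<bar>real_of_int \<xi>\<bar>\<^sup>2))))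
        = 2 * pi * C * (supn ?R * \<bar>of_int \<xi>\<bar> powr (-s) / \<bar>of_int \<xi>\<bar>)"
    proof -
      have *: "2 * pi * y * (S * (C * (P * (1 / y\<^sup>2)))) = 2 * pi * C * (S * P / y)" if "y > 0" for y S P :: real
        using that by (simp add: power2_eq_square)
      show ?thesis by (rule *) (use x1 in linarith)
    qed
    finally show "norm (?g t) \<le> 2 * pi * C * (supn ?R * \<bar>of_int \<xi>\<bar> powr (-s) / \<bar>of_int \<xi>\<bar>)" .
  qed simp
  finally show ?thesis by simp
qed

context cascade
begin

text \<open>Tuples over the support of a partial sum have the same coefficients there as in the
  limit, and for large \<open>n\<close> a tuple of the finite set \<open>F\<close> that is missed
  has a vanishing product in the limit. The difference is thus a tail of the series avoiding
  \<open>F\<close>, and the time-independent majorant \<open>tmaj\<close> makes it small uniformly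
  in \<open>t\<close>.\<close>

lemma tuple_limit:
  assumes C: "C \<ge> 0" and q: "\<And>g t. g \<noteq> 0 \<Longrightarrow> t \<in> {0..1} \<Longrightarrow> norm (q g t :: complex) \<le> C * \<bar>of_int g\<bar> powr (-s)"
    and e: "\<epsilon> > 0"
  shows "\<forall>\<^sub>F n in sequentially. \<forall>t\<in>{0..1}. norm ((\<Sum>\<^sub>\<infinity>\<xi>\<in>nonzero_freqs k. (\<Prod>i<k. sol_coeff (\<xi> i) t) * q (\<Sum>i<k. \<xi> i) t)
     - (\<Sum>\<xi>\<in>{\<xi>\<in>{..<k} \<rightarrow>\<^sub>E supp (psum w n). (\<Sum>i<k. \<xi> i) \<noteq> 0}. (\<Prod>i<k. psum w n (\<xi> i) t) * q (\<Sum>i<k. \<xi> i) t)) \<le> \<epsilon>"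
proof -
  let ?A = "nonzero_freqs k"
  let ?a = "\<lambda>\<xi> t. (\<Prod>i<k. sol_coeff (\<xi> i) t) * q (\<Sum>i<k. \<xi> i) t"
  have al: "norm (?a \<xi> t) \<le> C * tmaj \<xi>" if "\<xi> \<in> ?A" "t \<in> {0..1}" for \<xi> t
  proof -
    have "norm (?a \<xi> t) \<le> supn (\<lambda>t. \<Prod>i<k. sol_coeff (\<xi> i) t) * (C * \<bar>of_int (\<Sum>i<k. \<xi> i)\<bar> powr (-s))"
      unfolding norm_mult using that
      by (intro mult_mono supn_nonneg q supn_ge tuple_coeff_continuous) (auto simp: nonzero_freqs_def)
    then show ?thesis by (simp add: tmaj_def mult_ac)
  qed
  have Cs: "(\<lambda>\<xi>. C * tmaj \<xi>) summable_on ?A" by (intro summable_on_cmult_right tmaj_summable)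
  have "((\<lambda>\<xi>. C * tmaj \<xi>) has_sum (\<Sum>\<^sub>\<infinity>\<xi>\<in>?A. C * tmaj \<xi>)) ?A" using Cs by simp
  then have "\<forall>\<^sub>F F in finite_subsets_at_top ?A. dist (\<Sum>\<xi>\<in>F. C * tmaj \<xi>) (\<Sum>\<^sub>\<infinity>\<xi>\<in>?A. C * tmaj \<xi>) < \<epsilon>"
    unfolding has_sum_def using e by (rule tendstoD)
  then obtain F where F: "finite F" "F \<subseteq> ?A" "dist (\<Sum>\<xi>\<in>F. C * tmaj \<xi>) (\<Sum>\<^sub>\<infinity>\<xi>\<in>?A. C * tmaj \<xi>) < \<epsilon>"
    unfolding eventually_finite_subsets_at_top by blast
  have tail: "(\<Sum>\<^sub>\<infinity>\<xi>\<in>?A - G. C * tmaj \<xi>) \<le> \<epsilon>" if G: "finite G" "F \<subseteq> G" "G \<subseteq> ?A" for G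
  proof -
    have "(\<Sum>\<^sub>\<infinity>\<xi>\<in>?A - G. C * tmaj \<xi>) = (\<Sum>\<^sub>\<infinity>\<xi>\<in>?A. C * tmaj \<xi>) - (\<Sum>\<xi>\<in>G. C * tmaj \<xi>)"
      using infsum_Diff[OF Cs summable_on_finite[OF G(1)] G(3)] G(1) by simp
    also have "(\<Sum>\<xi>\<in>G. C * tmaj \<xi>) \<ge> (\<Sum>\<xi>\<in>F. C * tmaj \<xi>)"
      using G C tmaj_nonneg by (intro sum_mono2) auto
    ultimately show ?thesis using F(3) by (simp add: dist_real_def)
  qed
  obtain N where N: "\<And>\<xi> i n. \<xi> \<in> F \<Longrightarrow> i < k \<Longrightarrow> n \<ge> N \<Longrightarrow> \<bar>\<xi> i\<bar> \<le> int n"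
    using finite_tuples_bound[OF F(1)] by blast
  show ?thesis
  proof (rule eventually_sequentiallyI[of N], intro ballI)
    fix n and t :: real assume n: "N \<le> n" and t: "t \<in> {0..1}"
    let ?T = "{\<xi>\<in>{..<k} \<rightarrow>\<^sub>E supp (psum w n). (\<Sum>i<k. \<xi> i) \<noteq> 0}"
    let ?G = "?T \<union> F"
    have finT: "finite ?T" using finite_tuples[OF tpolyD(1)[OF psum], of k n] by (rule rev_finite_subset) auto
    have TA: "?T \<subseteq> ?A" by (auto simp: nonzero_freqs_def PiE_iff)
    have "(\<Sum>\<xi>\<in>?T. (\<Prod>i<k. psum w n (\<xi> i) t) * q (\<Sum>i<k. \<xi> i) t) = (\<Sum>\<xi>\<in>?T. ?a \<xi> t)"
    proof (rule sum.cong[OF refl])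
      fix \<xi> assume "\<xi> \<in> ?T"
      then have "(\<Prod>i<k. psum w n (\<xi> i) t) = (\<Prod>i<k. sol_coeff (\<xi> i) t)"
        by (intro prod.cong refl) (auto simp: psum_coeff PiE_iff)
      then show "(\<Prod>i<k. psum w n (\<xi> i) t) * q (\<Sum>i<k. \<xi> i) t = ?a \<xi> t" by (simp only:)
    qed
    also have "\<dots> = (\<Sum>\<xi>\<in>?G. ?a \<xi> t)"
    proof (rule sum.mono_neutral_left)
      show "\<forall>\<xi>\<in>?G - ?T. ?a \<xi> t = 0"
      proof
        fix \<xi> assume \<xi>: "\<xi> \<in> ?G - ?T"
        then have \<xi>F: "\<xi> \<in> F" by blast
        then have "\<xi> \<notin> {..<k} \<rightarrow>\<^sub>E supp (psum w n)" "\<xi> \<in> {..<k} \<rightarrow>\<^sub>E UNIV" using F(2) \<xi> by (auto simp: nonzero_freqs_def)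
        then obtain i where i: "i < k" "\<xi> i \<notin> supp (psum w n)" by (auto simp: PiE_iff)
        then have "sol_coeff (\<xi> i) t = 0"
          using psum_eventually[OF N[OF \<xi>F i(1) n]] not_supp[OF i(2), of t] by simp
        then have "(\<Prod>i<k. sol_coeff (\<xi> i) t) = 0" using i(1) by (intro prod_zero) auto
        then show "?a \<xi> t = 0" by (simp only: mult_zero_left)
      qed
    qed (use finT F(1) in auto)
    finally have eq: "(\<Sum>\<xi>\<in>?T. (\<Prod>i<k. psum w n (\<xi> i) t) * q (\<Sum>i<k. \<xi> i) t) = (\<Sum>\<xi>\<in>?G. ?a \<xi> t)" .
    have G: "finite ?G" "?G \<subseteq> ?A" using finT F TA by auto
    have as: "(\<lambda>\<xi>. norm (?a \<xi> t)) summable_on ?A"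
      by (rule summable_on_comparison_test[OF Cs]) (use al[OF _ t] in auto)
    then have sa: "(\<lambda>\<xi>. ?a \<xi> t) summable_on ?A" by (rule abs_summable_summable)
    have e1: "(\<Sum>\<^sub>\<infinity>\<xi>\<in>?A - ?G. ?a \<xi> t) = (\<Sum>\<^sub>\<infinity>\<xi>\<in>?A. ?a \<xi> t) - (\<Sum>\<^sub>\<infinity>\<xi>\<in>?G. ?a \<xi> t)"
      by (rule infsum_Diff[OF sa summable_on_finite[OF G(1)] G(2)])
    have e2: "(\<Sum>\<^sub>\<infinity>\<xi>\<in>?G. ?a \<xi> t) = (\<Sum>\<xi>\<in>?G. ?a \<xi> t)" by (rule infsum_finite[OF G(1)])
    have "(\<Sum>\<^sub>\<infinity>\<xi>\<in>?A. ?a \<xi> t) - (\<Sum>\<xi>\<in>?G. ?a \<xi> t) = (\<Sum>\<^sub>\<infinity>\<xi>\<in>?A - ?G. ?a \<xi> t)"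
      unfolding e1 e2 ..
    also have "norm \<dots> \<le> (\<Sum>\<^sub>\<infinity>\<xi>\<in>?A - ?G. C * tmaj \<xi>)"
    proof (rule norm_infsum_le[OF has_sum_infsum has_sum_infsum])
      show "(\<lambda>\<xi>. ?a \<xi> t) summable_on ?A - ?G" by (rule summable_on_subset_banach[OF sa]) auto
      show "(\<lambda>\<xi>. C * tmaj \<xi>) summable_on ?A - ?G" by (rule summable_on_subset_banach[OF Cs]) auto
    qed (use al[OF _ t] in auto)
    also have "\<dots> \<le> \<epsilon>" by (rule tail[OF G(1) _ G(2)]) auto
    finally show "norm ((\<Sum>\<^sub>\<infinity>\<xi>\<in>?A. ?a \<xi> t) - (\<Sum>\<xi>\<in>?T. (\<Prod>i<k. psum w n (\<xi> i) t) * q (\<Sum>i<k. \<xi> i) t)) \<le> \<epsilon>"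
      unfolding eq .
  qed
qed

text \<open>The weighted residual is only bounded by \<open>K\<close>, and it could escape to ever
  higher frequencies while each single mode tends to zero. With the factor 1/|xi|, frequencies from
  \<open>R\<close> on contribute at most K/R, and the finitely many lower ones vanish in the
  limit.\<close>

lemma resid_weak_limit:
  assumes e: "\<epsilon> > 0"
  shows "\<forall>\<^sub>F n in sequentially. \<forall>F. finite F \<and> 0 \<notin> F \<longrightarrow>
    (\<Sum>\<xi>\<in>F. supn (resid \<sigma> k (psum w n) \<xi>) * \<bar>of_int \<xi>\<bar> powr (-s) / \<bar>of_int \<xi>\<bar>) \<le> \<epsilon>"
proof -
  let ?e = "\<lambda>n \<xi>. supn (resid \<sigma> k (psum w n) \<xi>) * \<bar>real_of_int \<xi>\<bar> powr (-s)"
  have e0: "0 \<le> ?e n \<xi>" for n \<xi>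
    using k by (intro mult_nonneg_nonneg supn_nonneg flat_continuous resid_flat psum) auto
  obtain R :: nat where R: "R > 0" "K / real R < \<epsilon> / 2"
  proof -
    obtain R0 :: nat where "2 * \<bar>K\<bar> / \<epsilon> < real R0" using reals_Archimedean2 by blast
    then have "2 * \<bar>K\<bar> / \<epsilon> < real (Suc R0)" by simp
    then have "K / real (Suc R0) < \<epsilon> / 2" using e by (simp add: field_simps)
    then show ?thesis using that[of "Suc R0"] by blast
  qed
  let ?I = "{- int R..int R} - {0}"
  have "(\<lambda>n. \<Sum>\<xi>\<in>?I. ?e n \<xi>) \<longlonglongrightarrow> (\<Sum>\<xi>\<in>?I. 0 * \<bar>real_of_int \<xi>\<bar> powr (-s))"
    by (intro tendsto_sum tendsto_mult tendsto_const resid_lim) auto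
  then have "\<forall>\<^sub>F n in sequentially. (\<Sum>\<xi>\<in>?I. ?e n \<xi>) < \<epsilon> / 2" using e by (intro order_tendstoD) auto
  then show ?thesis
  proof eventually_elim
    case (elim n)
    show ?case
    proof (intro allI impI)
      fix F :: "int set" assume F: "finite F \<and> 0 \<notin> F"
      have "(\<Sum>\<xi>\<in>F. ?e n \<xi> / \<bar>of_int \<xi>\<bar>) \<le> (\<Sum>\<xi>\<in>F. (if \<xi> \<in> ?I then ?e n \<xi> else 0) + ?e n \<xi> / real R)"
      proof (rule sum_mono)
        fix \<xi> assume "\<xi> \<in> F"
        then have "\<xi> \<noteq> 0" using F by auto
        then have x1: "1 \<le> \<bar>real_of_int \<xi>\<bar>" by linarith
        show "?e n \<xi> / \<bar>of_int \<xi>\<bar> \<le> (if \<xi> \<in> ?I then ?e n \<xi> else 0) + ?e n \<xi> / real R"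
        proof (cases "\<xi> \<in> ?I")
          case True
          have "?e n \<xi> / \<bar>of_int \<xi>\<bar> \<le> ?e n \<xi> / 1" using x1 e0 by (intro divide_left_mono) auto
          moreover have "0 \<le> ?e n \<xi> / real R" using e0 by (intro divide_nonneg_nonneg) auto
          ultimately show ?thesis using True by simp
        next
          case False
          then have "int R \<le> \<bar>\<xi>\<bar>" using \<open>\<xi> \<noteq> 0\<close> by auto
          then have "real R \<le> \<bar>real_of_int \<xi>\<bar>" by linarith
          then have "?e n \<xi> / \<bar>of_int \<xi>\<bar> \<le> ?e n \<xi> / real R" using R e0 by (intro divide_left_mono) auto
          then show ?thesis unfolding if_not_P[OF False] by simp
        qed
      qed
      also have "\<dots> = (\<Sum>\<xi>\<in>F. if \<xi> \<in> ?I then ?e n \<xi> else 0) + (\<Sum>\<xi>\<in>F. ?e n \<xi>) / real R"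
        by (simp add: sum.distrib sum_divide_distrib)
      also have "(\<Sum>\<xi>\<in>F. if \<xi> \<in> ?I then ?e n \<xi> else 0) = (\<Sum>\<xi>\<in>F \<inter> ?I. ?e n \<xi>)"
        using F by (simp add: sum.inter_restrict)
      also have "\<dots> \<le> (\<Sum>\<xi>\<in>?I. ?e n \<xi>)" using e0 by (intro sum_mono2) auto
      also have "\<dots> \<le> \<epsilon> / 2" using elim by simp
      also have "(\<Sum>\<xi>\<in>F. ?e n \<xi>) / real R \<le> K / real R" using F R by (intro divide_right_mono resid_mass) auto
      also have "K / real R \<le> \<epsilon> / 2" using R by simp
      finally show "(\<Sum>\<xi>\<in>F. ?e n \<xi> / \<bar>of_int \<xi>\<bar>) \<le> \<epsilon>" by simp
    qed
  qed
qed

section \<open>Passing to the limit in the weak form\<close>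

definition JN :: "(real \<times> real \<Rightarrow> complex) \<Rightarrow> nat \<Rightarrow> real \<Rightarrow> complex" where
  "JN \<phi> n t = (\<Sum>\<xi>\<in>supp (psum w n). psum w n \<xi> t * Fc (pd (1, 0) \<phi>) \<xi> t)
     + (\<Sum>\<xi>\<in>supp (psum w n). psum w n \<xi> t * Fc ((pd (0, 1) ^^ 3) \<phi>) \<xi> t)
     + of_real \<sigma> * (\<Sum>\<xi>\<in>{\<xi>\<in>{..<k} \<rightarrow>\<^sub>E supp (psum w n). (\<Sum>i<k. \<xi> i) \<noteq> 0}.
         (\<Prod>i<k. psum w n (\<xi> i) t) * Fc (pd (0, 1) \<phi>) (\<Sum>i<k. \<xi> i) t)"

definition J :: "(real \<times> real \<Rightarrow> complex) \<Rightarrow> real \<Rightarrow> complex" where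
  "J \<phi> t = dist_path sol t (\<lambda>x. pd (1, 0) \<phi> (t, x)) + dist_path sol t (\<lambda>x. (pd (0, 1) ^^ 3) \<phi> (t, x))
     + of_real \<sigma> * (\<Sum>\<^sub>\<infinity>\<xi>\<in>nonzero_freqs k. (\<Prod>i<k. sol_coeff (\<xi> i) t) * Fc (pd (0, 1) \<phi>) (\<Sum>i<k. \<xi> i) t)"

lemma JN_continuous:
  assumes "smooth \<phi>"
  shows "continuous_on {0..1} (JN \<phi> n)"
  unfolding JN_def[abs_def]
  by (intro continuous_intros flat_continuous tpolyD[OF psum] Fc_continuous smooth_pd smooth_pd_power assms)

lemma JN_limit:
  assumes \<phi>: "smooth \<phi>" "xper \<phi>" and \<sigma>: "\<bar>\<sigma>\<bar> = 1"
  shows "uniform_limit {0..1} (JN \<phi>) (J \<phi>) sequentially"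
proof (rule uniform_limitI)
  fix \<epsilon> :: real assume e: "\<epsilon> > 0"
  let ?t = "pd (1, 0) \<phi>" and ?h3 = "(pd (0, 1) ^^ 3) \<phi>" and ?x = "pd (0, 1) \<phi>"
  have sm: "smooth ?t" "smooth ?h3" "smooth ?x" using \<phi> smooth_pd smooth_pd_power by auto
  obtain C1 where C1: "C1 \<ge> 0" "\<And>t x. t \<in> {0..1} \<Longrightarrow> x \<in> {0..1} \<Longrightarrow> norm (?t (t, x)) \<le> C1" using smooth_bounded[OF sm(1)] by blast
  obtain C3 where C3: "C3 \<ge> 0" "\<And>t x. t \<in> {0..1} \<Longrightarrow> x \<in> {0..1} \<Longrightarrow> norm (?h3 (t, x)) \<le> C3" using smooth_bounded[OF sm(2)] by blast
  obtain Cx where Cx: "Cx \<ge> 0" "\<And>\<xi> t. \<xi> \<noteq> 0 \<Longrightarrow> t \<in> {0..1} \<Longrightarrow> norm (Fc ?x \<xi> t) \<le> Cx * \<bar>of_int \<xi>\<bar> powr (-s)"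
    using Fc_decay[OF sm(3) xper_pd[OF \<phi>], of s] by blast
  have A: "norm (dist_path sol t (\<lambda>x. \<psi> (t, x)) - (\<Sum>\<xi>\<in>supp (psum w n). psum w n \<xi> t * Fc \<psi> \<xi> t)) \<le> C * (1/8) ^ n"
    if "smooth \<psi>" "\<And>t x. t \<in> {0..1} \<Longrightarrow> x \<in> {0..1} \<Longrightarrow> norm (\<psi> (t, x)) \<le> C" "t \<in> {0..1}" for \<psi> C n t
    using sol_test[OF that(3) smooth_continuous_slice[OF that(1)] that(2)[OF that(3)], of n]
    unfolding LINT_val_mult[OF psum smooth_continuous_slice[OF that(1)] tpolyD(1)[OF psum] order_refl] Fc_def .
  have e3: "\<epsilon> / 4 > 0" using e by simp
  have "\<forall>\<^sub>F n in sequentially. C1 * (1/8) ^ n < \<epsilon> / 4" by (rule order_tendstoD(2)[OF power_eighth_lim e3])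
  moreover have "\<forall>\<^sub>F n in sequentially. C3 * (1/8) ^ n < \<epsilon> / 4" by (rule order_tendstoD(2)[OF power_eighth_lim e3])
  moreover have "\<forall>\<^sub>F n in sequentially. \<forall>t\<in>{0..1}. norm ((\<Sum>\<^sub>\<infinity>\<xi>\<in>nonzero_freqs k. (\<Prod>i<k. sol_coeff (\<xi> i) t) * Fc ?x (\<Sum>i<k. \<xi> i) t)
     - (\<Sum>\<xi>\<in>{\<xi>\<in>{..<k} \<rightarrow>\<^sub>E supp (psum w n). (\<Sum>i<k. \<xi> i) \<noteq> 0}. (\<Prod>i<k. psum w n (\<xi> i) t) * Fc ?x (\<Sum>i<k. \<xi> i) t)) \<le> \<epsilon> / 4"
    by (rule tuple_limit[OF Cx e3])
  ultimately show "\<forall>\<^sub>F n in sequentially. \<forall>t\<in>{0..1}. dist (JN \<phi> n t) (J \<phi> t) < \<epsilon>"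
  proof eventually_elim
    case (elim n)
    show ?case
    proof
      fix t :: real assume t: "t \<in> {0..1}"
      let ?P = "\<Sum>\<^sub>\<infinity>\<xi>\<in>nonzero_freqs k. (\<Prod>i<k. sol_coeff (\<xi> i) t) * Fc ?x (\<Sum>i<k. \<xi> i) t"
      let ?Q = "\<Sum>\<xi>\<in>{\<xi>\<in>{..<k} \<rightarrow>\<^sub>E supp (psum w n). (\<Sum>i<k. \<xi> i) \<noteq> 0}. (\<Prod>i<k. psum w n (\<xi> i) t) * Fc ?x (\<Sum>i<k. \<xi> i) t"
      define P Q where "P = ?P" and "Q = ?Q"
      define a1 b1 a3 b3 where ab: "a1 = dist_path sol t (\<lambda>x. ?t (t, x))" "b1 = (\<Sum>\<xi>\<in>supp (psum w n). psum w n \<xi> t * Fc ?t \<xi> t)"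
        "a3 = dist_path sol t (\<lambda>x. ?h3 (t, x))" "b3 = (\<Sum>\<xi>\<in>supp (psum w n). psum w n \<xi> t * Fc ?h3 \<xi> t)"
      have 1: "norm (a1 - b1) \<le> C1 * (1/8) ^ n" unfolding ab by (rule A[OF sm(1) C1(2) t])
      have 3: "norm (a3 - b3) \<le> C3 * (1/8) ^ n" unfolding ab by (rule A[OF sm(2) C3(2) t])
      have 2: "norm (P - Q) \<le> \<epsilon> / 4" unfolding P_def Q_def using elim(3) t by blast
      have "J \<phi> t - JN \<phi> n t = (a1 - b1) + (a3 - b3) + of_real \<sigma> * (P - Q)"
        unfolding J_def JN_def ab[symmetric] P_def[symmetric] Q_def[symmetric] by (simp add: algebra_simps)
      also have "norm \<dots> \<le> norm (a1 - b1) + norm (a3 - b3) + norm (of_real \<sigma> * (P - Q))"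
        by (intro order_trans[OF norm_triangle_ineq] add_mono order_refl norm_triangle_ineq)
      also have "norm (of_real \<sigma> * (P - Q)) = norm (P - Q)" using \<sigma> by (simp add: norm_mult)
      finally have "norm (J \<phi> t - JN \<phi> n t) < \<epsilon>" using 1 2 3 elim(1,2) e by linarith
      then show "dist (JN \<phi> n t) (J \<phi> t) < \<epsilon>" by (simp add: dist_norm norm_minus_commute)
    qed
  qed
qed

text \<open>Grouping tuples by their sum turns the integrand into a finite sum over nonzero
  frequencies, so that \<open>mode_integral\<close> applies to each mode and
  \<open>resid_weak_limit\<close> to the total.\<close>

lemma JN_integral:
  assumes \<phi>: "smooth \<phi>" "xper \<phi>" "\<And>x. \<phi> (1, x) = 0" and \<sigma>: "\<sigma> * \<sigma> = 1"
  shows "(\<lambda>n. integral {0..1} (JN \<phi> n)) \<longlonglongrightarrow> 0"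
proof (rule tendstoI)
  fix \<epsilon> :: real assume e: "\<epsilon> > 0"
  obtain C where C: "C \<ge> 0" "\<And>\<xi> t. \<xi> \<noteq> 0 \<Longrightarrow> t \<in> {0..1} \<Longrightarrow> norm (Fc \<phi> \<xi> t) \<le> C * \<bar>of_int \<xi>\<bar> powr (-(s + 2))"
    using Fc_decay[OF \<phi>(1,2), of "s + 2"] by blast
  define d where "d = \<epsilon> / (2 * (2 * pi * C + 1))"
  have pC: "2 * pi * C \<ge> 0" using C by simp
  have d: "d > 0" using e pC unfolding d_def by (intro divide_pos_pos mult_pos_pos add_nonneg_pos) auto
  show "\<forall>\<^sub>F n in sequentially. dist (integral {0..1} (JN \<phi> n)) 0 < \<epsilon>"
    using resid_weak_limit[OF d]
  proof eventually_elim
    case (elim n)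
    let ?c = "psum w n"
    let ?T = "{\<xi>\<in>{..<k} \<rightarrow>\<^sub>E supp ?c. (\<Sum>i<k. \<xi> i) \<noteq> 0}"
    let ?S = "\<lambda>\<xi>. \<Sum>i<k. \<xi> i"
    define Y where "Y = supp ?c \<union> ?S ` ?T"
    let ?m = "\<lambda>\<xi> t. ?c \<xi> t * Fc (pd (1, 0) \<phi>) \<xi> t + ?c \<xi> t * Fc ((pd (0, 1) ^^ 3) \<phi>) \<xi> t
      + of_real \<sigma> * (conv k ?c \<xi> t * Fc (pd (0, 1) \<phi>) \<xi> t)"
    have finT: "finite ?T" using finite_tuples[OF tpolyD(1)[OF psum], of k n] by (rule rev_finite_subset) auto
    have Y: "finite Y" "0 \<notin> Y" using finT tpolyD(1,2)[OF psum] by (auto simp: Y_def)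
    have ext: "(\<Sum>\<xi>\<in>supp ?c. ?c \<xi> t * q \<xi>) = (\<Sum>\<xi>\<in>Y. ?c \<xi> t * q \<xi>)" for t and q :: "int \<Rightarrow> complex"
      using Y by (intro sum.mono_neutral_left) (auto simp: Y_def not_supp)
    have tup: "(\<Sum>\<xi>\<in>?T. (\<Prod>i<k. ?c (\<xi> i) t) * q (?S \<xi>)) = (\<Sum>g\<in>Y. conv k ?c g t * q g)" for t and q :: "int \<Rightarrow> complex"
    proof -
      have "(\<Sum>\<xi>\<in>?T. (\<Prod>i<k. ?c (\<xi> i) t) * q (?S \<xi>)) = (\<Sum>g\<in>Y. \<Sum>\<xi>\<in>{\<xi>\<in>?T. ?S \<xi> = g}. (\<Prod>i<k. ?c (\<xi> i) t) * q (?S \<xi>))"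
        by (rule sum.group[symmetric, OF finT Y(1)]) (simp add: Y_def)
      also have "\<dots> = (\<Sum>g\<in>Y. conv k ?c g t * q g)"
      proof (rule sum.cong[OF refl])
        fix g assume "g \<in> Y"
        then have "g \<noteq> 0" using Y(2) by blast
        then have "{\<xi>\<in>?T. ?S \<xi> = g} = {\<xi>\<in>{..<k} \<rightarrow>\<^sub>E supp ?c. ?S \<xi> = g}" by blast
        then show "(\<Sum>\<xi>\<in>{\<xi>\<in>?T. ?S \<xi> = g}. (\<Prod>i<k. ?c (\<xi> i) t) * q (?S \<xi>)) = conv k ?c g t * q g"
          unfolding conv_def sum_distrib_right by (intro sum.cong) auto
      qed
      finally show ?thesis .
    qed
    have tupx: "(\<Sum>\<xi>\<in>?T. (\<Prod>i<k. ?c (\<xi> i) t) * Fc (pd (0, 1) \<phi>) (?S \<xi>) t) = (\<Sum>g\<in>Y. conv k ?c g t * Fc (pd (0, 1) \<phi>) g t)" for t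
      by (rule tup)
    have "JN \<phi> n t = (\<Sum>\<xi>\<in>Y. ?m \<xi> t)" for t
      unfolding JN_def ext tupx by (simp only: sum.distrib sum_distrib_left)
    then have "JN \<phi> n = (\<lambda>t. \<Sum>\<xi>\<in>Y. ?m \<xi> t)" by (rule HOL.ext)
    moreover have "integral {0..1} (\<lambda>t. \<Sum>\<xi>\<in>Y. ?m \<xi> t) = (\<Sum>\<xi>\<in>Y. integral {0..1} (?m \<xi>))"
      using k by (intro Henstock_Kurzweil_Integration.integral_sum Y integrable_continuous_real continuous_intros
          flat_continuous tpolyD[OF psum] conv_flat psum Fc_continuous smooth_pd smooth_pd_power \<phi>) auto
    ultimately have "norm (integral {0..1} (JN \<phi> n)) = norm (\<Sum>\<xi>\<in>Y. integral {0..1} (?m \<xi>))" by (simp only:)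
    also have "\<dots> \<le> (\<Sum>\<xi>\<in>Y. 2 * pi * C * (supn (resid \<sigma> k ?c \<xi>) * \<bar>of_int \<xi>\<bar> powr (-s) / \<bar>of_int \<xi>\<bar>))"
    proof (rule order_trans[OF norm_sum sum_mono])
      fix \<xi> assume "\<xi> \<in> Y"
      then have "\<xi> \<noteq> 0" using Y(2) by blast
      then show "norm (integral {0..1} (?m \<xi>)) \<le> 2 * pi * C * (supn (resid \<sigma> k ?c \<xi>) * \<bar>of_int \<xi>\<bar> powr (-s) / \<bar>of_int \<xi>\<bar>)"
        using k by (intro mode_integral psum \<phi> \<sigma> C) auto
    qed
    also have "\<dots> = 2 * pi * C * (\<Sum>\<xi>\<in>Y. supn (resid \<sigma> k ?c \<xi>) * \<bar>of_int \<xi>\<bar> powr (-s) / \<bar>of_int \<xi>\<bar>)"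
      by (rule sum_distrib_left[symmetric])
    also have "\<dots> \<le> 2 * pi * C * d" using elim Y pC by (intro mult_left_mono) auto
    also have "\<dots> \<le> (2 * pi * C + 1) * d" using d by simp
    also have "\<dots> = \<epsilon> / 2"
    proof -
      have *: "X * (\<epsilon> / (2 * X)) = \<epsilon> / 2" if "X > 0" for X using that by simp
      show ?thesis unfolding d_def by (rule *) (use pC in linarith)
    qed
    also have "\<dots> < \<epsilon>" using e by simp
    finally show "dist (integral {0..1} (JN \<phi> n)) 0 < \<epsilon>" by simp
  qed
qed

lemma J_integral:
  assumes \<phi>: "smooth \<phi>" "xper \<phi>" "\<And>x. \<phi> (1, x) = 0" and \<sigma>: "\<sigma> * \<sigma> = 1"
  shows "(LINT t|lebesgue_on {0..1}. J \<phi> t) = 0"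
proof -
  have abs\<sigma>: "\<bar>\<sigma>\<bar> = 1" using \<sigma> by (metis abs_mult_self_eq abs_one abs_mult power2_eq_1_iff power2_eq_square abs_minus)
  note ul = JN_limit[OF \<phi>(1,2) abs\<sigma>]
  have Jc: "continuous_on {0..1} (J \<phi>)"
    by (rule uniform_limit_theorem[OF always_eventually ul]) (auto intro: JN_continuous \<phi>)
  have "(\<lambda>n. integral {0..1} (JN \<phi> n)) \<longlonglongrightarrow> integral {0..1} (J \<phi>)"
  proof (rule tendstoI)
    fix \<epsilon> :: real assume e: "\<epsilon> > 0"
    have "\<epsilon> / 2 > 0" using e by simp
    from uniform_limitD[OF ul this]
    show "\<forall>\<^sub>F n in sequentially. dist (integral {0..1} (JN \<phi> n)) (integral {0..1} (J \<phi>)) < \<epsilon>"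
    proof eventually_elim
      case (elim n)
      have "integral {0..1} (JN \<phi> n) - integral {0..1} (J \<phi>) = integral {0..1} (\<lambda>t. JN \<phi> n t - J \<phi> t)"
        by (intro Henstock_Kurzweil_Integration.integral_diff[symmetric] integrable_continuous_real JN_continuous Jc \<phi>)
      also have "norm \<dots> \<le> (\<epsilon> / 2) * (1 - 0)"
        by (intro integral_bound continuous_intros JN_continuous Jc \<phi>) (use elim in \<open>auto simp: dist_norm intro: less_imp_le\<close>)
      finally show ?case using e by (simp add: dist_norm)
    qed
  qed
  then have "integral {0..1} (J \<phi>) = 0" using JN_integral[OF \<phi> \<sigma>] LIMSEQ_unique by blast
  then show ?thesis using LINT_eq_integral(2)[OF Jc] by simp
qed

theorem sol_weak:
  assumes \<sigma>: "\<sigma> * \<sigma> = 1"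
  shows "weak_singular_solution \<sigma> k (\<lambda>_. 0) (dist_path sol)"
  unfolding weak_singular_solution_def
proof (intro conjI ballI)
  show "\<exists>r. (\<lambda>_. 0) \<in> sobolev r \<and> Ct_sobolev r (dist_path sol)"
  proof (intro exI conjI)
    show "Ct_sobolev (1/2 - 1/real k - 1) (dist_path sol)" by (rule sol_Ct_sobolev) simp
    show "(\<lambda>_. 0) \<in> sobolev (1/2 - 1/real k - 1)"
      by (auto simp: sobolev_def distribution_def fourier_def intro!: exI[of _ 0])
  qed
  show "\<exists>s'. product_exists k (\<lambda>_. dist_path sol) s'" using sol_product_exists by blast
  fix \<phi> assume "\<phi> \<in> spacetime_test_fun"
  then obtain b where \<phi>: "smooth \<phi>" "xper \<phi>" and b: "b < 1" "\<And>t x. t \<ge> b \<Longrightarrow> \<phi> (t, x) = 0"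
    by (auto simp: spacetime_test_fun_def xper_def)
  have \<phi>1: "\<phi> (1, x) = 0" for x using b(1) by (intro b(2)) simp
  \<comment> \<open>The x-derivatives of a periodic function have mean 0, so the homogeneous
    pairings of the definition become plain ones.\<close>
  have mean: "(LINT y|lebesgue_on {0..1}. (pd (0, 1) ^^ j) \<phi> (t, y)) = 0" if "j > 0" for j t
    using Fc_pd_power[OF \<phi>, of j 0 t] that by (simp add: Fc_def)
  have D1: "D (\<lambda>x. \<phi> (t, x)) = (\<lambda>x. pd (0, 1) \<phi> (t, x))" for t using D_power[OF \<phi>(1), of 1 t] by simp
  have "pairing (dist_path sol t) (\<lambda>x. vector_derivative (\<lambda>\<tau>. \<phi> (\<tau>, x)) (at t))
       + hom_pairing (dist_path sol t) ((D ^^ 3) (\<lambda>x. \<phi> (t, x)))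
       + of_real \<sigma> * hom_pairing (P_nonzero_product k (\<lambda>_. dist_path sol) t) (D (\<lambda>x. \<phi> (t, x))) = J \<phi> t"
    if t: "t \<in> {0..1}" for t
  proof -
    have 1: "vector_derivative (\<lambda>\<tau>. \<phi> (\<tau>, x)) (at t) = pd (1, 0) \<phi> (t, x)" for x
      by (rule vector_derivative_at[OF smooth_deriv(2)[OF \<phi>(1)]])
    show ?thesis
      using mean[of 3 t] mean[of 1 t]
      by (simp add: pairing_def hom_pairing_def 1 D_power[OF \<phi>(1)] D1 P_nonzero_product_def sol_fourier[OF t] dist_of_fun_def J_def Fc_def)
  qed
  then have "(LINT t|lebesgue_on {0..1}. pairing (dist_path sol t) (\<lambda>x. vector_derivative (\<lambda>\<tau>. \<phi> (\<tau>, x)) (at t))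
       + hom_pairing (dist_path sol t) ((D ^^ 3) (\<lambda>x. \<phi> (t, x)))
       + of_real \<sigma> * hom_pairing (P_nonzero_product k (\<lambda>_. dist_path sol) t) (D (\<lambda>x. \<phi> (t, x))))
      = (LINT t|lebesgue_on {0..1}. J \<phi> t)"
    by (intro Bochner_Integration.integral_cong refl) simp
  also have "\<dots> = 0" by (rule J_integral[OF \<phi> \<phi>1 \<sigma>])
  finally show "(LINT t|lebesgue_on {0..1}. pairing (dist_path sol t) (\<lambda>x. vector_derivative (\<lambda>\<tau>. \<phi> (\<tau>, x)) (at t))
       + hom_pairing (dist_path sol t) ((D ^^ 3) (\<lambda>x. \<phi> (t, x)))
       + of_real \<sigma> * hom_pairing (P_nonzero_product k (\<lambda>_. dist_path sol) t) (D (\<lambda>x. \<phi> (t, x))))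
      = - pairing (\<lambda>_. 0) (\<lambda>x. \<phi> (0, x))" by (simp add: pairing_def)
qed

end

theorem theorem1p4:
  fixes \<sigma> :: real
  assumes "\<sigma> \<in> {-1, 1}"
  shows "(\<forall>s::real. s > 3 \<longrightarrow>
           (\<exists>u :: real \<Rightarrow> real \<Rightarrow> real.
              (\<forall>\<epsilon>>0. 2 - \<epsilon> \<ge> 1 \<longrightarrow> Ct_Lp (2 - \<epsilon>) u) \<and>
              (\<exists>t\<in>{0..1}. \<not> zero_ae (u t)) \<and>
              product_exists 2 (\<lambda>_. dist_path u) (- s) \<and>
              weak_singular_solution \<sigma> 2 (\<lambda>_. 0) (dist_path u) \<and>
              zero_ae (u 0))) \<and>
         (\<forall>(k::nat) (s::real). k \<ge> 3 \<and> s > 3 \<longrightarrow>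
           (\<exists>u :: real \<Rightarrow> real \<Rightarrow> real.
              (\<forall>t\<in>{0..1}. integrable (lebesgue_on {0..1}) (u t)) \<and>
              (\<forall>\<epsilon>>0. Ct_sobolev (1/2 - 1 / real k - \<epsilon>) (dist_path u)) \<and>
              (\<exists>t\<in>{0..1}. \<not> zero_ae (u t)) \<and>
              product_exists k (\<lambda>_. dist_path u) (- s) \<and>
              weak_singular_solution \<sigma> k (\<lambda>_. 0) (dist_path u) \<and>
              zero_ae (u 0)))"
proof -
  have \<sigma>: "\<bar>\<sigma>\<bar> \<le> 1" "\<sigma> * \<sigma> = 1" using assms by auto
  \<comment> \<open>One construction serves both claims: the first reads off the L^p statement at k
    = 2, the second the Sobolev statement at k >= 3, where integrability in x ensures that
    \<open>dist_path u\<close> is given by genuine integrals.\<close>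
  have main: "\<exists>u :: real \<Rightarrow> real \<Rightarrow> real.
      (\<forall>p. 1 \<le> p \<and> p < 2 \<longrightarrow> Ct_Lp p u) \<and> (\<forall>t\<in>{0..1}. integrable (lebesgue_on {0..1}) (u t)) \<and>
      (\<forall>r < 1/2 - 1 / real k. Ct_sobolev r (dist_path u)) \<and> (\<exists>t\<in>{0..1}. \<not> zero_ae (u t)) \<and>
      product_exists k (\<lambda>_. dist_path u) (- s) \<and> weak_singular_solution \<sigma> k (\<lambda>_. 0) (dist_path u) \<and> zero_ae (u 0)"
    if k: "k \<ge> 2" and s: "s > 3" for k s
  proof -
    obtain w K where "cascade \<sigma> s K k w" using cascade_exists[OF k less_imp_le[OF s] \<sigma>(1)] by blast
    then interpret cascade \<sigma> s K k w .
    show ?thesis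
      using sol_Ct_Lp sol_integrable sol_Ct_sobolev sol_nonzero sol_product_exists sol_weak[OF \<sigma>(2)]
      by (intro exI[of _ sol] conjI allI impI ballI bexI[of _ 1]) (auto simp: zero_ae_def sol_0)
  qed
  show ?thesis
  proof (intro conjI allI impI)
    fix s :: real assume "s > 3"
    from main[OF order_refl this] obtain u :: "real \<Rightarrow> real \<Rightarrow> real" where
      "\<forall>p. 1 \<le> p \<and> p < 2 \<longrightarrow> Ct_Lp p u" "\<exists>t\<in>{0..1}. \<not> zero_ae (u t)"
      "product_exists 2 (\<lambda>_. dist_path u) (- s)" "weak_singular_solution \<sigma> 2 (\<lambda>_. 0) (dist_path u)" "zero_ae (u 0)"
      by blast
    then show "\<exists>u :: real \<Rightarrow> real \<Rightarrow> real. (\<forall>\<epsilon>>0. 2 - \<epsilon> \<ge> 1 \<longrightarrow> Ct_Lp (2 - \<epsilon>) u) \<and> (\<exists>t\<in>{0..1}. \<not> zero_ae (u t)) \<and>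
        product_exists 2 (\<lambda>_. dist_path u) (- s) \<and> weak_singular_solution \<sigma> 2 (\<lambda>_. 0) (dist_path u) \<and> zero_ae (u 0)"
      by (intro exI[of _ u]) simp
  next
    fix k :: nat and s :: real assume "k \<ge> 3 \<and> s > 3"
    then have "k \<ge> 2" "s > 3" by auto
    from main[OF this] obtain u :: "real \<Rightarrow> real \<Rightarrow> real" where
      "\<forall>t\<in>{0..1}. integrable (lebesgue_on {0..1}) (u t)" "\<forall>r < 1/2 - 1 / real k. Ct_sobolev r (dist_path u)"
      "\<exists>t\<in>{0..1}. \<not> zero_ae (u t)" "product_exists k (\<lambda>_. dist_path u) (- s)"
      "weak_singular_solution \<sigma> k (\<lambda>_. 0) (dist_path u)" "zero_ae (u 0)"
      by blast
    then show "\<exists>u :: real \<Rightarrow> real \<Rightarrow> real. (\<forall>t\<in>{0..1}. integrable (lebesgue_on {0..1}) (u t)) \<and>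
        (\<forall>\<epsilon>>0. Ct_sobolev (1/2 - 1 / real k - \<epsilon>) (dist_path u)) \<and> (\<exists>t\<in>{0..1}. \<not> zero_ae (u t)) \<and>
        product_exists k (\<lambda>_. dist_path u) (- s) \<and> weak_singular_solution \<sigma> k (\<lambda>_. 0) (dist_path u) \<and> zero_ae (u 0)"
      by (intro exI[of _ u]) simp
  qed
qed

end
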